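(* Let $\Bbbk$ be a field of characteristic zero, let $n\geqslant 1$, let $R=\Bbbk[x_1,\ldots,x_n]$ with its standard grading and with the symmetric group $\mathfrak{S}_n$ acting by permuting the variables, and let $\mathfrak{m}=(x_1,\ldots,x_n)$. Suppose $I\subseteq R$ is a nonzero homogeneous $\mathfrak{S}_n$-stable complete intersection ideal. Then the $\mathfrak{S}_n$-representation $I/\mathfrak{m}I$ is isomorphic to one of the following representations: (I) $\bigoplus^m S^{(n)}$, with $1\leqslant m\leqslant n$, i.e., a direct sum of up to $n$ trivial representations; (II) $S^{(1^n)}\oplus\left(\bigoplus^m S^{(n)}\right)$, with $0\leqslant m\leqslant n-1$, i.e., a direct sum of an alternating representation and up to $n-1$ trivial representations; (III) $S^{(n-1,1)}\oplus\left(\bigoplus^m S^{(n)}\right)$, with $0\leqslant m\leqslant 1$, i.e., a direct sum of a standard representation and up to one trivial representation; (IV) for $n=4$, $S^{(2,2)}\oplus\left(\bigoplus^m S^{(4)}\right)$, with $0\leqslant m\leqslant 2$, i.e., a direct sum of the irreducible representation $S^{(2,2)}$ and up to two trivial representations.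
   Context: The group $\mathfrak{S}_n$ acts on $R$ by $\Bbbk$-algebra automorphisms permuting the variables, $\sigma\cdot x_i=x_{\sigma(i)}$. An ideal of $R$ is called a complete intersection ideal if it is generated by a regular sequence. If $I$ is $\mathfrak{S}_n$-stable then so is $\mathfrak{m}I$, and $I/\mathfrak{m}I$ is a finite-dimensional $\mathfrak{S}_n$-representation over $\Bbbk$. For a partition $\lambda$ of $n$, $S^\lambda$ denotes the irreducible representation (Specht module) of $\mathfrak{S}_n$ over $\Bbbk$ associated with $\lambda$, with the convention that $S^{(n)}$ is the trivial representation, $S^{(1^n)}$ is the alternating (sign) representation, and $S^{(n-1,1)}$ is the $(n-1)$-dimensional standard representation (for $n\geqslant 2$; type (III) is considered only when $n\geqslant 2$). Here $(1^n)$ is the partition $(1,\ldots,1)$ with $n$ parts. $\bigoplus^m W$ denotes the direct sum of $m$ copies of $W$. Representations are isomorphic as ungraded representations. *)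

theory Defs
  imports
    Complex_Main
    "HOL-Library.Poly_Mapping"
    "HOL-Library.Cardinality"
    "HOL-Combinatorics.Permutations"
begin

text \<open>
  The index set of the variables is a finite type \<open>'n\<close>; the number \<open>n\<close> of variables is
  \<open>CARD('n)\<close>, and the symmetric group consists of the functions \<open>\<sigma>\<close> with
  \<open>\<sigma> permutes UNIV\<close>, multiplied by composition.
\<close>

section \<open>Ideals and regular sequences\<close>

text \<open>
  Ideals are the submodules of the ring over itself. The locale is not interpreted, because its
  simplification rule \<open>scale_scale\<close> would become associativity of multiplication and loop with
  \<open>ac_simps\<close>.
\<close>

lemma module_times: "module ((*) :: 'a::comm_ring_1 \<Rightarrow> 'a \<Rightarrow> 'a)"
  by standard (simp_all add: algebra_simps)

abbreviation is_ideal :: "'a::comm_ring_1 set \<Rightarrow> bool"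
  where "is_ideal \<equiv> module.subspace (*)"

abbreviation ideal_gen :: "'a::comm_ring_1 set \<Rightarrow> 'a set"
  where "ideal_gen \<equiv> module.span (*)"

definition ideal_prod :: "'a::comm_ring_1 set \<Rightarrow> 'a set \<Rightarrow> 'a set"
  where "ideal_prod I J = ideal_gen {a * b | a b. a \<in> I \<and> b \<in> J}"

definition regular_sequence :: "'a::comm_ring_1 list \<Rightarrow> bool"
  where "regular_sequence fs \<longleftrightarrow>
    (\<forall>i < length fs. \<forall>g. fs ! i * g \<in> ideal_gen (set (take i fs))
                           \<longrightarrow> g \<in> ideal_gen (set (take i fs)))
    \<and> ideal_gen (set fs) \<noteq> UNIV"

definition complete_intersection_ideal :: "'a::comm_ring_1 set \<Rightarrow> bool"
  where "complete_intersection_ideal I \<longleftrightarrow>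
    (\<exists>fs. regular_sequence fs \<and> I = ideal_gen (set fs))"

section \<open>The polynomial ring\<close>

type_synonym ('n, 'k) mpoly = "('n \<Rightarrow>\<^sub>0 nat) \<Rightarrow>\<^sub>0 'k"

definition Var :: "'n \<Rightarrow> ('n, 'k::zero_neq_one) mpoly"
  where "Var i = Poly_Mapping.single (Poly_Mapping.single i 1) 1"

definition monom_deg :: "('n::finite \<Rightarrow>\<^sub>0 nat) \<Rightarrow> nat"
  where "monom_deg a = (\<Sum>i\<in>UNIV. Poly_Mapping.lookup a i)"

definition homogeneous :: "nat \<Rightarrow> ('n::finite, 'k::zero) mpoly \<Rightarrow> bool"
  where "homogeneous d f \<longleftrightarrow> (\<forall>a\<in>Poly_Mapping.keys f. monom_deg a = d)"

definition homogeneous_ideal :: "('n::finite, 'k::comm_ring_1) mpoly set \<Rightarrow> bool"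
  where "homogeneous_ideal I \<longleftrightarrow>
    (\<exists>H. (\<forall>h\<in>H. \<exists>d. homogeneous d h) \<and> I = ideal_gen H)"

definition max_ideal :: "('n::finite, 'k::comm_ring_1) mpoly set"
  where "max_ideal = ideal_gen (range Var)"

text \<open>
  The coefficient of \<open>x\<^sup>a\<close> in \<open>\<sigma> \<cdot> f\<close> is the coefficient of \<open>x\<close> to the power \<open>a \<circ> \<sigma>\<close> in \<open>f\<close>;
  in particular \<open>\<sigma> \<cdot> x\<^sub>i = x\<^bsub>\<sigma>(i)\<^esub>\<close>, see \<open>perm_poly_Var\<close> below.
\<close>

definition perm_poly :: "('n \<Rightarrow> 'n) \<Rightarrow> ('n, 'k::zero) mpoly \<Rightarrow> ('n, 'k) mpoly"
  where "perm_poly \<sigma> = Poly_Mapping.map_key (Poly_Mapping.map_key \<sigma>)"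

definition perm_stable :: "('n, 'k::zero) mpoly set \<Rightarrow> bool"
  where "perm_stable I \<longleftrightarrow> (\<forall>\<sigma>. \<sigma> permutes UNIV \<longrightarrow> (\<forall>f\<in>I. perm_poly \<sigma> f \<in> I))"

lemma lookup_map_key:
  "inj g \<Longrightarrow> Poly_Mapping.lookup (Poly_Mapping.map_key g p) x = Poly_Mapping.lookup p (g x)"
  by (simp add: map_key.rep_eq)

lemma inj_map_key_perm:
  assumes "\<sigma> permutes UNIV"
  shows "inj (Poly_Mapping.map_key \<sigma> :: ('n \<Rightarrow>\<^sub>0 'c::zero) \<Rightarrow> _)"
proof (rule injI)
  fix a b :: "'n \<Rightarrow>\<^sub>0 'c"
  assume eq: "Poly_Mapping.map_key \<sigma> a = Poly_Mapping.map_key \<sigma> b"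
  have inj: "inj \<sigma>" using assms by (rule permutes_inj)
  have "Poly_Mapping.lookup a (\<sigma> x) = Poly_Mapping.lookup b (\<sigma> x)" for x
    using eq lookup_map_key[OF inj] by metis
  then have "Poly_Mapping.lookup a y = Poly_Mapping.lookup b y" for y
    by (metis assms permutes_inverses(1))
  then show "a = b" by (simp add: poly_mapping_eqI)
qed

lemma perm_poly_single:
  assumes "\<sigma> permutes UNIV"
  shows "perm_poly \<sigma> (Poly_Mapping.single (Poly_Mapping.map_key \<sigma> a) c) = Poly_Mapping.single a c"
  unfolding perm_poly_def by (rule map_key_single[OF inj_map_key_perm[OF assms]])

lemma perm_poly_Var:
  assumes "\<sigma> permutes UNIV"
  shows "perm_poly \<sigma> (Var i :: ('n, 'k::zero_neq_one) mpoly) = Var (\<sigma> i)"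
proof -
  have "Poly_Mapping.map_key \<sigma> (Poly_Mapping.single (\<sigma> i) (1::nat)) = Poly_Mapping.single i 1"
    by (rule map_key_single[OF permutes_inj[OF assms]])
  then show ?thesis
    unfolding Var_def by (metis perm_poly_single[OF assms])
qed

lemma perm_poly_const:
  assumes "\<sigma> permutes UNIV"
  shows "perm_poly \<sigma> (Poly_Mapping.single 0 c) = Poly_Mapping.single 0 c"
  using perm_poly_single[OF assms, of 0 c] permutes_inj[OF assms] by simp

lemma perm_poly_add:
  assumes "\<sigma> permutes UNIV"
  shows "perm_poly \<sigma> (f + g) = perm_poly \<sigma> f + perm_poly \<sigma> g"
  unfolding perm_poly_def by (rule map_key_plus[OF inj_map_key_perm[OF assms]])

lemma perm_poly_mult:
  fixes f g :: "('n, 'k::comm_ring_1) mpoly"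
  assumes s: "\<sigma> permutes UNIV"
  shows "perm_poly \<sigma> (f * g) = perm_poly \<sigma> f * perm_poly \<sigma> g"
proof -
  have inj: "inj \<sigma>" using s by (rule permutes_inj)
  have injp: "inj (inv \<sigma>)" using permutes_inv[OF s] by (rule permutes_inj)
  have ex: "\<exists>b. a = Poly_Mapping.map_key \<sigma> b" for a :: "'n \<Rightarrow>\<^sub>0 nat"
  proof
    show "a = Poly_Mapping.map_key \<sigma> (Poly_Mapping.map_key (inv \<sigma>) a)"
      by (rule poly_mapping_eqI)
        (simp add: lookup_map_key inj injp permutes_inverses(2)[OF s])
  qed
  have mon: "perm_poly \<sigma> (Poly_Mapping.single a c * Poly_Mapping.single b d) =
      perm_poly \<sigma> (Poly_Mapping.single a c) * perm_poly \<sigma> (Poly_Mapping.single b d)"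
    for a b :: "'n \<Rightarrow>\<^sub>0 nat" and c d :: 'k
  proof -
    obtain a' b' where ab: "a = Poly_Mapping.map_key \<sigma> a'" "b = Poly_Mapping.map_key \<sigma> b'"
      using ex by meson
    have "a + b = Poly_Mapping.map_key \<sigma> (a' + b')"
      using ab by (simp add: map_key_plus inj)
    then show ?thesis
      by (simp add: mult_single perm_poly_single[OF s] ab)
  qed
  have zero: "perm_poly \<sigma> (0 :: ('n, 'k) mpoly) = 0"
    unfolding perm_poly_def by (rule map_key_zero[OF inj_map_key_perm[OF s]])
  have upd: "Poly_Mapping.update a c p = p + Poly_Mapping.single a c"
    if "a \<notin> Poly_Mapping.keys p" for a c and p :: "('n, 'k) mpoly"
    using that
    by (intro poly_mapping_eqI)
      (auto simp: lookup_update lookup_add lookup_single when_def in_keys_iff)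
  have one: "perm_poly \<sigma> (Poly_Mapping.single a c * g) =
      perm_poly \<sigma> (Poly_Mapping.single a c) * perm_poly \<sigma> g" for a c
    by (induction g rule: update_induct)
      (simp_all add: zero upd distrib_left perm_poly_add[OF s] mon)
  show ?thesis
    by (induction f rule: update_induct)
      (simp_all add: zero upd distrib_right perm_poly_add[OF s] one)
qed

section \<open>Representations of the symmetric group\<close>

definition pm_scale :: "'k::field \<Rightarrow> ('a \<Rightarrow>\<^sub>0 'k) \<Rightarrow> ('a \<Rightarrow>\<^sub>0 'k)"
  where "pm_scale c = Poly_Mapping.map ((*) c)"

lemma lookup_pm_scale: "Poly_Mapping.lookup (pm_scale c p) x = c * Poly_Mapping.lookup p x"
  by (simp add: pm_scale_def map.rep_eq when_def)

lemma pm_scale_conv_mult: "pm_scale c f = Poly_Mapping.single 0 c * f"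
  for f :: "('n, 'k::field) mpoly"
  by (simp add: pm_scale_def mult_map_scale_conv_mult)

global_interpretation pm: vector_space "pm_scale :: 'k::field \<Rightarrow> ('a \<Rightarrow>\<^sub>0 'k) \<Rightarrow> ('a \<Rightarrow>\<^sub>0 'k)"
  by standard
    (auto intro!: poly_mapping_eqI simp: lookup_pm_scale lookup_add algebra_simps)

text \<open>
  A representation on a carrier set; only the values of the operations on elements of the
  carrier and on permutations of \<open>'n\<close> are significant.
\<close>

record ('n, 'k, 'v) rep =
  rep_carrier :: "'v set"
  rep_zero :: 'v
  rep_add :: "'v \<Rightarrow> 'v \<Rightarrow> 'v"
  rep_scale :: "'k \<Rightarrow> 'v \<Rightarrow> 'v"
  rep_act :: "('n \<Rightarrow> 'n) \<Rightarrow> 'v \<Rightarrow> 'v"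

definition rep_iso :: "('n, 'k, 'v) rep \<Rightarrow> ('n, 'k, 'w) rep \<Rightarrow> bool"  (infix \<open>\<cong>\<^sub>R\<close> 50)
  where "V \<cong>\<^sub>R W \<longleftrightarrow> (\<exists>\<phi>.
    bij_betw \<phi> (rep_carrier V) (rep_carrier W) \<and>
    (\<forall>u\<in>rep_carrier V. \<forall>v\<in>rep_carrier V. \<phi> (rep_add V u v) = rep_add W (\<phi> u) (\<phi> v)) \<and>
    (\<forall>c. \<forall>v\<in>rep_carrier V. \<phi> (rep_scale V c v) = rep_scale W c (\<phi> v)) \<and>
    (\<forall>\<sigma>. \<sigma> permutes UNIV \<longrightarrow> (\<forall>v\<in>rep_carrier V. \<phi> (rep_act V \<sigma> v) = rep_act W \<sigma> (\<phi> v))))"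

definition rep_sum :: "('n, 'k, 'v) rep \<Rightarrow> ('n, 'k, 'w) rep \<Rightarrow> ('n, 'k, 'v \<times> 'w) rep"
    (infixr \<open>\<oplus>\<^sub>R\<close> 65)
  where "V \<oplus>\<^sub>R W = \<lparr>
    rep_carrier = rep_carrier V \<times> rep_carrier W,
    rep_zero = (rep_zero V, rep_zero W),
    rep_add = (\<lambda>(v, w) (v', w'). (rep_add V v v', rep_add W w w')),
    rep_scale = (\<lambda>c (v, w). (rep_scale V c v, rep_scale W c w)),
    rep_act = (\<lambda>\<sigma> (v, w). (rep_act V \<sigma> v, rep_act W \<sigma> w)) \<rparr>"

text \<open>
  The direct sum of \<open>m\<close> copies of \<open>V\<close>: families indexed by \<open>{..<m}\<close>, extended by zero so that
  equality of families is equality of functions.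
\<close>

definition rep_power :: "nat \<Rightarrow> ('n, 'k, 'v) rep \<Rightarrow> ('n, 'k, nat \<Rightarrow> 'v) rep"
  where "rep_power m V = \<lparr>
    rep_carrier = {f. (\<forall>i<m. f i \<in> rep_carrier V) \<and> (\<forall>i\<ge>m. f i = rep_zero V)},
    rep_zero = (\<lambda>i. rep_zero V),
    rep_add = (\<lambda>f g i. if i < m then rep_add V (f i) (g i) else rep_zero V),
    rep_scale = (\<lambda>c f i. if i < m then rep_scale V c (f i) else rep_zero V),
    rep_act = (\<lambda>\<sigma> f i. if i < m then rep_act V \<sigma> (f i) else rep_zero V) \<rparr>"

subsection \<open>Quotients of stable ideals\<close>

definition coset :: "'a::plus \<Rightarrow> 'a set \<Rightarrow> 'a set"
  where "coset x K = {x + k | k. k \<in> K}"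

text \<open>
  The representation \<open>I / K\<close> on the set of cosets, for stable ideals \<open>K \<subseteq> I\<close>. Adding \<open>K\<close> in the
  scalar multiplication matters only for the scalar \<open>0\<close>.
\<close>

definition quotient_rep ::
    "('n, 'k::field) mpoly set \<Rightarrow> ('n, 'k) mpoly set \<Rightarrow> ('n, 'k, ('n, 'k) mpoly set) rep"
  where "quotient_rep I K = \<lparr>
    rep_carrier = {coset f K | f. f \<in> I},
    rep_zero = K,
    rep_add = (\<lambda>A B. {a + b | a b. a \<in> A \<and> b \<in> B}),
    rep_scale = (\<lambda>c A. {pm_scale c a + k | a k. a \<in> A \<and> k \<in> K}),
    rep_act = (\<lambda>\<sigma> A. perm_poly \<sigma> ` A) \<rparr>"

lemma quotient_rep_add:
  fixes f g :: "('n, 'k::field) mpoly"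
  assumes "is_ideal K"
  shows "rep_add (quotient_rep I K) (coset f K) (coset g K) = coset (f + g) K"
proof -
  have "\<exists>l. f + k + (g + k') = f + g + l \<and> l \<in> K" if "k \<in> K" "k' \<in> K" for k k'
    using that module.subspace_add[OF module_times assms] by (intro exI[of _ "k + k'"]) (simp add: algebra_simps)
  moreover have "\<exists>a b. f + g + k = a + b \<and> (\<exists>l. a = f + l \<and> l \<in> K) \<and> (\<exists>l. b = g + l \<and> l \<in> K)"
    if "k \<in> K" for k
    using that module.subspace_0[OF module_times assms]
    by (intro exI[of _ "f + k"] exI[of _ g]) (auto simp: algebra_simps intro!: exI[of _ 0])
  ultimately show ?thesis
    unfolding quotient_rep_def coset_def by auto
qed

lemma quotient_rep_scale:
  fixes f :: "('n, 'k::field) mpoly"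
  assumes "is_ideal K"
  shows "rep_scale (quotient_rep I K) c (coset f K) = coset (pm_scale c f) K"
proof -
  have "\<exists>l. pm_scale c (f + k) + k' = pm_scale c f + l \<and> l \<in> K" if "k \<in> K" "k' \<in> K" for k k'
  proof -
    have "pm_scale c k + k' \<in> K"
      unfolding pm_scale_conv_mult using that assms
      by (intro module.subspace_add[OF module_times] module.subspace_scale[OF module_times])
    then show ?thesis
      by (intro exI[of _ "pm_scale c k + k'"]) (simp add: pm.scale_right_distrib)
  qed
  moreover have "\<exists>a k'. pm_scale c f + k = pm_scale c a + k' \<and> (\<exists>l. a = f + l \<and> l \<in> K) \<and> k' \<in> K"
    if "k \<in> K" for k
    using that module.subspace_0[OF module_times assms]
    by (intro exI[of _ f] exI[of _ k]) (auto intro!: exI[of _ 0])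
  ultimately show ?thesis
    unfolding quotient_rep_def coset_def by auto
qed

lemma quotient_rep_act:
  fixes f :: "('n, 'k::field) mpoly"
  assumes s: "\<sigma> permutes UNIV" and K: "perm_stable K"
  shows "rep_act (quotient_rep I K) \<sigma> (coset f K) = coset (perm_poly \<sigma> f) K"
proof -
  have inv: "perm_poly \<sigma> (perm_poly (inv \<sigma>) k) = k" for k :: "('n, 'k) mpoly"
  proof (rule poly_mapping_eqI)
    have "Poly_Mapping.map_key (inv \<sigma>) (Poly_Mapping.map_key \<sigma> a) = a" for a :: "'n \<Rightarrow>\<^sub>0 nat"
      by (rule poly_mapping_eqI)
        (simp add: lookup_map_key permutes_inj[OF s] permutes_inj[OF permutes_inv[OF s]]
          permutes_inverses(1)[OF s])
    then show "Poly_Mapping.lookup (perm_poly \<sigma> (perm_poly (inv \<sigma>) k)) a = Poly_Mapping.lookup k a"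
      for a
      by (simp add: perm_poly_def lookup_map_key inj_map_key_perm s permutes_inv)
  qed
  have 1: "perm_poly \<sigma> k \<in> K" if "k \<in> K" for k
    using K s that unfolding perm_stable_def by blast
  have 2: "perm_poly (inv \<sigma>) k \<in> K" if "k \<in> K" for k
    using K permutes_inv[OF s] that unfolding perm_stable_def by blast
  have "perm_poly \<sigma> ` {f + k | k. k \<in> K} = {perm_poly \<sigma> f + k | k. k \<in> K}"
  proof (intro equalityI subsetI)
    fix y assume "y \<in> perm_poly \<sigma> ` {f + k | k. k \<in> K}"
    then show "y \<in> {perm_poly \<sigma> f + k | k. k \<in> K}"
      using 1 by (auto simp: perm_poly_add[OF s])
  next
    fix y assume "y \<in> {perm_poly \<sigma> f + k | k. k \<in> K}"
    then obtain k where k: "k \<in> K" "y = perm_poly \<sigma> f + k" by blast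
    then have "y = perm_poly \<sigma> (f + perm_poly (inv \<sigma>) k)"
      by (simp add: perm_poly_add[OF s] inv)
    then show "y \<in> perm_poly \<sigma> ` {f + k | k. k \<in> K}"
      using 2[OF k(1)] by blast
  qed
  then show ?thesis
    unfolding quotient_rep_def coset_def by simp
qed

subsection \<open>Specht modules\<close>

text \<open>
  A partition is a weakly decreasing list of positive integers. A tableau is encoded by the
  bijection sending each entry to its cell (row, column); the corresponding tabloid is the
  function sending each entry to its row. The group acts on tableaux and tabloids by
  \<open>\<sigma> \<cdot> t = t \<circ> inv \<sigma>\<close>. The permutation module on tabloids consists of formal linear
  combinations of tabloids, and the Specht module is its subspace spanned by the polytabloids.
\<close>

definition young_cells :: "nat list \<Rightarrow> (nat \<times> nat) set"
  where "young_cells l = {(i, j). i < length l \<and> j < l ! i}"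

definition tableau :: "nat list \<Rightarrow> ('n \<Rightarrow> nat \<times> nat) \<Rightarrow> bool"
  where "tableau l t \<longleftrightarrow> bij_betw t UNIV (young_cells l)"

definition column_stabilizer :: "('n \<Rightarrow> nat \<times> nat) \<Rightarrow> ('n \<Rightarrow> 'n) set"
  where "column_stabilizer t = {\<pi>. \<pi> permutes UNIV \<and> (\<forall>x. snd (t (\<pi> x)) = snd (t x))}"

definition polytabloid :: "('n::finite \<Rightarrow> nat \<times> nat) \<Rightarrow> (('n \<Rightarrow> nat) \<Rightarrow>\<^sub>0 'k::field)"
  where "polytabloid t =
    (\<Sum>\<pi>\<in>column_stabilizer t. Poly_Mapping.single (fst \<circ> t \<circ> inv \<pi>) (of_int (sign \<pi>)))"

text \<open>
  The coefficient of a tabloid \<open>r\<close> in \<open>\<sigma> \<cdot> v\<close> is the coefficient of \<open>r \<circ> \<sigma>\<close> in \<open>v\<close>, so that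
  \<open>\<sigma>\<close> maps the basis element \<open>r\<close> to the basis element \<open>r \<circ> inv \<sigma>\<close>.
\<close>

definition perm_tabloids ::
    "('n \<Rightarrow> 'n) \<Rightarrow> (('n \<Rightarrow> nat) \<Rightarrow>\<^sub>0 'k::zero) \<Rightarrow> (('n \<Rightarrow> nat) \<Rightarrow>\<^sub>0 'k)"
  where "perm_tabloids \<sigma> = Poly_Mapping.map_key (\<lambda>r. r \<circ> \<sigma>)"

definition specht :: "nat list \<Rightarrow> ('n::finite, 'k::field, ('n \<Rightarrow> nat) \<Rightarrow>\<^sub>0 'k) rep"
  where "specht l = \<lparr>
    rep_carrier = pm.span {polytabloid t | t. tableau l t},
    rep_zero = 0,
    rep_add = (+),
    rep_scale = pm_scale,
    rep_act = perm_tabloids \<rparr>"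

lemma perm_tabloids_single:
  assumes s: "\<sigma> permutes UNIV"
  shows "perm_tabloids \<sigma> (Poly_Mapping.single r c) = Poly_Mapping.single (r \<circ> inv \<sigma>) c"
proof -
  have "inj (\<lambda>r :: 'a \<Rightarrow> nat. r \<circ> \<sigma>)"
    by (rule injI) (metis comp_assoc comp_id permutes_inv_o(1)[OF s])
  from map_key_single[OF this, of "r \<circ> inv \<sigma>" c] show ?thesis
    unfolding perm_tabloids_def by (simp add: comp_assoc permutes_inv_o(2)[OF s])
qed

end

theory Submission
  imports Defs
begin

text \<open>
  Let \<open>I\<close> be generated by a regular sequence \<open>f\<^sub>1, \<dots>, f\<^sub>r\<close>, and let \<open>V = I / \<mm>I\<close>. The proof shows that
  every transposition acts on \<open>V\<close> trivially or as a reflection, and then classifies the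
  representations of the symmetric group with this property directly by their roots.

  The eigenspace of a transposition \<open>(a b)\<close> on \<open>V\<close> for the eigenvalue \<open>-1\<close> consists of classes of polynomials
  that are negated by \<open>(a b)\<close>, and these are divisible by \<open>x\<^sub>a - x\<^sub>b\<close>
  (\<open>Var_diff_dvd_diff_perm_poly_transpose\<close>). But two elements of \<open>I\<close> with a common factor
  in \<open>\<mm>\<close> are linearly dependent modulo \<open>\<mm>I\<close> (\<open>common_factor_imp_dependent\<close>): the syzygies of a
  regular sequence have coefficients in \<open>I\<close>, and Cramer's rule applied to the syzygy that comes
  from the common factor puts one of the two elements into \<open>\<mm>I\<close>. So the eigenspace is at most a line,
  spanned by a root of \<open>(a b)\<close>.

  The dimension of \<open>V\<close> is at most \<open>r\<close>, and \<open>r \<le> n\<close> (\<open>regular_sequence_length_le\<close>) because the elements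
  of a regular sequence are algebraically independent and the number of monomials of bounded
  degree limits the number of algebraically independent polynomials. A Nakayama argument gives
  \<open>V \<noteq> 0\<close>.

  If all transpositions act trivially, \<open>V\<close> is a sum of trivial representations. Otherwise \<open>V\<close> is the
  direct sum of its invariants and the span \<open>N\<close> of all roots. For three indices the roots of the
  three transpositions either coincide up to sign or satisfy the relation of the root system
  \<open>A\<^sub>2\<close> (\<open>root_triple\<close>). In the first case all transpositions have the same root and \<open>N\<close> is the sign
  representation. In the second case there remains the question whether disjoint transpositions
  have a common root. If not, the roots satisfy the relations of the differences \<open>e\<^sub>i - e\<^sub>j\<close> and \<open>N\<close> is the
  standard representation; if so, \<open>n = 4\<close> (\<open>root_common_disjoint\<close>) and \<open>N\<close> is the two-dimensional
  representation of \<open>S\<^sub>4\<close>.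

  To identify \<open>N\<close> with a Specht module, an equivariant map from the Specht module to \<open>N\<close> is
  evaluated on one polytabloid. Its value is a nonzero multiple of a root, so the map is onto, and it
  is injective for reasons of dimension (\<open>specht_iso_orbit_span\<close>).
\<close>

section \<open>Regular sequences\<close>

lemmas ideal_base = module.span_base[OF module_times]
lemmas ideal_zero = module.span_zero[OF module_times]
lemmas ideal_add = module.span_add[OF module_times]
lemmas ideal_diff = module.span_diff[OF module_times]
lemmas ideal_scale = module.span_scale[OF module_times]
lemmas ideal_sum = module.span_sum[OF module_times]
lemmas ideal_mono = module.span_mono[OF module_times]
lemmas ideal_minimal = module.span_minimal[OF module_times]
lemmas ideal_is_ideal = module.subspace_span[OF module_times]
lemmas ideal_insert = module.span_breakdown_eq[OF module_times]

lemma regular_sequence_snocD: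
  assumes "regular_sequence (fs @ [f])"
  shows "regular_sequence fs"
    and "\<And>g. f * g \<in> ideal_gen (set fs) \<Longrightarrow> g \<in> ideal_gen (set fs)"
proof -
  have r: "(fs @ [f]) ! i * g \<in> ideal_gen (set (take i (fs @ [f]))) \<Longrightarrow>
      g \<in> ideal_gen (set (take i (fs @ [f])))" if "i < Suc (length fs)" for i g
    using assms that unfolding regular_sequence_def by simp
  show "\<And>g. f * g \<in> ideal_gen (set fs) \<Longrightarrow> g \<in> ideal_gen (set fs)"
    using r[of "length fs"] by simp
  have "ideal_gen (set fs) \<subseteq> ideal_gen (set (fs @ [f]))"
    by (rule ideal_mono) auto
  moreover have "ideal_gen (set (fs @ [f])) \<noteq> UNIV"
    using assms unfolding regular_sequence_def by blast
  ultimately have "ideal_gen (set fs) \<noteq> UNIV"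
    by blast
  moreover have "g \<in> ideal_gen (set (take i fs))"
    if "i < length fs" "fs ! i * g \<in> ideal_gen (set (take i fs))" for i g
    using r[of i g] that by (simp add: nth_append)
  ultimately show "regular_sequence fs"
    unfolding regular_sequence_def by blast
qed

lemma ideal_gen_listE:
  assumes "x \<in> ideal_gen (set fs)"
  obtains c where "x = (\<Sum>i<length fs. c i * fs ! i)"
proof -
  have "\<exists>c. x = (\<Sum>i<length fs. c i * fs ! i)"
    using assms
  proof (induction fs arbitrary: x rule: rev_induct)
    case Nil
    then show ?case by (simp add: module.span_empty[OF module_times])
  next
    case (snoc f fs)
    then obtain k where "x - k * f \<in> ideal_gen (set fs)"
      by (auto simp: ideal_insert)
    then obtain c where c: "x - k * f = (\<Sum>i<length fs. c i * fs ! i)"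
      using snoc.IH by blast
    have "x = (\<Sum>i<length fs. (c(length fs := k)) i * (fs @ [f]) ! i) + k * f"
      using c by (simp add: nth_append algebra_simps)
    then show ?case
      by (intro exI[of _ "c(length fs := k)"]) simp
  qed
  then show ?thesis using that by blast
qed

text \<open>
  The syzygies of a regular sequence are generated by the Koszul relations, hence have their
  coefficients in the ideal. The induction reads off the last coefficient from regularity and
  subtracts the corresponding Koszul relations.
\<close>

lemma regular_sequence_syzygy:
  assumes "regular_sequence fs" and "(\<Sum>i<length fs. c i * fs ! i) = 0" and "i < length fs"
  shows "c i \<in> ideal_gen (set fs)"
  using assms
proof (induction fs arbitrary: c i rule: rev_induct)
  case Nil
  then show ?case by simp
next
  case (snoc f fs)
  let ?r = "length fs"
  have reg: "regular_sequence fs"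
    and nzd: "\<And>g. f * g \<in> ideal_gen (set fs) \<Longrightarrow> g \<in> ideal_gen (set fs)"
    using regular_sequence_snocD[OF snoc.prems(1)] by blast+
  have rel: "(\<Sum>i<?r. c i * fs ! i) + c ?r * f = 0"
    using snoc.prems(2) by (simp add: nth_append)
  then have "f * c ?r = (\<Sum>i<?r. (- c i) * fs ! i)"
    by (simp add: sum_negf algebra_simps eq_neg_iff_add_eq_0)
  also have "\<dots> \<in> ideal_gen (set fs)"
    by (intro ideal_sum ideal_scale ideal_base) auto
  finally have last: "c ?r \<in> ideal_gen (set fs)"
    by (rule nzd)
  then obtain d where d: "c ?r = (\<Sum>i<?r. d i * fs ! i)"
    by (rule ideal_gen_listE)
  have "(\<Sum>i<?r. (c i + d i * f) * fs ! i) = (\<Sum>i<?r. c i * fs ! i) + c ?r * f"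
    unfolding d by (simp add: sum.distrib sum_distrib_left algebra_simps)
  then have "(\<Sum>i<?r. (c i + d i * f) * fs ! i) = 0"
    using rel by simp
  then have first: "c j + d j * f \<in> ideal_gen (set fs)" if "j < ?r" for j
    using snoc.IH[OF reg, of "\<lambda>i. c i + d i * f"] that by blast
  have sub: "ideal_gen (set fs) \<subseteq> ideal_gen (set (fs @ [f]))"
    by (rule ideal_mono) auto
  show ?case
  proof (cases "i < ?r")
    case True
    have "c i + d i * f - d i * f \<in> ideal_gen (set (fs @ [f]))"
    proof (rule ideal_diff)
      show "c i + d i * f \<in> ideal_gen (set (fs @ [f]))"
        using first[OF True] sub by blast
      show "d i * f \<in> ideal_gen (set (fs @ [f]))"
        by (intro ideal_scale ideal_base) auto
    qed
    then show ?thesis by simp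
  next
    case False
    then show ?thesis
      using snoc.prems(3) last sub by (auto simp: less_Suc_eq)
  qed
qed

section \<open>The length of a regular sequence of polynomials\<close>

abbreviation Const :: "'k::zero \<Rightarrow> ('n, 'k) mpoly"
  where "Const \<equiv> Poly_Mapping.single 0"

definition power_products :: "nat \<Rightarrow> nat \<Rightarrow> nat list set"
  where "power_products r D = {as. set as \<subseteq> {..<D} \<and> length as = r}"

definition list_power :: "'a::comm_ring_1 list \<Rightarrow> nat list \<Rightarrow> 'a"
  where "list_power fs as = prod_list (map2 (^) fs as)"

lemma list_power_Cons [simp]: "list_power (f # fs) (a # as) = f ^ a * list_power fs as"
  by (simp add: list_power_def)

lemma power_products_0 [simp]: "power_products 0 D = {[]}"
  by (auto simp: power_products_def)

lemma
  shows finite_power_products: "finite (power_products r D)"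
    and card_power_products: "card (power_products r D) = D ^ r"
  unfolding power_products_def
  using finite_lists_length_eq[of "{..<D}" r] card_lists_length_eq[of "{..<D}" r] by auto

lemma sum_power_products_Suc:
  "(\<Sum>as\<in>power_products (Suc r) D. h as) =
    (\<Sum>a<D. \<Sum>as\<in>power_products r D. h (a # as))"
proof -
  have eq: "power_products (Suc r) D = (\<lambda>(a, as). a # as) ` ({..<D} \<times> power_products r D)"
    by (auto simp: power_products_def length_Suc_conv image_iff)
  have inj: "inj_on (\<lambda>(a, as). a # as) ({..<D} \<times> power_products r D)"
    by (auto simp: inj_on_def)
  show ?thesis
    unfolding eq sum.reindex[OF inj] sum.cartesian_product
    by (simp add: case_prod_unfold)
qed

text \<open>
  Modulo an element of the sequence a polynomial relation loses all terms that involve this element.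
  So by induction on the length of the sequence, applied modulo the first element, the part of
  the relation that does not involve the first element has zero coefficients; the rest is
  divisible by the first element, and the quotient is again a relation because that element is
  regular modulo \<open>J\<close>. A general ideal \<open>J\<close> is needed for this induction.
\<close>

lemma regular_sequence_algebraically_independent:
  fixes fs :: "('n, 'k::field) mpoly list"
  assumes "\<And>i g. i < length fs \<Longrightarrow> fs ! i * g \<in> ideal_gen (J \<union> set (take i fs)) \<Longrightarrow>
      g \<in> ideal_gen (J \<union> set (take i fs))"
    and "ideal_gen (J \<union> set fs) \<noteq> UNIV"
    and "(\<Sum>as\<in>power_products (length fs) D. Const (c as) * list_power fs as) \<in> ideal_gen J"
    and "as \<in> power_products (length fs) D"
  shows "c as = 0"
  using assms
proof (induction fs arbitrary: J c as)
  case Nil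
  have "c [] = 0"
  proof (rule ccontr)
    assume nz: "c [] \<noteq> 0"
    have "Const (c []) \<in> ideal_gen J"
      using Nil.prems(3) by (simp add: list_power_def)
    then have "Const (inverse (c [])) * Const (c []) \<in> ideal_gen J"
      by (rule ideal_scale)
    then have one: "1 \<in> ideal_gen J"
      using nz by (simp add: mult_single)
    have "p \<in> ideal_gen J" for p
      using ideal_scale[OF one, of p] by simp
    then show False
      using Nil.prems(2) by auto
  qed
  then show ?case
    using Nil.prems(4) by simp
next
  case (Cons f fs)
  let ?P = "power_products (length fs) D"
  let ?J = "ideal_gen J"
  let ?Jf = "ideal_gen (insert f J)"
  have un: "J \<union> set (take (Suc i) (f # fs)) = insert f J \<union> set (take i fs)" for i
    by auto
  have reg: "fs ! i * g \<in> ideal_gen (insert f J \<union> set (take i fs)) \<Longrightarrow>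
      g \<in> ideal_gen (insert f J \<union> set (take i fs))" if "i < length fs" for i g
    using Cons.prems(1)[of "Suc i" g] that unfolding un by simp
  have proper: "ideal_gen (insert f J \<union> set fs) \<noteq> UNIV"
    using Cons.prems(2) by simp
  have nzd: "g \<in> ?J" if "f * g \<in> ?J" for g
    using Cons.prems(1)[of 0 g] that by simp
  have key: "\<forall>a<E. \<forall>as\<in>?P. b a as = 0"
    if "(\<Sum>a<E. \<Sum>as\<in>?P. Const (b a as) * (f ^ a * list_power fs as)) \<in> ?J" for E b
    using that
  proof (induction E arbitrary: b)
    case 0
    then show ?case by simp
  next
    case (Suc E)
    define R where "R = (\<Sum>a<E. \<Sum>as\<in>?P. Const (b (Suc a) as) * (f ^ a * list_power fs as))"
    define S where "S = (\<Sum>as\<in>?P. Const (b 0 as) * list_power fs as)"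
    have "(\<Sum>a<Suc E. \<Sum>as\<in>?P. Const (b a as) * (f ^ a * list_power fs as)) = S + f * R"
      unfolding sum.lessThan_Suc_shift R_def S_def
      by (simp add: sum_distrib_left mult_ac)
    then have SR: "S + f * R \<in> ?J"
      using Suc.prems by simp
    have "S + f * R - R * f \<in> ?Jf"
    proof (rule ideal_diff)
      show "S + f * R \<in> ?Jf"
        using SR ideal_mono[of J "insert f J", OF subset_insertI] by (rule subsetD[rotated])
      show "R * f \<in> ?Jf"
        by (intro ideal_scale ideal_base) simp
    qed
    then have "S \<in> ?Jf"
      by (simp add: mult.commute)
    then have b0: "b 0 as = 0" if "as \<in> ?P" for as
      using Cons.IH[OF reg proper, of "b 0"] that unfolding S_def by blast
    then have "S = 0"
      unfolding S_def by simp
    then have "R \<in> ?J"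
      using SR by (simp add: nzd)
    then have "\<forall>a<E. \<forall>as\<in>?P. b (Suc a) as = 0"
      unfolding R_def by (rule Suc.IH)
    then show ?case
      using b0 by (auto simp: less_Suc_eq_0_disj)
  qed
  have "(\<Sum>a<D. \<Sum>as\<in>?P. Const (c (a # as)) * (f ^ a * list_power fs as)) \<in> ?J"
    using Cons.prems(3) by (simp add: sum_power_products_Suc)
  from key[OF this] show ?case
    using Cons.prems(4) by (auto simp: power_products_def length_Suc_conv)
qed

lemma mpoly_induct [case_names monomial add]:
  fixes f :: "('n, 'k::comm_ring_1) mpoly"
  assumes "\<And>a c. P (Poly_Mapping.single a c)"
    and "\<And>f g. P f \<Longrightarrow> P g \<Longrightarrow> P (f + g)"
  shows "P f"
proof (induction f rule: update_induct)
  case const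
  show ?case using assms(1)[of 0 0] by simp
next
  case (update f a c)
  have "Poly_Mapping.update a c f = f + Poly_Mapping.single a c"
    using update.hyps
    by (intro poly_mapping_eqI)
      (auto simp: lookup_update lookup_add lookup_single when_def in_keys_iff)
  then show ?case
    using assms update by simp
qed

text \<open>
  Bounding the degree in each variable separately makes the number of monomials easy to count.
\<close>

definition degrees_le :: "nat \<Rightarrow> ('n, 'k::zero) mpoly \<Rightarrow> bool"
  where "degrees_le e f \<longleftrightarrow> (\<forall>a\<in>Poly_Mapping.keys f. \<forall>i. Poly_Mapping.lookup a i \<le> e)"

lemma degrees_le_mono: "degrees_le e f \<Longrightarrow> e \<le> e' \<Longrightarrow> degrees_le e' f"
  unfolding degrees_le_def using le_trans by blast

lemma degrees_le_mult:
  fixes f g :: "('n, 'k::comm_ring_1) mpoly"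
  assumes "degrees_le d f" "degrees_le e g"
  shows "degrees_le (d + e) (f * g)"
  unfolding degrees_le_def
proof (intro ballI allI)
  fix a i assume "a \<in> Poly_Mapping.keys (f * g)"
  then obtain b c where "a = b + c" "b \<in> Poly_Mapping.keys f" "c \<in> Poly_Mapping.keys g"
    using keys_mult by blast
  then show "Poly_Mapping.lookup a i \<le> d + e"
    using assms unfolding degrees_le_def by (auto simp: lookup_add intro: add_mono)
qed

lemma degrees_le_power:
  fixes f :: "('n, 'k::comm_ring_1) mpoly"
  assumes "degrees_le e f"
  shows "degrees_le (a * e) (f ^ a)"
proof (induction a)
  case 0
  show ?case by (simp add: degrees_le_def)
next
  case (Suc a)
  then show ?case using degrees_le_mult[OF assms Suc] by simp
qed

lemma degrees_le_list_power:
  fixes fs :: "('n, 'k::comm_ring_1) mpoly list"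
  assumes "\<And>f. f \<in> set fs \<Longrightarrow> degrees_le e f"
    and "length as = length fs" and "set as \<subseteq> {..<D}"
  shows "degrees_le (D * (length fs * e)) (list_power fs as)"
  using assms(2,1,3)
proof (induction as fs rule: list_induct2)
  case Nil
  show ?case by (simp add: degrees_le_def list_power_def)
next
  case (Cons a as f fs)
  have "degrees_le (a * e) (f ^ a)"
    using Cons.prems by (intro degrees_le_power) simp
  moreover have "a * e \<le> D * e"
    using Cons.prems by (intro mult_right_mono) auto
  ultimately have "degrees_le (D * e) (f ^ a)"
    by (rule degrees_le_mono)
  then have "degrees_le (D * e + D * (length fs * e)) (f ^ a * list_power fs as)"
    using Cons by (intro degrees_le_mult) auto
  then show ?case by (simp add: algebra_simps)
qed

lemma ex_degrees_le: "\<exists>e. degrees_le e f"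
  for f :: "('n::finite, 'k::zero) mpoly"
proof -
  let ?S = "(\<lambda>(a, i). Poly_Mapping.lookup a i) ` (Poly_Mapping.keys f \<times> UNIV)"
  have "finite ?S" by simp
  then have "Poly_Mapping.lookup a i \<le> Max ?S" if "a \<in> Poly_Mapping.keys f" for a i
    using that by (intro Max_ge) auto
  then show ?thesis unfolding degrees_le_def by blast
qed

lemma ex_degrees_le_list: "\<exists>e. \<forall>f\<in>set fs. degrees_le e f"
  for fs :: "('n::finite, 'k::zero) mpoly list"
proof (induction fs)
  case (Cons f fs)
  then obtain e where "\<forall>f\<in>set fs. degrees_le e f" by blast
  moreover obtain d where "degrees_le d f" using ex_degrees_le by blast
  ultimately show ?case
    by (intro exI[of _ "max d e"]) (auto intro: degrees_le_mono)
qed simp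

lemma degrees_le_span:
  fixes f :: "('n::finite, 'k::field) mpoly"
  assumes "degrees_le e f"
  shows "f \<in> pm.span ((\<lambda>a. Poly_Mapping.single a 1) ` {a. \<forall>i. Poly_Mapping.lookup a i \<le> e})"
proof -
  have "f = (\<Sum>a\<in>Poly_Mapping.keys f. pm_scale (Poly_Mapping.lookup f a) (Poly_Mapping.single a 1))"
    by (rule poly_mapping_eqI)
      (auto simp: lookup_sum lookup_pm_scale lookup_single when_def in_keys_iff if_distrib cong: if_cong)
  also have "\<dots> \<in> pm.span ((\<lambda>a. Poly_Mapping.single a 1) ` {a. \<forall>i. Poly_Mapping.lookup a i \<le> e})"
    using assms unfolding degrees_le_def
    by (intro pm.span_sum pm.span_scale pm.span_base) auto
  finally show ?thesis .
qed

lemma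
  fixes e :: nat
  shows finite_exponents_le: "finite {a :: 'n::finite \<Rightarrow>\<^sub>0 nat. \<forall>i. Poly_Mapping.lookup a i \<le> e}"
    and card_exponents_le:
      "card {a :: 'n \<Rightarrow>\<^sub>0 nat. \<forall>i. Poly_Mapping.lookup a i \<le> e} \<le> Suc e ^ CARD('n)"
proof -
  let ?A = "{a :: 'n \<Rightarrow>\<^sub>0 nat. \<forall>i. Poly_Mapping.lookup a i \<le> e}"
  let ?B = "PiE (UNIV :: 'n set) (\<lambda>_. {..e})"
  have inj: "inj_on Poly_Mapping.lookup ?A"
    by (auto simp: inj_on_def intro: poly_mapping_eqI)
  have sub: "Poly_Mapping.lookup ` ?A \<subseteq> ?B"
    by (auto simp: PiE_def)
  have fin: "finite ?B"
    by (rule finite_PiE) auto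
  show "finite ?A"
    using inj_on_finite[OF inj sub fin] .
  show "card ?A \<le> Suc e ^ CARD('n)"
    using card_inj_on_le[OF inj sub fin] by (simp add: card_PiE)
qed

lemma (in vector_space) independent_family:
  fixes g :: "'i \<Rightarrow> 'b"
  assumes "finite A" and zero: "\<And>c x. (\<Sum>x\<in>A. c x *s g x) = 0 \<Longrightarrow> x \<in> A \<Longrightarrow> c x = 0"
  shows "inj_on g A" and "independent (g ` A)"
proof -
  show inj: "inj_on g A"
  proof (rule inj_onI, rule ccontr)
    fix x y assume xy: "x \<in> A" "y \<in> A" "g x = g y" "x \<noteq> y"
    let ?c = "\<lambda>z. (if z = x then 1 else 0) - (if z = y then 1 else 0) :: 'a"
    have "(\<Sum>z\<in>A. ?c z *s g z) = (\<Sum>z\<in>A. if z = x then g z else 0) - (\<Sum>z\<in>A. if z = y then g z else 0)"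
      unfolding sum_subtractf[symmetric]
      by (intro sum.cong) (auto simp: scale_left_diff_distrib)
    also have "\<dots> = 0" using xy assms(1) by simp
    finally show False using zero[OF _ xy(1), of ?c] xy(4) by simp
  qed
  show "independent (g ` A)"
  proof (rule independent_if_scalars_zero)
    show "finite (g ` A)" using assms(1) by (rule finite_imageI)
    fix h v assume "(\<Sum>x\<in>g ` A. h x *s x) = 0" and v: "v \<in> g ` A"
    then have "(\<Sum>x\<in>A. h (g x) *s g x) = 0"
      by (simp add: sum.reindex[OF inj])
    from zero[OF this] show "h v = 0" using v by auto
  qed
qed

text \<open>
  The \<open>D\<^sup>r\<close> power products of \<open>r\<close> regular elements with exponents below \<open>D\<close> are linearly
  independent and lie in the span of at most \<open>(C D)\<^sup>n\<close> monomials, for a constant \<open>C\<close>; letting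
  \<open>D\<close> grow gives \<open>r \<le> n\<close>.
\<close>

theorem regular_sequence_length_le:
  fixes fs :: "('n::finite, 'k::field) mpoly list"
  assumes reg: "regular_sequence fs"
  shows "length fs \<le> CARD('n)"
proof (rule ccontr)
  let ?r = "length fs" and ?n = "CARD('n)"
  assume "\<not> ?r \<le> ?n"
  then have r: "Suc ?n \<le> ?r" by simp
  obtain e where e: "\<And>f. f \<in> set fs \<Longrightarrow> degrees_le e f"
    using ex_degrees_le_list by blast
  have bound: "D ^ ?r \<le> Suc (D * (?r * e)) ^ ?n" for D
  proof -
    let ?P = "power_products ?r D"
    let ?M = "{a :: 'n \<Rightarrow>\<^sub>0 nat. \<forall>i. Poly_Mapping.lookup a i \<le> D * (?r * e)}"
    have zero: "c as = 0"
      if "(\<Sum>as\<in>?P. Const (c as) * list_power fs as) = 0" "as \<in> ?P" for c as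
      using regular_sequence_algebraically_independent[of fs "{}" c D as] that reg
      ideal_zero[of "{}"] unfolding regular_sequence_def by simp
    note family = pm.independent_family[of ?P "list_power fs", OF finite_power_products]
    have inj: "inj_on (list_power fs) ?P"
      by (rule family(1)) (rule zero, simp_all add: pm_scale_conv_mult)
    have "pm.independent (list_power fs ` ?P)"
      by (rule family(2)) (rule zero, simp_all add: pm_scale_conv_mult)
    moreover have "list_power fs ` ?P \<subseteq> pm.span ((\<lambda>a. Poly_Mapping.single a 1) ` ?M)"
      using degrees_le_list_power[of fs e _ D] e unfolding power_products_def
      by (auto intro!: degrees_le_span)
    ultimately have "card (list_power fs ` ?P) \<le> card ((\<lambda>a. Poly_Mapping.single a (1::'k)) ` ?M)"
      using pm.independent_span_bound finite_exponents_le by blast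
    also have "\<dots> \<le> card ?M"
      by (rule card_image_le[OF finite_exponents_le])
    also have "\<dots> \<le> Suc (D * (?r * e)) ^ ?n"
      by (rule card_exponents_le)
    finally show ?thesis
      by (simp add: card_image[OF inj] card_power_products)
  qed
  define C where "C = Suc (?r * e) ^ ?n"
  define D where "D = Suc C"
  have "D ^ ?n * D \<le> D ^ ?r"
    using power_increasing[OF r, of D] by (simp add: D_def mult.commute)
  also have "\<dots> \<le> Suc (D * (?r * e)) ^ ?n"
    by (rule bound)
  also have "\<dots> \<le> (D * Suc (?r * e)) ^ ?n"
    by (rule power_mono) (auto simp: D_def)
  also have "\<dots> = D ^ ?n * C"
    unfolding C_def by (rule power_mult_distrib)
  finally have "D ^ ?n * D \<le> D ^ ?n * C" .
  moreover have "0 < D ^ ?n"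
    unfolding D_def by (rule zero_less_power) (rule zero_less_Suc)
  ultimately have "D \<le> C"
    by (metis mult_le_cancel1)
  then show False
    unfolding D_def by (rule Suc_n_not_le_n[THEN notE])
qed

section \<open>Minimal generators of complete intersections\<close>

lemma Const_mult: "Const (c * d) = (Const c * Const d :: ('n, 'k::comm_ring_1) mpoly)"
  by (simp add: mult_single)

lemma ideal_Const_cancel:
  fixes f :: "('n, 'k::field) mpoly"
  assumes "is_ideal I" and "Const c * f \<in> I" and "c \<noteq> 0"
  shows "f \<in> I"
proof -
  have "Const (inverse c) * (Const c * f) \<in> I"
    by (rule module.subspace_scale[OF module_times assms(1,2)])
  moreover have "Const (inverse c) * (Const c * f) = f"
    using assms(3) by (simp add: mult_single flip: mult.assoc)
  ultimately show ?thesis by simp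
qed

lemma ex_Const_diff_max_ideal:
  fixes f :: "('n::finite, 'k::comm_ring_1) mpoly"
  shows "\<exists>c. f - Const c \<in> max_ideal"
proof (induction f rule: mpoly_induct)
  case (monomial a c)
  show ?case
  proof (cases "a = 0")
    case True
    then show ?thesis
      by (intro exI[of _ c]) (simp add: max_ideal_def ideal_zero)
  next
    case False
    then obtain i where i: "Poly_Mapping.lookup a i \<noteq> 0"
      by (metis lookup_zero poly_mapping_eqI)
    have "a = (a - Poly_Mapping.single i 1) + Poly_Mapping.single i 1"
      using i by (intro poly_mapping_eqI)
        (auto simp: lookup_add lookup_minus lookup_single when_def)
    then have "Poly_Mapping.single a c =
        Poly_Mapping.single (a - Poly_Mapping.single i 1) c * Var i"
      unfolding Var_def mult_single by simp
    also have "\<dots> \<in> max_ideal"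
      unfolding max_ideal_def by (intro ideal_scale ideal_base) auto
    finally show ?thesis
      by (intro exI[of _ 0]) simp
  qed
next
  case (add f g)
  then obtain c d where "f - Const c \<in> max_ideal" "g - Const d \<in> max_ideal"
    by blast
  then have "(f - Const c) + (g - Const d) \<in> max_ideal"
    unfolding max_ideal_def by (rule ideal_add)
  then show ?case
    by (intro exI[of _ "c + d"]) (simp add: single_add algebra_simps)
qed

lemma max_ideal_lookup_0:
  fixes f :: "('n::finite, 'k::comm_ring_1) mpoly"
  assumes "f \<in> max_ideal"
  shows "Poly_Mapping.lookup f 0 = 0"
  using assms unfolding max_ideal_def
proof (induction f rule: module.span_induct_alt[OF module_times, consumes 1])
  case 1
  show ?case by simp
next
  case (2 g x f)
  then obtain i where x: "x = Var i" by blast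
  have "Poly_Mapping.lookup (g * Var i) 0 = 0"
  proof (rule ccontr)
    assume "Poly_Mapping.lookup (g * Var i) 0 \<noteq> 0"
    then have "0 \<in> Poly_Mapping.keys (g * Var i)"
      by (simp add: in_keys_iff)
    then obtain b where "(0 :: 'n \<Rightarrow>\<^sub>0 nat) = b + Poly_Mapping.single i 1"
      using keys_mult[of g "Var i"] by (auto simp: Var_def)
    then have "Poly_Mapping.lookup (0 :: 'n \<Rightarrow>\<^sub>0 nat) i =
        Poly_Mapping.lookup (b + Poly_Mapping.single i 1) i"
      by (rule arg_cong)
    then have "Poly_Mapping.lookup (0 :: 'n \<Rightarrow>\<^sub>0 nat) i = Poly_Mapping.lookup b i + 1"
      unfolding lookup_add by simp
    then show False by simp
  qed
  then show ?case
    using 2 by (simp add: x lookup_add)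
qed

lemma ideal_prodI: "x \<in> I \<Longrightarrow> y \<in> J \<Longrightarrow> x * y \<in> ideal_prod I J"
  unfolding ideal_prod_def by (intro ideal_base) blast

lemma is_ideal_ideal_prod: "is_ideal (ideal_prod I J)"
  unfolding ideal_prod_def by (rule ideal_is_ideal)

lemma ideal_prod_subset_right: "is_ideal J \<Longrightarrow> ideal_prod I J \<subseteq> J"
  unfolding ideal_prod_def
  by (rule ideal_minimal) (auto intro: module.subspace_scale[OF module_times])

lemma max_ideal_prod_subset: "ideal_prod max_ideal I \<subseteq> max_ideal"
  unfolding ideal_prod_def max_ideal_def
proof (rule ideal_minimal)
  show "{a * b |a b. a \<in> ideal_gen (range Var) \<and> b \<in> I} \<subseteq> ideal_gen (range Var)"
  proof clarify
    fix a b :: "('a, 'b) mpoly"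
    assume "a \<in> ideal_gen (range Var)"
    then show "a * b \<in> ideal_gen (range Var)"
      unfolding mult.commute[of a b] by (rule ideal_scale)
  qed
qed (rule ideal_is_ideal)

lemma max_ideal_prod_gen_listE:
  fixes fs :: "('n::finite, 'k::comm_ring_1) mpoly list"
  assumes "x \<in> ideal_prod max_ideal (ideal_gen (set fs))"
  obtains a where "\<And>i. a i \<in> max_ideal" and "x = (\<Sum>i<length fs. a i * fs ! i)"
proof -
  have "\<exists>a. (\<forall>i. a i \<in> max_ideal) \<and> x = (\<Sum>i<length fs. a i * fs ! i)"
    using assms unfolding ideal_prod_def
  proof (induction x rule: module.span_induct_alt[OF module_times, consumes 1])
    case 1
    show ?case
      by (intro exI[of _ "\<lambda>_. 0"]) (simp add: max_ideal_def ideal_zero)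
  next
    case (2 c x y)
    then obtain u v a where uv: "x = u * v" "u \<in> max_ideal" "v \<in> ideal_gen (set fs)"
      and a: "\<And>i. a i \<in> max_ideal" "y = (\<Sum>i<length fs. a i * fs ! i)"
      by blast
    obtain b where b: "v = (\<Sum>i<length fs. b i * fs ! i)"
      using ideal_gen_listE[OF uv(3)] .
    show ?case
    proof (intro exI[of _ "\<lambda>i. (c * b i) * u + a i"] conjI allI)
      show "c * b i * u + a i \<in> max_ideal" for i
        using uv(2) a(1) unfolding max_ideal_def by (intro ideal_add ideal_scale)
      show "c * x + y = (\<Sum>i<length fs. (c * b i * u + a i) * fs ! i)"
        unfolding uv(1) b a(2)
        by (simp add: sum_distrib_left sum.distrib algebra_simps)
    qed
  qed
  then show ?thesis using that by blast
qed

text \<open>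
  A form of Nakayama's lemma. If \<open>I = \<mm>I\<close> then the first generator is a combination of the
  generators with coefficients in \<open>\<mm>\<close>, which is a syzygy with a coefficient that is a
  unit modulo \<open>\<mm>\<close>.
\<close>

lemma regular_sequence_max_ideal_prod_neq:
  fixes fs :: "('n::finite, 'k::field) mpoly list"
  assumes reg: "regular_sequence fs" and ne: "ideal_gen (set fs) \<noteq> {0}"
  shows "ideal_prod max_ideal (ideal_gen (set fs)) \<noteq> ideal_gen (set fs)"
proof
  let ?I = "ideal_gen (set fs)"
  assume eq: "ideal_prod max_ideal ?I = ?I"
  have len: "0 < length fs"
    using ne by (cases fs) (auto simp: module.span_empty[OF module_times])
  then have "fs ! 0 \<in> ideal_prod max_ideal ?I"
    unfolding eq by (intro ideal_base) simp
  then obtain a where a: "\<And>i. a i \<in> max_ideal" "fs ! 0 = (\<Sum>i<length fs. a i * fs ! i)"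
    using max_ideal_prod_gen_listE by blast
  have "(\<Sum>i<length fs. (a i - (if i = 0 then 1 else 0)) * fs ! i) =
      (\<Sum>i<length fs. a i * fs ! i) - (\<Sum>i<length fs. (if i = 0 then fs ! i else 0))"
    unfolding sum_subtractf[symmetric] by (intro sum.cong) (auto simp: algebra_simps)
  also have "\<dots> = 0"
    using len by (simp flip: a(2))
  finally have "a 0 - (if (0::nat) = 0 then 1 else 0) \<in> ?I"
    using regular_sequence_syzygy[OF reg _ len, of "\<lambda>i. a i - (if i = 0 then 1 else 0)"] by blast
  then have "a 0 - 1 \<in> max_ideal"
    using eq max_ideal_prod_subset by fastforce
  then show False
    using max_ideal_lookup_0[of "a 0 - 1"] max_ideal_lookup_0[OF a(1)[of 0]]
    by (simp add: lookup_minus)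
qed

lemma ideal_gen_mod_max_ideal_prodE:
  fixes fs :: "('n::finite, 'k::field) mpoly list"
  assumes "f \<in> ideal_gen (set fs)"
  obtains a \<alpha> where "f = (\<Sum>i<length fs. a i * fs ! i)" and "\<And>i. a i - Const (\<alpha> i) \<in> max_ideal"
    and "f - (\<Sum>i<length fs. Const (\<alpha> i) * fs ! i) \<in> ideal_prod max_ideal (ideal_gen (set fs))"
proof -
  obtain a where a: "f = (\<Sum>i<length fs. a i * fs ! i)"
    using ideal_gen_listE[OF assms] .
  obtain \<alpha> where \<alpha>: "a i - Const (\<alpha> i) \<in> max_ideal" for i
    using choice[of "\<lambda>i c. a i - Const c \<in> max_ideal"] ex_Const_diff_max_ideal by blast
  have "f - (\<Sum>i<length fs. Const (\<alpha> i) * fs ! i) =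
      (\<Sum>i<length fs. (a i - Const (\<alpha> i)) * fs ! i)"
    unfolding a by (simp add: sum_subtractf algebra_simps)
  also have "\<dots> \<in> ideal_prod max_ideal (ideal_gen (set fs))"
    using \<alpha> by (intro module.subspace_sum[OF module_times is_ideal_ideal_prod] ideal_prodI ideal_base) auto
  finally show ?thesis using that a \<alpha> by blast
qed

text \<open>
  Two minimal generators of a complete intersection are coprime. If \<open>f = h f'\<close> and
  \<open>g = h g'\<close> then \<open>g' f - f' g = 0\<close> is a syzygy, so that modulo \<open>I\<close> the coefficient vectors of
  \<open>f\<close> and \<open>g\<close> become proportional after multiplication by \<open>g'\<close> and \<open>f'\<close>. By Cramer's rule a
  minor \<open>u\<close> of the two coefficient vectors satisfies \<open>u f' \<in> I\<close>, and hence
  \<open>u f \<in> \<mm>I\<close>. Modulo \<open>\<mm>\<close> the minors are constants; if one of them does not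
  vanish then \<open>f \<in> \<mm>I\<close>, and if all vanish then \<open>f\<close> and \<open>g\<close> are linearly dependent
  modulo \<open>\<mm>I\<close>.
\<close>

theorem common_factor_imp_dependent:
  fixes fs :: "('n::finite, 'k::field) mpoly list"
  defines "I \<equiv> ideal_gen (set fs)"
  assumes reg: "regular_sequence fs"
    and h: "h \<in> max_ideal" and f: "h * f' \<in> I" and g: "h * g' \<in> I"
  shows "\<exists>c d. (c \<noteq> 0 \<or> d \<noteq> 0) \<and>
    pm_scale c (h * f') + pm_scale d (h * g') \<in> ideal_prod max_ideal I"
proof -
  let ?K = "ideal_prod max_ideal I"
  let ?s = "\<lambda>\<alpha>. \<Sum>i<length fs. Const (\<alpha> i) * fs ! i"
  have K: "is_ideal ?K" by (rule is_ideal_ideal_prod)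
  note K_add = module.subspace_add[OF module_times K]
    and K_diff = module.subspace_diff[OF module_times K]
    and K_scale = module.subspace_scale[OF module_times K]
  obtain a \<alpha> where a: "h * f' = (\<Sum>i<length fs. a i * fs ! i)"
    and \<alpha>: "\<And>i. a i - Const (\<alpha> i) \<in> max_ideal" and f\<alpha>: "h * f' - ?s \<alpha> \<in> ?K"
    using ideal_gen_mod_max_ideal_prodE[OF f[unfolded I_def]] unfolding I_def by blast
  obtain b \<beta> where b: "h * g' = (\<Sum>i<length fs. b i * fs ! i)"
    and \<beta>: "\<And>i. b i - Const (\<beta> i) \<in> max_ideal" and g\<beta>: "h * g' - ?s \<beta> \<in> ?K"
    using ideal_gen_mod_max_ideal_prodE[OF g[unfolded I_def]] unfolding I_def by blast
  have syz: "g' * a i - f' * b i \<in> I" if "i < length fs" for i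
    unfolding I_def
  proof (rule regular_sequence_syzygy[OF reg _ that])
    have "(\<Sum>i<length fs. (g' * a i - f' * b i) * fs ! i) = g' * (h * f') - f' * (h * g')"
      unfolding a b by (simp add: sum_subtractf sum_distrib_left algebra_simps)
    then show "(\<Sum>i<length fs. (g' * a i - f' * b i) * fs ! i) = 0"
      by (simp add: algebra_simps)
  qed
  show ?thesis
  proof (cases "\<forall>i<length fs. \<forall>j<length fs. \<alpha> i * \<beta> j = \<alpha> j * \<beta> i")
    case proportional: True
    show ?thesis
    proof (cases "\<forall>i<length fs. \<alpha> i = 0")
      case True
      then have "h * f' \<in> ?K"
        using f\<alpha> by simp
      then show ?thesis
        by (intro exI[of _ 1] exI[of _ 0]) simp
    next
      case False
      then obtain i where i: "i < length fs" "\<alpha> i \<noteq> 0" by blast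
      have "Const (\<beta> i) * ?s \<alpha> - Const (\<alpha> i) * ?s \<beta> =
          (\<Sum>j<length fs. Const (\<beta> i * \<alpha> j - \<alpha> i * \<beta> j) * fs ! j)"
        by (simp add: sum_subtractf sum_distrib_left single_diff Const_mult algebra_simps)
      also have "\<dots> = 0"
        using proportional i by (intro sum.neutral) (simp add: mult.commute)
      finally have "Const (\<beta> i) * (h * f') + Const (- \<alpha> i) * (h * g') =
          Const (\<beta> i) * (h * f' - ?s \<alpha>) - Const (\<alpha> i) * (h * g' - ?s \<beta>)"
        by (simp add: algebra_simps single_uminus)
      also have "\<dots> \<in> ?K"
        by (rule K_diff[OF K_scale[OF f\<alpha>] K_scale[OF g\<beta>]])
      finally show ?thesis
        using i by (intro exI[of _ "\<beta> i"] exI[of _ "- \<alpha> i"]) (simp add: pm_scale_conv_mult)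
    qed
  next
    case False
    then obtain i j where ij: "i < length fs" "j < length fs" "\<alpha> i * \<beta> j - \<alpha> j * \<beta> i \<noteq> 0"
      by auto
    let ?u = "a i * b j - a j * b i"
    let ?c = "\<alpha> i * \<beta> j - \<alpha> j * \<beta> i"
    have "b i * (g' * a j - f' * b j) - b j * (g' * a i - f' * b i) \<in> I"
      "a i * (g' * a j - f' * b j) - a j * (g' * a i - f' * b i) \<in> I"
      unfolding I_def
      by (rule ideal_diff; rule ideal_scale; use syz ij in \<open>simp add: I_def\<close>)+
    then have "- (?u * f') \<in> I"
      by (simp add: algebra_simps)
    then have uf: "?u * f' \<in> I"
      using module.span_neg[OF module_times, of "- (?u * f')"] unfolding I_def
      by (simp only: minus_minus)
    have "h * (?u * f') \<in> ?K"
      using h uf by (rule ideal_prodI)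
    moreover have "(?u - Const ?c) * (h * f') \<in> ?K"
    proof (rule ideal_prodI)
      have "?u - Const ?c = b j * (a i - Const (\<alpha> i)) + Const (\<alpha> i) * (b j - Const (\<beta> j))
          - (b i * (a j - Const (\<alpha> j)) + Const (\<alpha> j) * (b i - Const (\<beta> i)))"
        by (simp add: algebra_simps single_diff Const_mult)
      also have "\<dots> \<in> max_ideal"
        using \<alpha> \<beta> unfolding max_ideal_def
        by (intro ideal_diff[OF ideal_add ideal_add] ideal_scale)
      finally show "?u - Const ?c \<in> max_ideal" .
    qed (rule f)
    ultimately have "h * (?u * f') - (?u - Const ?c) * (h * f') \<in> ?K"
      by (rule K_diff)
    then have "Const ?c * (h * f') \<in> ?K"
      by (simp add: algebra_simps)
    then have "h * f' \<in> ?K"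
      using ideal_Const_cancel[OF K] ij(3) by blast
    then show ?thesis
      by (intro exI[of _ 1] exI[of _ 0]) simp
  qed
qed

section \<open>The action of permutations on polynomials\<close>

lemma Var_diff_dvd_diff_perm_poly_transpose:
  fixes f :: "('n::finite, 'k::comm_ring_1) mpoly"
  shows "(Var a - Var b) dvd (f - perm_poly (transpose a b) f)"
proof -
  let ?t = "transpose a b" and ?h = "Var a - Var b :: ('n, 'k) mpoly"
  have t: "?t permutes UNIV"
    by (rule permutes_swap_id) auto
  have mult: "?h dvd (f * g - perm_poly ?t (f * g))"
    if "?h dvd (f - perm_poly ?t f)" "?h dvd (g - perm_poly ?t g)" for f g
  proof -
    have "f * g - perm_poly ?t (f * g) =
        f * (g - perm_poly ?t g) + (f - perm_poly ?t f) * perm_poly ?t g"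
      by (simp add: perm_poly_mult[OF t] algebra_simps)
    then show ?thesis
      using that by simp
  qed
  have const_dvd: "?h dvd (Const c - perm_poly ?t (Const c))" for c
    by (simp add: perm_poly_const[OF t])
  have var: "?h dvd (Var i - perm_poly ?t (Var i))" for i
  proof (cases "i = a \<or> i = b")
    case True
    moreover have "?h dvd (Var b - Var a)"
      by (metis dvd_refl dvd_minus_iff minus_diff_eq)
    ultimately show ?thesis
      by (auto simp: perm_poly_Var[OF t])
  next
    case False
    then show ?thesis by (simp add: perm_poly_Var[OF t])
  qed
  have pow: "?h dvd (Poly_Mapping.single (Poly_Mapping.single i m) 1 -
      perm_poly ?t (Poly_Mapping.single (Poly_Mapping.single i m) 1))" for i m
  proof (induction m)
    case 0
    show ?case using const_dvd[of 1] by (simp only: single_zero)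
  next
    case (Suc m)
    have "Poly_Mapping.single (Poly_Mapping.single i (Suc m)) 1 =
        (Var i :: ('n, 'k) mpoly) * Poly_Mapping.single (Poly_Mapping.single i m) 1"
      by (simp add: Var_def mult_single flip: single_add)
    then show ?case
      using mult[OF var Suc] by simp
  qed
  have mono: "?h dvd (Poly_Mapping.single a c - perm_poly ?t (Poly_Mapping.single a c))" for a c
  proof (induction a arbitrary: c rule: update_induct)
    case const
    show ?case by (rule const_dvd)
  next
    case (update a i m)
    have "Poly_Mapping.update i m a = Poly_Mapping.single i m + a"
      using update.hyps
      by (intro poly_mapping_eqI)
        (auto simp: lookup_update lookup_add lookup_single when_def in_keys_iff)
    then have "Poly_Mapping.single (Poly_Mapping.update i m a) c =
        Poly_Mapping.single (Poly_Mapping.single i m) 1 * Poly_Mapping.single a c"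
      by (simp add: mult_single)
    then show ?case
      using mult[OF pow update.IH] by simp
  qed
  show ?thesis
  proof (induction f rule: mpoly_induct)
    case (monomial a c)
    show ?case by (rule mono)
  next
    case (add f g)
    then have "?h dvd ((f - perm_poly ?t f) + (g - perm_poly ?t g))"
      by (rule dvd_add)
    then show ?case
      by (simp add: perm_poly_add[OF t] algebra_simps)
  qed
qed

lemma perm_poly_comp:
  assumes s: "\<sigma> permutes UNIV" and t: "\<tau> permutes UNIV"
  shows "perm_poly (\<sigma> \<circ> \<tau>) f = perm_poly \<sigma> (perm_poly \<tau> f)"
proof -
  have "Poly_Mapping.map_key (\<sigma> \<circ> \<tau>) a = Poly_Mapping.map_key \<tau> (Poly_Mapping.map_key \<sigma> a)"
    for a :: "'a \<Rightarrow>\<^sub>0 nat"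
    by (rule poly_mapping_eqI)
      (simp add: lookup_map_key permutes_inj[OF s] permutes_inj[OF t] inj_compose)
  then show ?thesis
    by (intro poly_mapping_eqI)
      (simp add: perm_poly_def lookup_map_key inj_map_key_perm s t permutes_compose)
qed

lemma perm_poly_id: "perm_poly id f = f"
proof -
  have "Poly_Mapping.map_key id a = a" for a :: "'a \<Rightarrow>\<^sub>0 nat"
    by (rule poly_mapping_eqI) (simp add: lookup_map_key)
  then show ?thesis
    by (intro poly_mapping_eqI)
      (simp add: perm_poly_def lookup_map_key inj_map_key_perm permutes_id)
qed

lemma perm_poly_pm_scale:
  assumes "\<sigma> permutes UNIV"
  shows "perm_poly \<sigma> (pm_scale c f) = pm_scale c (perm_poly \<sigma> f)"
  using assms
  by (intro poly_mapping_eqI)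
    (simp add: perm_poly_def lookup_map_key inj_map_key_perm lookup_pm_scale)

lemma perm_stable_ideal_gen:
  fixes S :: "('n, 'k::comm_ring_1) mpoly set"
  assumes "\<And>\<sigma> f. \<sigma> permutes UNIV \<Longrightarrow> f \<in> S \<Longrightarrow> perm_poly \<sigma> f \<in> ideal_gen S"
  shows "perm_stable (ideal_gen S)"
  unfolding perm_stable_def
proof (intro allI impI ballI)
  fix \<sigma> :: "'n \<Rightarrow> 'n" and f
  assume s: "\<sigma> permutes UNIV" and "f \<in> ideal_gen S"
  from this(2) show "perm_poly \<sigma> f \<in> ideal_gen S"
  proof (induction f rule: module.span_induct_alt[OF module_times, consumes 1])
    case 1
    have "perm_poly \<sigma> (0 :: ('n, 'k) mpoly) = 0"
      using perm_poly_const[OF s, of 0] by simp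
    then show ?case by (simp add: ideal_zero)
  next
    case (2 c x y)
    then show ?case
      using assms[OF s] by (simp add: perm_poly_add[OF s] perm_poly_mult[OF s] ideal_add ideal_scale)
  qed
qed

lemma perm_stable_max_ideal: "perm_stable (max_ideal :: ('n::finite, 'k::comm_ring_1) mpoly set)"
  unfolding max_ideal_def
proof (rule perm_stable_ideal_gen)
  fix \<sigma> :: "'n \<Rightarrow> 'n" and f :: "('n, 'k) mpoly"
  assume "\<sigma> permutes UNIV" "f \<in> range Var"
  then show "perm_poly \<sigma> f \<in> ideal_gen (range Var)"
    by (auto simp: perm_poly_Var intro: ideal_base)
qed

lemma perm_stable_ideal_prod:
  fixes I J :: "('n, 'k::comm_ring_1) mpoly set"
  assumes "perm_stable I" "perm_stable J"
  shows "perm_stable (ideal_prod I J)"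
  unfolding ideal_prod_def
proof (rule perm_stable_ideal_gen)
  fix \<sigma> :: "'n \<Rightarrow> 'n" and f
  assume s: "\<sigma> permutes UNIV" and "f \<in> {a * b |a b. a \<in> I \<and> b \<in> J}"
  then obtain a b where f: "f = a * b" and "a \<in> I" "b \<in> J" by blast
  then show "perm_poly \<sigma> f \<in> ideal_gen {a * b |a b. a \<in> I \<and> b \<in> J}"
    using assms s unfolding perm_stable_def f perm_poly_mult[OF s]
    by (intro ideal_base) blast
qed

section \<open>Isomorphisms of representations\<close>

definition rep_closed :: "('n, 'k, 'v) rep \<Rightarrow> bool"
  where "rep_closed V \<longleftrightarrow>
    (\<forall>u\<in>rep_carrier V. \<forall>v\<in>rep_carrier V. rep_add V u v \<in> rep_carrier V) \<and>
    (\<forall>c. \<forall>v\<in>rep_carrier V. rep_scale V c v \<in> rep_carrier V) \<and>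
    (\<forall>\<sigma>. \<sigma> permutes UNIV \<longrightarrow> (\<forall>v\<in>rep_carrier V. rep_act V \<sigma> v \<in> rep_carrier V))"

lemma rep_isoI:
  assumes "bij_betw \<phi> (rep_carrier V) (rep_carrier W)"
    and "\<And>u v. u \<in> rep_carrier V \<Longrightarrow> v \<in> rep_carrier V \<Longrightarrow>
      \<phi> (rep_add V u v) = rep_add W (\<phi> u) (\<phi> v)"
    and "\<And>c v. v \<in> rep_carrier V \<Longrightarrow> \<phi> (rep_scale V c v) = rep_scale W c (\<phi> v)"
    and "\<And>\<sigma> v. \<sigma> permutes UNIV \<Longrightarrow> v \<in> rep_carrier V \<Longrightarrow>
      \<phi> (rep_act V \<sigma> v) = rep_act W \<sigma> (\<phi> v)"
  shows "V \<cong>\<^sub>R W"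
  unfolding rep_iso_def using assms by blast

lemma rep_isoE:
  assumes "V \<cong>\<^sub>R W"
  obtains \<phi> where "bij_betw \<phi> (rep_carrier V) (rep_carrier W)"
    and "\<And>u v. u \<in> rep_carrier V \<Longrightarrow> v \<in> rep_carrier V \<Longrightarrow>
      \<phi> (rep_add V u v) = rep_add W (\<phi> u) (\<phi> v)"
    and "\<And>c v. v \<in> rep_carrier V \<Longrightarrow> \<phi> (rep_scale V c v) = rep_scale W c (\<phi> v)"
    and "\<And>\<sigma> v. \<sigma> permutes UNIV \<Longrightarrow> v \<in> rep_carrier V \<Longrightarrow>
      \<phi> (rep_act V \<sigma> v) = rep_act W \<sigma> (\<phi> v)"
  using assms unfolding rep_iso_def by blast

lemma rep_iso_trans:
  assumes "V \<cong>\<^sub>R W" "W \<cong>\<^sub>R X"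
  shows "V \<cong>\<^sub>R X"
proof -
  obtain \<phi> where \<phi>: "bij_betw \<phi> (rep_carrier V) (rep_carrier W)"
    and \<phi>': "\<And>u v. u \<in> rep_carrier V \<Longrightarrow> v \<in> rep_carrier V \<Longrightarrow>
      \<phi> (rep_add V u v) = rep_add W (\<phi> u) (\<phi> v)"
     "\<And>c v. v \<in> rep_carrier V \<Longrightarrow> \<phi> (rep_scale V c v) = rep_scale W c (\<phi> v)"
     "\<And>\<sigma> v. \<sigma> permutes UNIV \<Longrightarrow> v \<in> rep_carrier V \<Longrightarrow>
      \<phi> (rep_act V \<sigma> v) = rep_act W \<sigma> (\<phi> v)"
    using rep_isoE[OF assms(1)] by blast
  obtain \<psi> where \<psi>: "bij_betw \<psi> (rep_carrier W) (rep_carrier X)"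
    and \<psi>': "\<And>u v. u \<in> rep_carrier W \<Longrightarrow> v \<in> rep_carrier W \<Longrightarrow>
      \<psi> (rep_add W u v) = rep_add X (\<psi> u) (\<psi> v)"
     "\<And>c v. v \<in> rep_carrier W \<Longrightarrow> \<psi> (rep_scale W c v) = rep_scale X c (\<psi> v)"
     "\<And>\<sigma> v. \<sigma> permutes UNIV \<Longrightarrow> v \<in> rep_carrier W \<Longrightarrow>
      \<psi> (rep_act W \<sigma> v) = rep_act X \<sigma> (\<psi> v)"
    using rep_isoE[OF assms(2)] by blast
  have mem: "\<phi> v \<in> rep_carrier W" if "v \<in> rep_carrier V" for v
    using bij_betwE[OF \<phi>] that by blast
  show ?thesis
    by (rule rep_isoI[of "\<psi> \<circ> \<phi>"]) (simp_all add: \<phi>' \<psi>' mem bij_betw_trans[OF \<phi> \<psi>])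
qed

lemma rep_iso_sym:
  assumes "V \<cong>\<^sub>R W" and closed: "rep_closed V"
  shows "W \<cong>\<^sub>R V"
proof -
  obtain \<phi> where \<phi>: "bij_betw \<phi> (rep_carrier V) (rep_carrier W)"
    and hom: "\<And>u v. u \<in> rep_carrier V \<Longrightarrow> v \<in> rep_carrier V \<Longrightarrow>
      \<phi> (rep_add V u v) = rep_add W (\<phi> u) (\<phi> v)"
     "\<And>c v. v \<in> rep_carrier V \<Longrightarrow> \<phi> (rep_scale V c v) = rep_scale W c (\<phi> v)"
     "\<And>\<sigma> v. \<sigma> permutes UNIV \<Longrightarrow> v \<in> rep_carrier V \<Longrightarrow>
      \<phi> (rep_act V \<sigma> v) = rep_act W \<sigma> (\<phi> v)"
    using rep_isoE[OF assms(1)] by blast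
  let ?\<psi> = "the_inv_into (rep_carrier V) \<phi>"
  have inj: "inj_on \<phi> (rep_carrier V)"
    using \<phi> by (rule bij_betw_imp_inj_on)
  have left: "?\<psi> (\<phi> v) = v" if "v \<in> rep_carrier V" for v
    using the_inv_into_f_f[OF inj that] .
  have ex: "\<exists>v\<in>rep_carrier V. w = \<phi> v" if "w \<in> rep_carrier W" for w
    using bij_betw_imp_surj_on[OF \<phi>] that by blast
  show ?thesis
  proof (rule rep_isoI[of ?\<psi>])
    show "bij_betw ?\<psi> (rep_carrier W) (rep_carrier V)"
      using \<phi> by (rule bij_betw_the_inv_into)
  next
    fix u v assume "u \<in> rep_carrier W" "v \<in> rep_carrier W"
    then show "?\<psi> (rep_add W u v) = rep_add V (?\<psi> u) (?\<psi> v)"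
      using ex[of u] ex[of v] closed unfolding rep_closed_def
      by (metis hom(1) left)
  next
    fix c v assume "v \<in> rep_carrier W"
    then show "?\<psi> (rep_scale W c v) = rep_scale V c (?\<psi> v)"
      using ex[of v] closed unfolding rep_closed_def by (metis hom(2) left)
  next
    fix \<sigma> :: "'a \<Rightarrow> 'a" and v assume "\<sigma> permutes UNIV" "v \<in> rep_carrier W"
    then show "?\<psi> (rep_act W \<sigma> v) = rep_act V \<sigma> (?\<psi> v)"
      using ex[of v] closed unfolding rep_closed_def by (metis hom(3) left)
  qed
qed

lemma rep_iso_sum:
  assumes "V \<cong>\<^sub>R V'" "W \<cong>\<^sub>R W'"
  shows "V \<oplus>\<^sub>R W \<cong>\<^sub>R V' \<oplus>\<^sub>R W'"
proof -
  obtain \<phi> where \<phi>: "bij_betw \<phi> (rep_carrier V) (rep_carrier V')"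
    and \<phi>': "\<And>u v. u \<in> rep_carrier V \<Longrightarrow> v \<in> rep_carrier V \<Longrightarrow>
      \<phi> (rep_add V u v) = rep_add V' (\<phi> u) (\<phi> v)"
     "\<And>c v. v \<in> rep_carrier V \<Longrightarrow> \<phi> (rep_scale V c v) = rep_scale V' c (\<phi> v)"
     "\<And>\<sigma> v. \<sigma> permutes UNIV \<Longrightarrow> v \<in> rep_carrier V \<Longrightarrow>
      \<phi> (rep_act V \<sigma> v) = rep_act V' \<sigma> (\<phi> v)"
    using rep_isoE[OF assms(1)] by blast
  obtain \<psi> where \<psi>: "bij_betw \<psi> (rep_carrier W) (rep_carrier W')"
    and \<psi>': "\<And>u v. u \<in> rep_carrier W \<Longrightarrow> v \<in> rep_carrier W \<Longrightarrow>
      \<psi> (rep_add W u v) = rep_add W' (\<psi> u) (\<psi> v)"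
     "\<And>c v. v \<in> rep_carrier W \<Longrightarrow> \<psi> (rep_scale W c v) = rep_scale W' c (\<psi> v)"
     "\<And>\<sigma> v. \<sigma> permutes UNIV \<Longrightarrow> v \<in> rep_carrier W \<Longrightarrow>
      \<psi> (rep_act W \<sigma> v) = rep_act W' \<sigma> (\<psi> v)"
    using rep_isoE[OF assms(2)] by blast
  show ?thesis
    by (rule rep_isoI[of "map_prod \<phi> \<psi>"])
      (auto simp: rep_sum_def \<phi>' \<psi>' bij_betw_map_prod[OF \<phi> \<psi>])
qed

lemma rep_closed_sum: "rep_closed V \<Longrightarrow> rep_closed W \<Longrightarrow> rep_closed (V \<oplus>\<^sub>R W)"
  unfolding rep_closed_def rep_sum_def by auto

lemma rep_closed_power: "rep_closed V \<Longrightarrow> rep_closed (rep_power m V)"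
  unfolding rep_closed_def rep_power_def by auto

section \<open>Linear actions of the symmetric group\<close>

locale linear_perm_action = vector_space scale
  for scale :: "'k::field_char_0 \<Rightarrow> 'v::ab_group_add \<Rightarrow> 'v" (infixr \<open>*s\<close> 75) +
  fixes act :: "('n::finite \<Rightarrow> 'n) \<Rightarrow> 'v \<Rightarrow> 'v"
  assumes act_add: "\<sigma> permutes UNIV \<Longrightarrow> act \<sigma> (x + y) = act \<sigma> x + act \<sigma> y"
    and act_scale: "\<sigma> permutes UNIV \<Longrightarrow> act \<sigma> (c *s x) = c *s act \<sigma> x"
    and act_id: "act id x = x"
    and act_comp: "\<sigma> permutes UNIV \<Longrightarrow> \<tau> permutes UNIV \<Longrightarrow> act (\<sigma> \<circ> \<tau>) x = act \<sigma> (act \<tau> x)"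
begin

abbreviation perms :: "('n \<Rightarrow> 'n) set"
  where "perms \<equiv> {\<sigma>. \<sigma> permutes UNIV}"

definition stable :: "'v set \<Rightarrow> bool"
  where "stable U \<longleftrightarrow> (\<forall>\<sigma>. \<sigma> permutes UNIV \<longrightarrow> (\<forall>x\<in>U. act \<sigma> x \<in> U))"

definition subrep :: "'v set \<Rightarrow> ('n, 'k, 'v) rep"
  where "subrep U = \<lparr>rep_carrier = U, rep_zero = 0, rep_add = (+), rep_scale = scale, rep_act = act\<rparr>"

lemma subrep_simps [simp]:
  "rep_carrier (subrep U) = U" "rep_zero (subrep U) = 0" "rep_add (subrep U) = (+)"
  "rep_scale (subrep U) = scale" "rep_act (subrep U) = act"
  by (simp_all add: subrep_def)

lemma stableD: "stable U \<Longrightarrow> \<sigma> permutes UNIV \<Longrightarrow> x \<in> U \<Longrightarrow> act \<sigma> x \<in> U"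
  unfolding stable_def by blast

lemma rep_closed_subrep: "subspace U \<Longrightarrow> stable U \<Longrightarrow> rep_closed (subrep U)"
  unfolding rep_closed_def by (auto intro: subspace_add subspace_scale stableD)

lemma linear_act: "\<sigma> permutes UNIV \<Longrightarrow> module_hom scale scale (act \<sigma>)"
  by standard (simp_all add: act_add act_scale)

lemmas act_zero = module_hom.zero[OF linear_act]
lemmas act_neg = module_hom.neg[OF linear_act]
lemmas act_diff = module_hom.diff[OF linear_act]
lemmas act_sum = module_hom.sum[OF linear_act]

lemma act_inv_act:
  assumes "\<sigma> permutes UNIV"
  shows "act (inv \<sigma>) (act \<sigma> x) = x"
  using act_comp[OF permutes_inv[OF assms] assms] permutes_inv_o[OF assms] act_id by metis

lemma act_act_inv:
  assumes "\<sigma> permutes UNIV"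
  shows "act \<sigma> (act (inv \<sigma>) x) = x"
  using act_comp[OF assms permutes_inv[OF assms]] permutes_inv_o[OF assms] act_id by metis

lemma finite_perms: "finite perms"
  by (rule finite_permutations) simp

lemma card_perms_neq_0: "(of_nat (card perms) :: 'k) \<noteq> 0"
proof -
  have "perms \<noteq> {}" using permutes_id by blast
  then have "card perms \<noteq> 0" using finite_perms by (simp only: card_0_eq not_False_eq_True)
  then show ?thesis unfolding of_nat_eq_0_iff .
qed

lemma sum_perms_left:
  assumes "\<tau> permutes UNIV"
  shows "(\<Sum>\<sigma>\<in>perms. h (\<tau> \<circ> \<sigma>)) = (\<Sum>\<sigma>\<in>perms. h \<sigma>)"
  using setum_permutations_compose_left[OF assms] by metis

lemma sum_perms_right:
  assumes "\<tau> permutes UNIV"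
  shows "(\<Sum>\<sigma>\<in>perms. h (\<sigma> \<circ> \<tau>)) = (\<Sum>\<sigma>\<in>perms. h \<sigma>)"
  using sum_permutations_compose_right[OF assms] by metis

definition total :: "'v \<Rightarrow> 'v"
  where "total x = (\<Sum>\<sigma>\<in>perms. act \<sigma> x)"

lemma linear_total: "module_hom scale scale total"
  by standard (simp_all add: total_def act_add act_scale sum.distrib scale_sum_right)

lemma act_total:
  assumes "\<tau> permutes UNIV"
  shows "act \<tau> (total x) = total x"
  unfolding total_def act_sum[OF assms] using sum_perms_left[OF assms, of "\<lambda>\<sigma>. act \<sigma> x"]
  by (simp add: act_comp[OF assms])

lemma total_act:
  assumes "\<tau> permutes UNIV"
  shows "total (act \<tau> x) = total x"
  unfolding total_def using sum_perms_right[OF assms, of "\<lambda>\<sigma>. act \<sigma> x"]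
  by (simp add: act_comp[OF _ assms])

lemma total_fixed:
  assumes "\<And>\<sigma>. \<sigma> permutes UNIV \<Longrightarrow> act \<sigma> x = x"
  shows "total x = of_nat (card perms) *s x"
  unfolding total_def using assms by (simp add: sum_constant_scale)

lemma total_mem:
  assumes "subspace U" "stable U" "x \<in> U"
  shows "total x \<in> U"
  unfolding total_def using assms by (auto intro: subspace_sum stableD)

text \<open>Maschke's theorem: averaging a linear projection onto \<open>K\<close> makes its kernel stable.\<close>

lemma ex_stable_complement:
  assumes I: "subspace I" "stable I" and K: "subspace K" "stable K" "K \<subseteq> I"
  obtains U where "subspace U" "stable U" "U \<subseteq> I" "U \<inter> K \<subseteq> {0}" "\<forall>x\<in>I. \<exists>u\<in>U. x - u \<in> K"
proof -
  interpret pair: vector_space_pair scale scale by standard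
  have "\<exists>g. range g \<subseteq> K \<and> Vector_Spaces.linear scale scale g \<and> (\<forall>v\<in>K. g (id v) = v)"
    by (rule pair.linear_exists_left_inverse_on[OF linear_id K(1) inj_on_id])
  then obtain g where g: "\<And>x. g x \<in> K" "Vector_Spaces.linear scale scale g" "\<And>x. x \<in> K \<Longrightarrow> g x = x"
    by auto
  interpret g: Vector_Spaces.linear scale scale g by fact
  let ?c = "inverse (of_nat (card perms)) :: 'k"
  define P where "P x = ?c *s (\<Sum>\<sigma>\<in>perms. act \<sigma> (g (act (inv \<sigma>) x)))" for x
  have inv: "inv \<sigma> permutes UNIV" if "\<sigma> permutes UNIV" for \<sigma> :: "'n \<Rightarrow> 'n"
    using that by (rule permutes_inv)
  interpret P: module_hom scale scale P
    by standard
      (simp_all add: P_def act_add act_scale inv g.add g.scale sum.distrib scale_right_distrib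
        scale_sum_right mult.commute)
  have PK: "P x \<in> K" for x
    unfolding P_def using K g(1) by (intro subspace_scale subspace_sum) (auto intro: stableD)
  have Pid: "P x = x" if "x \<in> K" for x
  proof -
    have "act \<sigma> (g (act (inv \<sigma>) x)) = x" if s: "\<sigma> permutes UNIV" for \<sigma>
      using g(3)[OF stableD[OF K(2) inv[OF s] \<open>x \<in> K\<close>]] act_act_inv[OF s] by simp
    then have "P x = ?c *s (\<Sum>\<sigma>\<in>perms. x)"
      unfolding P_def by simp
    then show ?thesis
      using card_perms_neq_0 by (simp add: sum_constant_scale)
  qed
  have Pact: "P (act \<tau> x) = act \<tau> (P x)" if t: "\<tau> permutes UNIV" for \<tau> x
  proof -
    have "(\<Sum>\<sigma>\<in>perms. act \<sigma> (g (act (inv \<sigma>) (act \<tau> x)))) =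
        (\<Sum>\<sigma>\<in>perms. act (\<tau> \<circ> \<sigma>) (g (act (inv (\<tau> \<circ> \<sigma>)) (act \<tau> x))))"
      by (rule sum_perms_left[OF t, symmetric])
    also have "\<dots> = (\<Sum>\<sigma>\<in>perms. act \<tau> (act \<sigma> (g (act (inv \<sigma>) x))))"
    proof (rule sum.cong)
      fix \<sigma> :: "'n \<Rightarrow> 'n" assume "\<sigma> \<in> perms"
      then have s: "\<sigma> permutes UNIV" by simp
      have "inv (\<tau> \<circ> \<sigma>) = inv \<sigma> \<circ> inv \<tau>"
        using s t by (intro o_inv_distrib) (auto intro: permutes_bij)
      then have "act (inv (\<tau> \<circ> \<sigma>)) (act \<tau> x) = act (inv \<sigma>) x"
        by (simp add: act_comp inv s t act_inv_act)
      then show "act (\<tau> \<circ> \<sigma>) (g (act (inv (\<tau> \<circ> \<sigma>)) (act \<tau> x))) = act \<tau> (act \<sigma> (g (act (inv \<sigma>) x)))"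
        by (simp add: act_comp s t)
    qed simp
    finally show ?thesis
      unfolding P_def by (simp add: act_scale[OF t] act_sum[OF t])
  qed
  show ?thesis
  proof (rule that[of "I \<inter> {x. P x = 0}"])
    show "subspace (I \<inter> {x. P x = 0})"
      using I(1) P.subspace_kernel by (rule subspace_inter)
    show "stable (I \<inter> {x. P x = 0})"
      using I(2) unfolding stable_def by (simp add: Pact act_zero)
    show "I \<inter> {x. P x = 0} \<inter> K \<subseteq> {0}"
      using Pid by auto
    show "\<forall>x\<in>I. \<exists>u\<in>I \<inter> {x. P x = 0}. x - u \<in> K"
    proof
      fix x assume "x \<in> I"
      then have "x - P x \<in> I \<inter> {x. P x = 0}"
        using PK[of x] K(3) I(1) Pid[OF PK] by (auto simp: P.diff intro: subspace_diff)
      then show "\<exists>u\<in>I \<inter> {x. P x = 0}. x - u \<in> K"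
        using PK by (intro bexI[of _ "x - P x"]) auto
    qed
  qed simp
qed

lemma internal_direct_sum_iso:
  assumes "subspace N" "subspace M" "N \<inter> M \<subseteq> {0}"
    and "U = {x + y | x y. x \<in> N \<and> y \<in> M}"
  shows "subrep N \<oplus>\<^sub>R subrep M \<cong>\<^sub>R subrep U"
proof (rule rep_isoI[of "\<lambda>(x, y). x + y"])
  have "inj_on (\<lambda>(x, y). x + y) (N \<times> M)"
  proof (rule inj_onI, clarify)
    fix x y x' y' assume *: "x \<in> N" "y \<in> M" "x' \<in> N" "y' \<in> M" "x + y = x' + y'"
    then have "x - x' = y' - y" by (simp add: algebra_simps)
    moreover have "x - x' \<in> N" "y' - y \<in> M"
      using * assms by (auto intro: subspace_diff)
    ultimately have "x - x' \<in> N \<inter> M" "y' - y \<in> N \<inter> M" by auto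
    then have "x - x' = 0" "y' - y = 0"
      using assms(3) by blast+
    then show "x = x' \<and> y = y'" by simp
  qed
  then show "bij_betw (\<lambda>(x, y). x + y) (rep_carrier (subrep N \<oplus>\<^sub>R subrep M)) (rep_carrier (subrep U))"
    unfolding bij_betw_def assms(4) by (auto simp: rep_sum_def image_iff)
qed (auto simp: rep_sum_def scale_right_distrib act_add)

lemma independent_Un:
  assumes "independent E" "finite E" "E \<subseteq> N" "independent B" "finite B" "B \<subseteq> M"
    and "subspace N" "subspace M" "N \<inter> M \<subseteq> {0}"
  shows "independent (E \<union> B)" and "card (E \<union> B) = card E + card B"
proof -
  have disj: "E \<inter> B = {}"
  proof (rule ccontr)
    assume "E \<inter> B \<noteq> {}"
    then obtain x where x: "x \<in> E" "x \<in> B" by blast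
    then have "x = 0" using assms by blast
    then show False using x(1) assms(1) dependent_zero by blast
  qed
  then show "card (E \<union> B) = card E + card B"
    using assms by (intro card_Un_disjoint)
  show "independent (E \<union> B)"
  proof (rule independent_if_scalars_zero)
    show "finite (E \<union> B)" using assms by simp
    fix u x assume 0: "(\<Sum>v\<in>E \<union> B. u v *s v) = 0" and x: "x \<in> E \<union> B"
    let ?e = "\<Sum>v\<in>E. u v *s v" and ?b = "\<Sum>v\<in>B. u v *s v"
    have eb: "?e + ?b = 0"
      using 0 sum.union_disjoint[OF assms(2,5) disj] by metis
    have "?e \<in> N" "?b \<in> M"
      using assms by (auto intro!: subspace_sum intro: subspace_scale)
    moreover have "?e = - ?b" using eb by (simp add: eq_neg_iff_add_eq_0)
    ultimately have "?e \<in> N \<inter> M" using assms(8) by (auto intro: subspace_neg)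
    then have e: "?e = 0" using assms(9) by blast
    then have b: "?b = 0" using eb by simp
    show "u x = 0"
      using x independentD[OF assms(1,2) subset_refl e] independentD[OF assms(4,5) subset_refl b]
      by blast
  qed
qed

definition invariants :: "'v set \<Rightarrow> 'v set"
  where "invariants U = {x \<in> U. \<forall>\<sigma>. \<sigma> permutes UNIV \<longrightarrow> act \<sigma> x = x}"

lemma subspace_invariants: "subspace U \<Longrightarrow> subspace (invariants U)"
  unfolding invariants_def
  by (rule subspaceI)
    (auto simp: act_zero act_add act_scale intro: subspace_0 subspace_add subspace_scale)

definition orbit_span :: "'v \<Rightarrow> 'v set"
  where "orbit_span x = span {act \<sigma> x | \<sigma>. \<sigma> permutes UNIV}"

lemma act_mem_orbit_span: "\<sigma> permutes UNIV \<Longrightarrow> act \<sigma> x \<in> orbit_span x"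
  unfolding orbit_span_def by (auto intro: span_base)

lemma subspace_orbit_span: "subspace (orbit_span x)"
  unfolding orbit_span_def by (rule subspace_span)

lemma stable_span:
  assumes "\<And>\<sigma> x. \<sigma> permutes UNIV \<Longrightarrow> x \<in> A \<Longrightarrow> act \<sigma> x \<in> span A"
  shows "stable (span A)"
  unfolding stable_def
proof (intro allI impI ballI)
  fix \<sigma> :: "'n \<Rightarrow> 'n" and x assume s: "\<sigma> permutes UNIV" and "x \<in> span A"
  from this(2) show "act \<sigma> x \<in> span A"
    using assms[OF s] s
    by (induction x rule: span_induct_alt)
      (auto simp: act_zero act_add act_scale intro: span_zero span_add span_scale)
qed

lemma stable_orbit_span: "stable (orbit_span x)"
  unfolding orbit_span_def
proof (rule stable_span)
  fix \<sigma> :: "'n \<Rightarrow> 'n" and y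
  assume s: "\<sigma> permutes UNIV" and "y \<in> {act \<sigma> x |\<sigma>. \<sigma> permutes UNIV}"
  then obtain \<tau> where t: "\<tau> permutes UNIV" "y = act \<tau> x" by blast
  then have "act \<sigma> y = act (\<sigma> \<circ> \<tau>) x" by (simp add: act_comp s)
  then show "act \<sigma> y \<in> span {act \<sigma> x |\<sigma>. \<sigma> permutes UNIV}"
    using permutes_compose[OF t(1) s] by (auto intro: span_base)
qed

lemma orbit_span_subset: "subspace U \<Longrightarrow> stable U \<Longrightarrow> x \<in> U \<Longrightarrow> orbit_span x \<subseteq> U"
  unfolding orbit_span_def by (rule span_minimal) (auto intro: stableD)

lemma total_orbit_span:
  assumes "total x = 0" and "y \<in> orbit_span x"
  shows "total y = 0"
  using assms(2) unfolding orbit_span_def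
  by (rule module_hom.eq_0_on_span[OF linear_total, rotated]) (auto simp: total_act assms(1))

text \<open>
  The sum over the group kills the orbit of \<open>x\<close>, but multiplies an invariant vector by the order
  of the group.
\<close>

lemma orbit_span_Int_invariants:
  assumes "total x = 0"
  shows "orbit_span x \<inter> invariants U \<subseteq> {0}"
proof
  fix y assume y: "y \<in> orbit_span x \<inter> invariants U"
  then have "of_nat (card perms) *s y = 0"
    using total_orbit_span[OF assms, of y] total_fixed[of y] unfolding invariants_def by force
  then show "y \<in> {0}" using card_perms_neq_0 scale_eq_0_iff by blast
qed

end

section \<open>Representations in which transpositions act as reflections\<close>

context linear_perm_action
begin

abbreviation swap :: "'n \<Rightarrow> 'n \<Rightarrow> 'v \<Rightarrow> 'v"
  where "swap a b \<equiv> act (transpose a b)"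

lemma transpose_permutes: "transpose a b permutes (UNIV :: 'n set)"
  by (rule permutes_swap_id) auto

lemmas swap_add = act_add[OF transpose_permutes]
lemmas swap_diff = act_diff[OF transpose_permutes]
lemmas swap_neg = act_neg[OF transpose_permutes]
lemmas swap_scale = act_scale[OF transpose_permutes]
lemmas swap_zero = act_zero[OF transpose_permutes]

lemma swap_swap [simp]: "swap a b (swap a b x) = x"
  using act_comp[OF transpose_permutes[of a b] transpose_permutes[of a b]] act_id
  by (metis transpose_comp_involutory)

lemma swap_commute: "swap a b = swap b a"
  by (simp add: transpose_commute)

lemma act_swap:
  assumes "\<sigma> permutes UNIV"
  shows "act \<sigma> (swap a b x) = swap (\<sigma> a) (\<sigma> b) (act \<sigma> x)"
proof -
  have "\<sigma> \<circ> transpose a b = transpose (\<sigma> a) (\<sigma> b) \<circ> \<sigma>"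
    using permutes_inj[OF assms] by (auto simp: fun_eq_iff transpose_def inj_eq)
  then show ?thesis
    by (metis act_comp assms transpose_permutes)
qed

lemma neq_minus_self: "x \<noteq> 0 \<Longrightarrow> x \<noteq> - x" for x :: 'v
proof
  assume "x \<noteq> 0" "x = - x"
  then have "(1 + 1) *s x = 0"
    by (metis add.right_inverse scale_left_distrib scale_one)
  then show False using \<open>x \<noteq> 0\<close> by simp
qed

lemma swap_eigenvalue:
  assumes "swap a b x = k *s x" "x \<noteq> 0"
  shows "k = 1 \<or> k = -1"
proof -
  have "x = (k * k) *s x"
    using swap_swap[of a b x] by (simp add: assms(1) swap_scale)
  then have "(k * k - 1) *s x = 0"
    by (simp add: scale_left_diff_distrib)
  then have "k * k = 1" using assms(2) by simp
  then show ?thesis by (simp add: square_eq_1_iff)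
qed

lemma swap_neq_scale:
  assumes "x \<noteq> 0" "k \<noteq> 1" "k \<noteq> -1"
  shows "swap a b x \<noteq> k *s x"
  using swap_eigenvalue assms by blast

lemma act_fixed_by_swaps:
  assumes "\<sigma> permutes S" "finite S" "\<And>a b. a \<in> S \<Longrightarrow> b \<in> S \<Longrightarrow> a \<noteq> b \<Longrightarrow> swap a b x = x"
  shows "act \<sigma> x = x"
  using assms(1,2)
proof (induction \<sigma> rule: permutes_induct)
  case id
  show ?case by (rule act_id)
next
  case (swap a b p)
  have "p permutes UNIV" using swap.hyps(4) permutes_subset by blast
  then show ?case
    unfolding act_comp[OF transpose_permutes \<open>p permutes UNIV\<close>]
    using swap assms(3)[of a b] by simp
qed

lemma act_negated_by_swaps:
  assumes "\<sigma> permutes UNIV" "\<And>a b. a \<noteq> b \<Longrightarrow> swap a b x = - x"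
  shows "act \<sigma> x = of_int (sign \<sigma>) *s x"
  using assms(1) finite_class.finite_UNIV
proof (induction \<sigma> rule: permutes_induct)
  case id
  show ?case unfolding act_id sign_id by simp
next
  case (swap a b p)
  have "permutation p" "permutation (transpose a b)"
    using swap.hyps(4) transpose_permutes permutation_permutes finite_class.finite_UNIV by blast+
  then have "sign (transpose a b \<circ> p) = - sign p"
    using swap.hyps(3) by (simp add: sign_compose sign_swap_id)
  then show ?case
    unfolding act_comp[OF transpose_permutes swap.hyps(4)] \<open>sign (transpose a b \<circ> p) = - sign p\<close>
    using swap.IH assms(2)[OF swap.hyps(3)] by (simp add: swap_scale)
qed

end

text \<open>
  A transposition is diagonalizable with eigenvalues \<open>1\<close> and \<open>-1\<close>. The assumption says that its
  \<open>-1\<close>-eigenspace is at most a line, so that it acts trivially or as a reflection.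
\<close>

locale reflection_action = linear_perm_action scale act
  for scale :: "'k::field_char_0 \<Rightarrow> 'v::ab_group_add \<Rightarrow> 'v" (infixr \<open>*s\<close> 75)
    and act :: "('n::finite \<Rightarrow> 'n) \<Rightarrow> 'v \<Rightarrow> 'v" +
  fixes U :: "'v set"
  assumes subspace_U: "subspace U" and stable_U: "stable U"
    and reflection: "a \<noteq> b \<Longrightarrow> x \<in> U \<Longrightarrow> y \<in> U \<Longrightarrow> swap a b x = - x \<Longrightarrow> swap a b y = - y \<Longrightarrow>
      \<exists>c d. (c \<noteq> 0 \<or> d \<noteq> 0) \<and> c *s x + d *s y = 0"
begin

definition root :: "'n \<Rightarrow> 'n \<Rightarrow> 'v \<Rightarrow> bool"
  where "root a b x \<longleftrightarrow> a \<noteq> b \<and> x \<in> U \<and> x \<noteq> 0 \<and> swap a b x = - x"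

lemma root_multiple:
  assumes "root a b x" "y \<in> U" "swap a b y = - y"
  obtains k where "y = k *s x"
proof -
  have x: "a \<noteq> b" "x \<in> U" "x \<noteq> 0" "swap a b x = - x"
    using assms(1) unfolding root_def by auto
  obtain c d where cd: "c \<noteq> 0 \<or> d \<noteq> 0" "c *s x + d *s y = 0"
    using reflection[OF x(1,2) assms(2) x(4) assms(3)] by blast
  have "d \<noteq> 0"
    using cd x(3) by auto
  have "d *s y = - (c *s x)"
    using cd(2) by (simp add: eq_neg_iff_add_eq_0 add.commute)
  then have "inverse d *s d *s y = inverse d *s - (c *s x)"
    by simp
  then have "y = - (inverse d * c) *s x"
    using \<open>d \<noteq> 0\<close> by simp
  then show ?thesis using that by blast
qed

lemma root_act:
  assumes "root a b x" "\<sigma> permutes UNIV"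
  shows "root (\<sigma> a) (\<sigma> b) (act \<sigma> x)"
proof -
  have "act \<sigma> x \<noteq> 0"
    using assms act_inv_act[OF assms(2), of x] act_zero[OF permutes_inv[OF assms(2)]]
    unfolding root_def by metis
  moreover have "swap (\<sigma> a) (\<sigma> b) (act \<sigma> x) = - act \<sigma> x"
    using assms unfolding root_def by (simp flip: act_swap add: act_neg)
  ultimately show ?thesis
    using assms stableD[OF stable_U] permutes_inj[OF assms(2)] unfolding root_def
    by (auto simp: inj_eq)
qed

lemma root_swap:
  assumes "root a b x"
  shows "root (transpose c d a) (transpose c d b) (swap c d x)"
  using root_act[OF assms transpose_permutes] .

lemma total_root:
  assumes "root a b x"
  shows "total x = 0"
proof -
  have "total x = - total x"
    using total_act[OF transpose_permutes, of a b x] assms module_hom.neg[OF linear_total]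
    unfolding root_def by metis
  then show ?thesis using neq_minus_self by blast
qed

text \<open>
  The roots \<open>x\<close>, \<open>(b c) x\<close>, \<open>(a c) x\<close> of the three transpositions of \<open>a, b, c\<close> either coincide up
  to sign, or form a root system of type \<open>A\<^sub>2\<close>. Indeed \<open>x - (b c) x\<close> is a root of \<open>(b c)\<close>, or
  zero, and so it equals \<open>k (a c) x\<close> for a scalar \<open>k\<close>. Applying \<open>(a c)\<close> to this relation
  gives \<open>(a c) x + (b c) x = k x\<close>, and the two relations together give
  \<open>(k - 1) (x + (a c) x) = 0\<close>.
\<close>

lemma root_triple:
  assumes r: "root a b x" and c: "c \<noteq> a" "c \<noteq> b"
  shows "(swap b c x = - x \<and> swap a c x = - x) \<or> swap b c x + swap a c x = x"
proof -
  have ab: "a \<noteq> b" and xU: "x \<in> U" using r unfolding root_def by auto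
  let ?y = "swap b c x" and ?z = "swap a c x"
  have ry: "root a c ?y"
    using root_swap[OF r, of b c] ab c by simp
  have rz: "root c b ?z"
    using root_swap[OF r, of a c] ab c by simp
  have "swap c b (x - ?y) = - (x - ?y)"
    by (simp add: swap_diff swap_commute[of c b])
  moreover have "x - ?y \<in> U"
    using xU stableD[OF stable_U transpose_permutes xU] subspace_U by (auto intro: subspace_diff)
  ultimately obtain k where k: "x - ?y = k *s ?z"
    using root_multiple[OF rz] by blast
  have "swap a c (x - ?y) = swap a c (k *s ?z)"
    using k by simp
  moreover have "swap a c ?y = - ?y"
    using ry unfolding root_def by blast
  ultimately have k': "?z + ?y = k *s x"
    by (simp add: swap_diff swap_scale)
  have "(k - 1) *s (x + ?z) = k *s x + k *s ?z - x - ?z"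
    by (simp add: scale_left_diff_distrib scale_right_distrib algebra_simps)
  also have "\<dots> = 0"
    unfolding k[symmetric] k'[symmetric] by simp
  finally have "k = 1 \<or> x + ?z = 0"
    by simp
  then show ?thesis
  proof
    assume "k = 1"
    then show ?thesis using k by (simp add: algebra_simps)
  next
    assume "x + ?z = 0"
    then have z: "?z = - x" by (simp add: eq_neg_iff_add_eq_0 add.commute)
    then have "swap b c (- x) = - (- x)"
      using rz unfolding root_def by (simp add: swap_commute[of c b])
    then have "?y = - x" by (simp add: swap_neg minus_equation_iff)
    then show ?thesis using z by blast
  qed
qed

lemma root_triple_neg:
  assumes "root a b x" "c \<noteq> a" "c \<noteq> b" "swap b c x = - x"
  shows "swap a c x = - x"
proof (rule ccontr)
  assume "swap a c x \<noteq> - x"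
  then have "swap a c x = x + x"
    using root_triple[OF assms(1-3)] assms(4) by (auto simp: algebra_simps)
  then have "swap a c x = 2 *s x"
    by (metis one_add_one scale_left_distrib scale_one)
  then show False
    using swap_neq_scale[of x 2 a c] assms(1) unfolding root_def by simp
qed

lemma root_disjoint:
  assumes "root a b x" "c \<notin> {a, b}" "d \<notin> {a, b}"
  shows "swap c d x = x \<or> swap c d x = - x"
proof -
  have "root a b (swap c d x)"
    using root_swap[OF assms(1), of c d] assms(2,3) by auto
  then obtain k where k: "swap c d x = k *s x"
    using root_multiple[OF assms(1)] unfolding root_def by blast
  then have "k = 1 \<or> k = -1"
    using swap_eigenvalue assms(1) unfolding root_def by blast
  then show ?thesis using k by auto
qed

text \<open>
  A common root of two overlapping transpositions is a root of all transpositions: this is carried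
  from \<open>(b c)\<close> to \<open>(b d)\<close> by conjugation with \<open>(c d)\<close>, which preserves the line of the root because
  it commutes with \<open>(a b)\<close>, and from two sides of a triangle to the third.
\<close>

lemma root_all_negated:
  assumes r: "root a b x" and c: "c \<notin> {a, b}" "swap b c x = - x" and "d \<noteq> e"
  shows "swap d e x = - x"
proof -
  have ab: "a \<noteq> b" and sab: "swap a b x = - x" using r unfolding root_def by auto
  have b: "swap b d x = - x" if d: "d \<notin> {a, b}" for d
  proof (cases "d = c")
    case False
    have "swap c d (swap b c x) = swap b d (swap c d x)"
    proof -
      have "transpose c d b = b" "transpose c d c = d"
        using c(1) d by auto
      then show ?thesis
        using act_swap[OF transpose_permutes[of c d], of b c x] by simp
    qed
    moreover have "swap c d x = x \<or> swap c d x = - x"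
      using root_disjoint[OF r c(1) d] .
    ultimately have "(swap c d x = x \<and> swap b d x = - x) \<or>
        (swap c d x = - x \<and> - swap b d x = x)"
      using c(2) by (auto simp: swap_neg)
    then show ?thesis
      by (metis minus_equation_iff)
  qed (use c in simp)
  have a: "swap a d x = - x" if "d \<notin> {a, b}" for d
    using root_triple_neg[OF r _ _ b[OF that]] that by blast
  have out: "swap d e x = - x" if "d \<notin> {a, b}" "e \<notin> {a, b}" "d \<noteq> e" for d e
  proof (rule root_triple_neg[OF _ _ _ b[OF that(2)]])
    show "root d b x"
      using r b[OF that(1)] that(1) unfolding root_def by (auto simp: swap_commute[of d b])
  qed (use that in auto)
  consider "d \<in> {a, b}" "e \<in> {a, b}" | "d \<in> {a, b}" "e \<notin> {a, b}"
    | "d \<notin> {a, b}" "e \<in> {a, b}" | "d \<notin> {a, b}" "e \<notin> {a, b}" by blast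
  then show ?thesis
  proof cases
    case 1
    then show ?thesis
      using \<open>d \<noteq> e\<close> sab swap_commute[of b a] by auto
  next
    case 2
    then show ?thesis using a[of e] b[of e] by auto
  next
    case 3
    then show ?thesis using a[of d] b[of d] swap_commute[of d] by auto
  next
    case 4
    then show ?thesis using out \<open>d \<noteq> e\<close> by blast
  qed
qed

text \<open>
  Outside the sign representation, disjoint transpositions can have a common root only in
  \<open>S\<^sub>4\<close>, where this comes from the exceptional homomorphism onto \<open>S\<^sub>3\<close>. If there is a fifth
  element \<open>e\<close>, then the common root \<open>x\<close> of \<open>(a b)\<close> and \<open>(c d)\<close> is up to sign fixed by \<open>(d e)\<close> and
  \<open>(c e)\<close>, and the dichotomy for \<open>c, d, e\<close> makes it a root of \<open>(d e)\<close>. As \<open>(a c)\<close>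
  commutes with \<open>(d e)\<close>, it maps \<open>x\<close> to \<open>x\<close> or \<open>- x\<close>, so that \<open>(b c) x = x - (a c) x\<close> is \<open>0\<close> or
  \<open>2 x\<close>. Neither is possible for an involution.
\<close>

lemma root_common_disjoint:
  assumes r: "root a b x" and n: "\<And>c. c \<notin> {a, b} \<Longrightarrow> swap b c x + swap a c x = x"
    and c: "c \<notin> {a, b}" and d: "d \<notin> {a, b}" and cd: "c \<noteq> d" "swap c d x = - x"
  shows "UNIV = {a, b, c, d}"
proof (rule ccontr)
  assume "UNIV \<noteq> {a, b, c, d}"
  then obtain e where e: "e \<notin> {a, b, c, d}" by auto
  have x0: "x \<noteq> 0" and xU: "x \<in> U" and ab: "a \<noteq> b" using r unfolding root_def by auto
  have rcd: "root c d x" using cd x0 xU unfolding root_def by blast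
  have sde: "swap d e x = x \<or> swap d e x = - x" and sce: "swap c e x = x \<or> swap c e x = - x"
    using root_disjoint[OF r] c d e by auto
  have "swap d e x = - x"
  proof (rule ccontr)
    assume no: "swap d e x \<noteq> - x"
    then have "swap d e x = x" "swap d e x + swap c e x = x"
      using sde root_triple[OF rcd, of e] e by auto
    then have "swap c e x = 0" by simp
    then show False using sce x0 by auto
  qed
  then have rde: "root d e x" using e x0 xU unfolding root_def by auto
  have "root d e (swap a c x)"
    using root_swap[OF rde, of a c] c d e cd(1) by auto
  then obtain k where k: "swap a c x = k *s x"
    using root_multiple[OF rde] unfolding root_def by blast
  then have k1: "k = 1 \<or> k = -1"
    using swap_eigenvalue x0 by blast
  have "swap b c x = x - k *s x"
    using n[OF c] k by (simp add: algebra_simps)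
  then have "swap b c x = (1 - k) *s x"
    by (simp add: scale_left_diff_distrib)
  moreover have "1 - k \<noteq> 1" "1 - k \<noteq> -1"
    using k1 by auto
  ultimately show False
    using swap_neq_scale x0 by blast
qed

text \<open>
  For a transposition \<open>\<tau>\<close> the vector \<open>y - \<tau> y\<close> lies on the root line of \<open>\<tau>\<close>. As transpositions
  generate, \<open>y - \<sigma> y\<close> is in the span of the roots for every permutation \<open>\<sigma>\<close>, and averaging over \<open>\<sigma>\<close>
  shows that \<open>y\<close> differs from an invariant vector by an element of this span.
\<close>

lemma span_root_plus_invariants:
  assumes r: "root a b x"
  shows "U = {y + z | y z. y \<in> orbit_span x \<and> z \<in> invariants U}"
proof -
  let ?N = "orbit_span x"
  have xU: "x \<in> U" using r unfolding root_def by blast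
  have NU: "?N \<subseteq> U"
    using orbit_span_subset[OF subspace_U stable_U xU] .
  note N = subspace_orbit_span[of x] stable_orbit_span[of x]
  have swap_mem: "y - swap c d y \<in> ?N" if y: "y \<in> U" for y c d
  proof (cases "c = d")
    case True
    have "swap c c y = y" using act_id[of y] by (simp add: id_def)
    then show ?thesis using True subspace_0[OF N(1)] by simp
  next
    case False
    have ab: "a \<noteq> b" using r unfolding root_def by blast
    \<comment> \<open>a permutation that moves \<open>a\<close> to \<open>c\<close> and \<open>b\<close> to \<open>d\<close>\<close>
    define \<sigma> where "\<sigma> = transpose (transpose a c b) d \<circ> transpose a c"
    have s: "\<sigma> permutes UNIV" unfolding \<sigma>_def
      by (intro permutes_compose transpose_permutes)
    have "\<sigma> a = c" "\<sigma> b = d"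
      using ab False by (auto simp: \<sigma>_def transpose_def)
    then have rt: "root c d (act \<sigma> x)"
      using root_act[OF r s] by simp
    have "swap c d (y - swap c d y) = - (y - swap c d y)"
      by (simp add: swap_diff)
    moreover have "y - swap c d y \<in> U"
      using y stableD[OF stable_U transpose_permutes y] subspace_U by (auto intro: subspace_diff)
    ultimately obtain k where "y - swap c d y = k *s act \<sigma> x"
      using root_multiple[OF rt] by blast
    then show ?thesis
      using act_mem_orbit_span[OF s] N(1) by (auto intro: subspace_scale)
  qed
  have act_mem: "y - act \<sigma> y \<in> ?N" if "\<sigma> permutes UNIV" and y: "y \<in> U" for y \<sigma>
    using that(1) finite_class.finite_UNIV
  proof (induction \<sigma> rule: permutes_induct)
    case id
    show ?case unfolding act_id using subspace_0[OF N(1)] by simp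
  next
    case (swap c d p)
    have "(y - act p y) + (act p y - swap c d (act p y)) \<in> ?N"
      using swap.IH swap_mem stableD[OF stable_U swap.hyps(4) y] by (intro subspace_add[OF N(1)])
    then show ?case
      unfolding act_comp[OF transpose_permutes swap.hyps(4)] by simp
  qed
  have dec: "\<exists>y z. u = y + z \<and> y \<in> ?N \<and> z \<in> invariants U" if u: "u \<in> U" for u
  proof -
    let ?c = "inverse (of_nat (card perms)) :: 'k"
    let ?z = "?c *s total u"
    have "?z \<in> U"
      using total_mem[OF subspace_U stable_U u] subspace_U by (intro subspace_scale)
    then have z: "?z \<in> invariants U"
      unfolding invariants_def by (simp add: act_scale act_total)
    have "u = ?c *s (\<Sum>\<sigma>\<in>perms. u)"
      using card_perms_neq_0 by (simp add: sum_constant_scale)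
    then have "u - ?z = ?c *s (\<Sum>\<sigma>\<in>perms. u - act \<sigma> u)"
      unfolding total_def by (simp add: sum_subtractf scale_right_diff_distrib)
    also have "\<dots> \<in> ?N"
      using act_mem u by (intro subspace_scale[OF N(1)] subspace_sum[OF N(1)]) auto
    finally show ?thesis
      using z by (intro exI[of _ "u - ?z"] exI[of _ ?z]) simp
  qed
  show ?thesis
  proof (intro equalityI subsetI)
    fix u assume "u \<in> U"
    then show "u \<in> {y + z | y z. y \<in> ?N \<and> z \<in> invariants U}" using dec by blast
  next
    fix u assume "u \<in> {y + z | y z. y \<in> ?N \<and> z \<in> invariants U}"
    then show "u \<in> U" using NU subspace_U unfolding invariants_def by (auto intro: subspace_add)
  qed
qed

end

section \<open>Specht modules\<close>

lemma lookup_perm_tabloids: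
  assumes "\<sigma> permutes UNIV"
  shows "Poly_Mapping.lookup (perm_tabloids \<sigma> w) r = Poly_Mapping.lookup w (r \<circ> \<sigma>)"
proof -
  have "inj (\<lambda>r :: 'a \<Rightarrow> nat. r \<circ> \<sigma>)"
    by (rule injI) (metis comp_assoc comp_id permutes_inv_o(1)[OF assms])
  then show ?thesis
    unfolding perm_tabloids_def by (rule lookup_map_key)
qed

global_interpretation tab: linear_perm_action
  "pm_scale :: 'k::field_char_0 \<Rightarrow> (('n::finite \<Rightarrow> nat) \<Rightarrow>\<^sub>0 'k) \<Rightarrow> _" perm_tabloids
proof
  fix \<sigma> \<tau> :: "'n \<Rightarrow> 'n" and x y :: "('n \<Rightarrow> nat) \<Rightarrow>\<^sub>0 'k" and c :: 'k
  assume s: "\<sigma> permutes UNIV"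
  show "perm_tabloids \<sigma> (x + y) = perm_tabloids \<sigma> x + perm_tabloids \<sigma> y"
    by (rule poly_mapping_eqI) (simp add: lookup_perm_tabloids[OF s] lookup_add)
  show "perm_tabloids \<sigma> (pm_scale c x) = pm_scale c (perm_tabloids \<sigma> x)"
    by (rule poly_mapping_eqI) (simp add: lookup_perm_tabloids[OF s] lookup_pm_scale)
  assume t: "\<tau> permutes UNIV"
  show "perm_tabloids (\<sigma> \<circ> \<tau>) x = perm_tabloids \<sigma> (perm_tabloids \<tau> x)"
    by (rule poly_mapping_eqI)
      (simp only: lookup_perm_tabloids s t permutes_compose[OF t s] comp_assoc)
next
  fix x :: "('n \<Rightarrow> nat) \<Rightarrow>\<^sub>0 'k"
  show "perm_tabloids id x = x"
    by (rule poly_mapping_eqI) (simp only: lookup_perm_tabloids[OF permutes_id] comp_id)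
qed

lemma inv_comp_perm:
  assumes "\<sigma> permutes UNIV" "\<tau> permutes UNIV"
  shows "inv (\<sigma> \<circ> \<tau>) = inv \<tau> \<circ> inv \<sigma>"
  using assms by (intro o_inv_distrib) (auto intro: permutes_bij)

lemma permutation_UNIV: "\<sigma> permutes UNIV \<Longrightarrow> permutation \<sigma>" for \<sigma> :: "'n::finite \<Rightarrow> 'n"
  using permutation_permutes finite_class.finite_UNIV by blast

lemma perm_tabloids_polytabloid:
  assumes s: "\<sigma> permutes UNIV"
  shows "perm_tabloids \<sigma> (polytabloid t :: _ \<Rightarrow>\<^sub>0 'k::field_char_0) = polytabloid (t \<circ> inv \<sigma>)"
proof -
  have si: "inv \<sigma> permutes UNIV" using s by (rule permutes_inv)
  note inv_simps = permutes_inverses[OF s]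
  have conj: "\<sigma> \<circ> \<pi> \<circ> inv \<sigma> permutes UNIV" "inv \<sigma> \<circ> \<pi> \<circ> \<sigma> permutes UNIV"
    if "\<pi> permutes UNIV" for \<pi>
    using s si that by (auto intro: permutes_compose)
  have "perm_tabloids \<sigma> (polytabloid t :: _ \<Rightarrow>\<^sub>0 'k) =
      (\<Sum>\<pi>\<in>column_stabilizer t. Poly_Mapping.single (fst \<circ> t \<circ> inv \<pi> \<circ> inv \<sigma>) (of_int (sign \<pi>)))"
    unfolding polytabloid_def tab.act_sum[OF s] by (simp add: perm_tabloids_single[OF s])
  also have "\<dots> = polytabloid (t \<circ> inv \<sigma>)"
    unfolding polytabloid_def
  proof (rule sum.reindex_bij_witness[of _ "\<lambda>\<pi>. inv \<sigma> \<circ> \<pi> \<circ> \<sigma>" "\<lambda>\<pi>. \<sigma> \<circ> \<pi> \<circ> inv \<sigma>"])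
    fix \<pi> assume p: "\<pi> \<in> column_stabilizer t"
    then have pp: "\<pi> permutes UNIV" unfolding column_stabilizer_def by blast
    show "inv \<sigma> \<circ> (\<sigma> \<circ> \<pi> \<circ> inv \<sigma>) \<circ> \<sigma> = \<pi>"
      by (simp add: fun_eq_iff inv_simps)
    show "\<sigma> \<circ> \<pi> \<circ> inv \<sigma> \<in> column_stabilizer (t \<circ> inv \<sigma>)"
      using p conj(1)[OF pp] unfolding column_stabilizer_def by (simp add: inv_simps)
    have "inv (\<sigma> \<circ> \<pi> \<circ> inv \<sigma>) = \<sigma> \<circ> inv \<pi> \<circ> inv \<sigma>"
      using s si pp by (simp add: inv_comp_perm permutes_compose permutes_inv_inv comp_assoc)
    then have "fst \<circ> (t \<circ> inv \<sigma>) \<circ> inv (\<sigma> \<circ> \<pi> \<circ> inv \<sigma>) = fst \<circ> t \<circ> inv \<pi> \<circ> inv \<sigma>"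
      by (simp add: fun_eq_iff inv_simps)
    moreover have "sign (\<sigma> \<circ> \<pi> \<circ> inv \<sigma>) = sign \<pi>"
      using s si pp by (simp add: sign_compose sign_inverse permutation_UNIV permutes_compose
          del: comp_apply)
    ultimately show "Poly_Mapping.single (fst \<circ> (t \<circ> inv \<sigma>) \<circ> inv (\<sigma> \<circ> \<pi> \<circ> inv \<sigma>))
        (of_int (sign (\<sigma> \<circ> \<pi> \<circ> inv \<sigma>)) :: 'k) =
        Poly_Mapping.single (fst \<circ> t \<circ> inv \<pi> \<circ> inv \<sigma>) (of_int (sign \<pi>))"
      by simp
  next
    fix \<pi> assume p: "\<pi> \<in> column_stabilizer (t \<circ> inv \<sigma>)"
    then have pp: "\<pi> permutes UNIV" unfolding column_stabilizer_def by blast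
    show "\<sigma> \<circ> (inv \<sigma> \<circ> \<pi> \<circ> \<sigma>) \<circ> inv \<sigma> = \<pi>"
      by (simp add: fun_eq_iff inv_simps)
    have "snd (t (inv \<sigma> (\<pi> (\<sigma> x)))) = snd (t x)" for x
      using p unfolding column_stabilizer_def by (auto simp: inv_simps dest: spec[of _ "\<sigma> x"])
    then show "inv \<sigma> \<circ> \<pi> \<circ> \<sigma> \<in> column_stabilizer t"
      using conj(2)[OF pp] unfolding column_stabilizer_def by simp
  qed
  finally show ?thesis .
qed

lemma tableau_comp_inv:
  assumes "tableau l t" "\<sigma> permutes UNIV"
  shows "tableau l (t \<circ> inv \<sigma>)"
  using assms permutes_inv[OF assms(2)] unfolding tableau_def
  by (blast intro: bij_betw_trans permutes_bij)

lemma tableau_conjugate: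
  assumes "tableau l t" "tableau l t'"
  obtains \<sigma> where "\<sigma> permutes UNIV" "t' = t \<circ> inv \<sigma>"
proof -
  let ?u = "the_inv_into UNIV t"
  have t: "bij_betw t UNIV (young_cells l)" and t': "bij_betw t' UNIV (young_cells l)"
    using assms unfolding tableau_def by auto
  have "bij_betw (?u \<circ> t') UNIV UNIV"
    using bij_betw_trans[OF t' bij_betw_the_inv_into[OF t]] .
  then have p: "(?u \<circ> t') permutes UNIV"
    by (auto intro: bij_imp_permutes)
  have "t (?u (t' x)) = t' x" for x
    using f_the_inv_into_f_bij_betw[OF t] bij_betwE[OF t'] by blast
  then have "t' = t \<circ> inv (inv (?u \<circ> t'))"
    using permutes_inv_inv[OF p] by (simp add: fun_eq_iff)
  then show ?thesis
    using that[OF permutes_inv[OF p]] by blast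
qed

lemma specht_eq_orbit_span:
  assumes "tableau l t"
  shows "specht l = tab.subrep (tab.orbit_span (polytabloid t :: _ \<Rightarrow>\<^sub>0 'k::field_char_0))"
proof -
  have "{polytabloid t' :: _ \<Rightarrow>\<^sub>0 'k | t'. tableau l t'} =
      {perm_tabloids \<sigma> (polytabloid t) | \<sigma>. \<sigma> permutes UNIV}" (is "?A = ?B")
  proof (intro equalityI subsetI)
    fix x assume "x \<in> ?A"
    then obtain t' where t': "x = polytabloid t'" "tableau l t'" by blast
    then show "x \<in> ?B"
      using tableau_conjugate[OF assms t'(2)] perm_tabloids_polytabloid by (metis (mono_tags, lifting) mem_Collect_eq)
  next
    fix x assume "x \<in> ?B"
    then show "x \<in> ?A"
      using tableau_comp_inv[OF assms] perm_tabloids_polytabloid by auto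
  qed
  then show ?thesis
    unfolding specht_def tab.subrep_def tab.orbit_span_def by simp
qed

lemma rep_closed_specht_of_tableau:
  assumes "tableau l (t :: 'n::finite \<Rightarrow> _)"
  shows "rep_closed (specht l :: ('n, 'k::field_char_0, _) rep)"
  unfolding specht_eq_orbit_span[OF assms]
  by (rule tab.rep_closed_subrep[OF tab.subspace_orbit_span tab.stable_orbit_span])

subsection \<open>The trivial representation\<close>

lemma ex_bij_lessThan:
  fixes A :: "'n::finite set"
  obtains f where "bij_betw f A {..<card A}"
  using ex_bij_betw_finite_nat[of A] by (auto simp: atLeast0LessThan)

lemma tableau_single_row:
  assumes "bij_betw f (UNIV :: 'n::finite set) {..<CARD('n)}"
  shows "tableau [CARD('n)] (\<lambda>x. (0, f x))"
  using assms unfolding tableau_def young_cells_def bij_betw_def inj_on_def by auto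

lemma specht_trivial_carrier:
  "rep_carrier (specht [CARD('n)] :: ('n::finite, 'k::field_char_0, _) rep) =
    range (Poly_Mapping.single (\<lambda>_. 0))"
proof -
  obtain f where f: "bij_betw f (UNIV :: 'n set) {..<CARD('n)}"
    using ex_bij_lessThan .
  let ?t = "\<lambda>x. (0::nat, f x)"
  have inj: "inj f" using f by (rule bij_betw_imp_inj_on)
  have "column_stabilizer ?t = {id}"
    unfolding column_stabilizer_def using inj permutes_id by (auto simp: inj_eq fun_eq_iff)
  then have e: "polytabloid ?t = (Poly_Mapping.single (\<lambda>_. 0) 1 :: _ \<Rightarrow>\<^sub>0 'k)"
    unfolding polytabloid_def by (simp add: comp_def)
  have "{perm_tabloids \<sigma> (Poly_Mapping.single (\<lambda>_. 0) 1 :: _ \<Rightarrow>\<^sub>0 'k) |\<sigma> :: 'n \<Rightarrow> 'n. \<sigma> permutes UNIV} =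
      {Poly_Mapping.single (\<lambda>_. 0) 1}"
  proof (intro equalityI subsetI)
    fix x :: "('n \<Rightarrow> nat) \<Rightarrow>\<^sub>0 'k"
    assume "x \<in> {Poly_Mapping.single (\<lambda>_. 0) 1}"
    then have "x = perm_tabloids id (Poly_Mapping.single (\<lambda>_. 0) 1)"
      by (simp only: tab.act_id singleton_iff)
    then show "x \<in> {perm_tabloids \<sigma> (Poly_Mapping.single (\<lambda>_. 0) 1) |\<sigma>. \<sigma> permutes UNIV}"
      using permutes_id by blast
  qed (auto simp: perm_tabloids_single comp_def)
  then show ?thesis
    unfolding specht_eq_orbit_span[OF tableau_single_row[OF f]] tab.subrep_simps tab.orbit_span_def e
    by (simp add: pm.span_singleton pm_scale_def)
qed

lemma rep_closed_specht_trivial: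
  "rep_closed (specht [CARD('n)] :: ('n::finite, 'k::field_char_0, _) rep)"
  using rep_closed_specht_of_tableau[OF tableau_single_row] ex_bij_lessThan[of "UNIV :: 'n set"]
  by metis

context linear_perm_action
begin

text \<open>
  The carrier of the trivial Specht module is the line of the only tabloid, so that a family in
  its power is a family of coordinates.
\<close>

lemma rep_power_trivial_iso:
  assumes B: "finite B" "independent B" and fixed: "\<And>\<sigma> x. \<sigma> permutes UNIV \<Longrightarrow> x \<in> B \<Longrightarrow> act \<sigma> x = x"
  shows "rep_power (card B) (specht [CARD('n)] :: ('n, 'k, _) rep) \<cong>\<^sub>R subrep (span B)"
proof -
  let ?m = "card B" and ?z = "\<lambda>_ :: 'n. 0 :: nat"
  let ?W = "rep_power ?m (specht [CARD('n)] :: ('n, 'k, _) rep)"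
  obtain g where g: "bij_betw g {..<?m} B"
    using ex_bij_betw_nat_finite[OF B(1)] by (auto simp: atLeast0LessThan)
  have gB: "g i \<in> B" if "i < ?m" for i using bij_betwE[OF g] that by simp
  define \<chi> where "\<chi> f = (\<Sum>i<?m. Poly_Mapping.lookup (f i) ?z *s g i)" for f :: "nat \<Rightarrow> ('n \<Rightarrow> nat) \<Rightarrow>\<^sub>0 'k"
  have car: "f \<in> rep_carrier ?W \<longleftrightarrow>
      (\<forall>i<?m. \<exists>c. f i = Poly_Mapping.single ?z c) \<and> (\<forall>i\<ge>?m. f i = 0)" for f
    unfolding rep_power_def
    by (simp add: specht_trivial_carrier image_iff) (simp add: specht_def)
  have sum_g: "(\<Sum>i<?m. h (g i)) = (\<Sum>b\<in>B. h b)" for h :: "'v \<Rightarrow> 'v"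
    using sum.reindex_bij_betw[OF g] .
  show ?thesis
  proof (rule rep_isoI[of \<chi>])
    have "inj_on \<chi> (rep_carrier ?W)"
    proof (rule inj_onI)
      fix f f' assume ff: "f \<in> rep_carrier ?W" "f' \<in> rep_carrier ?W" "\<chi> f = \<chi> f'"
      let ?u = "\<lambda>i. Poly_Mapping.lookup (f i) ?z - Poly_Mapping.lookup (f' i) ?z"
      let ?i = "the_inv_into {..<?m} g"
      have inv: "?i (g i) = i" if "i < ?m" for i
        using the_inv_into_f_f[OF bij_betw_imp_inj_on[OF g]] that by simp
      have "(\<Sum>i<?m. ?u i *s g i) = 0"
        using ff(3) unfolding \<chi>_def by (simp add: scale_left_diff_distrib sum_subtractf)
      then have "(\<Sum>i<?m. ?u (?i (g i)) *s g i) = 0"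
        by (simp add: inv)
      then have "(\<Sum>b\<in>B. ?u (?i b) *s b) = 0"
        using sum_g[of "\<lambda>b. ?u (?i b) *s b"] by simp
      then have u: "?u i = 0" if "i < ?m" for i
        using independentD[OF B(2,1) subset_refl _ gB[OF that], of "\<lambda>b. ?u (?i b)"] inv[OF that] by simp
      show "f = f'"
      proof
        fix i show "f i = f' i"
        proof (cases "i < ?m")
          case True
          then obtain c c' where "f i = Poly_Mapping.single ?z c" "f' i = Poly_Mapping.single ?z c'"
            using ff car by meson
          then show ?thesis using u[OF True] by simp
        next
          case False
          then have "f i = 0" "f' i = 0"
            using ff(1,2) unfolding car by auto
          then show ?thesis by simp
        qed
      qed
    qed
    moreover have "\<chi> ` rep_carrier ?W = span B"
    proof (intro equalityI subsetI)
      fix x assume "x \<in> \<chi> ` rep_carrier ?W"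
      then obtain f where x: "x = \<chi> f" by blast
      show "x \<in> span B"
        unfolding x \<chi>_def by (rule span_sum, rule span_scale, rule span_base, rule gB) simp
    next
      fix x assume "x \<in> span B"
      then obtain u where "x = (\<Sum>b\<in>B. u b *s b)"
        unfolding span_finite[OF B(1)] by blast
      then have "x = \<chi> (\<lambda>i. if i < ?m then Poly_Mapping.single ?z (u (g i)) else 0)"
        unfolding \<chi>_def using sum_g[of "\<lambda>b. u b *s b"] by simp
      moreover have "(\<lambda>i. if i < ?m then Poly_Mapping.single ?z (u (g i)) else 0) \<in> rep_carrier ?W"
        unfolding car by auto
      ultimately show "x \<in> \<chi> ` rep_carrier ?W" by blast
    qed
    ultimately show "bij_betw \<chi> (rep_carrier ?W) (rep_carrier (subrep (span B)))"
      unfolding bij_betw_def by simp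
  next
    fix f f'
    show "\<chi> (rep_add ?W f f') = rep_add (subrep (span B)) (\<chi> f) (\<chi> f')"
      unfolding \<chi>_def rep_power_def
      by (simp add: specht_def lookup_add scale_left_distrib sum.distrib)
  next
    fix c f
    show "\<chi> (rep_scale ?W c f) = rep_scale (subrep (span B)) c (\<chi> f)"
      unfolding \<chi>_def rep_power_def
      by (simp add: specht_def lookup_pm_scale scale_sum_right)
  next
    fix \<sigma> :: "'n \<Rightarrow> 'n" and f assume s: "\<sigma> permutes UNIV"
    have "\<chi> (rep_act ?W \<sigma> f) = \<chi> f"
      unfolding \<chi>_def rep_power_def
      by (simp add: specht_def lookup_perm_tabloids[OF s] comp_def)
    also have "\<dots> = act \<sigma> (\<chi> f)"
      unfolding \<chi>_def act_sum[OF s] act_scale[OF s] using fixed[OF s gB] by simp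
    finally show "\<chi> (rep_act ?W \<sigma> f) = rep_act (subrep (span B)) \<sigma> (\<chi> f)" by simp
  qed
qed

subsection \<open>Equivariant maps out of Specht modules\<close>

text \<open>
  The tabloid \<open>T\<close> is sent to the sum of \<open>\<sigma> x\<close> over all \<open>\<sigma>\<close> with \<open>\<sigma> \<cdot> r = T\<close>; tabloids outside the
  orbit of \<open>r\<close> are sent to \<open>0\<close>. Summing over the whole group makes the map equivariant for every \<open>x\<close>.
\<close>

definition tabloid_map :: "('n \<Rightarrow> nat) \<Rightarrow> 'v \<Rightarrow> (('n \<Rightarrow> nat) \<Rightarrow>\<^sub>0 'k) \<Rightarrow> 'v"
  where "tabloid_map r x w = (\<Sum>\<sigma>\<in>perms. Poly_Mapping.lookup w (r \<circ> inv \<sigma>) *s act \<sigma> x)"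

lemma linear_tabloid_map: "module_hom pm_scale scale (tabloid_map r x)"
proof -
  interpret pm: vector_space "pm_scale :: 'k \<Rightarrow> (('n \<Rightarrow> nat) \<Rightarrow>\<^sub>0 'k) \<Rightarrow> _"
    by (rule pm.vector_space_axioms)
  show ?thesis
    by standard
      (simp_all add: tabloid_map_def lookup_add lookup_pm_scale scale_left_distrib sum.distrib
        scale_sum_right)
qed

lemma tabloid_map_perm_tabloids:
  assumes t: "\<tau> permutes UNIV"
  shows "tabloid_map r x (perm_tabloids \<tau> w) = act \<tau> (tabloid_map r x w)"
proof -
  have "tabloid_map r x (perm_tabloids \<tau> w) =
      (\<Sum>\<sigma>\<in>perms. Poly_Mapping.lookup w (r \<circ> inv (\<tau> \<circ> \<sigma>) \<circ> \<tau>) *s act (\<tau> \<circ> \<sigma>) x)"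
    unfolding tabloid_map_def
    by (subst sum_perms_left[OF t, symmetric]) (simp add: lookup_perm_tabloids[OF t])
  also have "\<dots> = (\<Sum>\<sigma>\<in>perms. Poly_Mapping.lookup w (r \<circ> inv \<sigma>) *s act \<tau> (act \<sigma> x))"
  proof (rule sum.cong)
    fix \<sigma> :: "'n \<Rightarrow> 'n" assume "\<sigma> \<in> perms"
    then have s: "\<sigma> permutes UNIV" by simp
    have "r \<circ> inv (\<tau> \<circ> \<sigma>) \<circ> \<tau> = r \<circ> inv \<sigma>"
      by (simp add: inv_comp_perm[OF t s] comp_assoc permutes_inv_o[OF t])
    then show "Poly_Mapping.lookup w (r \<circ> inv (\<tau> \<circ> \<sigma>) \<circ> \<tau>) *s act (\<tau> \<circ> \<sigma>) x =
        Poly_Mapping.lookup w (r \<circ> inv \<sigma>) *s act \<tau> (act \<sigma> x)"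
      by (simp only: act_comp[OF t s])
  qed simp
  also have "\<dots> = act \<tau> (tabloid_map r x w)"
    unfolding tabloid_map_def by (simp add: act_sum[OF t] act_scale[OF t])
  finally show ?thesis .
qed

definition row_sum :: "('n \<Rightarrow> nat) \<Rightarrow> 'v \<Rightarrow> 'v"
  where "row_sum r x = (\<Sum>\<eta>\<in>{\<eta>. \<eta> permutes UNIV \<and> r \<circ> \<eta> = r}. act \<eta> x)"

lemma tabloid_map_single: "tabloid_map r x (Poly_Mapping.single r c) = c *s row_sum r x"
proof -
  have "r = r \<circ> inv \<sigma> \<longleftrightarrow> r \<circ> \<sigma> = r" if "\<sigma> permutes UNIV" for \<sigma>
    using permutes_inv_o[OF that] by (metis comp_assoc comp_id)
  then have "tabloid_map r x (Poly_Mapping.single r c) = (\<Sum>\<sigma>\<in>perms. if r \<circ> \<sigma> = r then c *s act \<sigma> x else 0)"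
    unfolding tabloid_map_def by (intro sum.cong) (auto simp: lookup_single when_def)
  also have "\<dots> = (\<Sum>\<sigma>\<in>{\<sigma>\<in>perms. r \<circ> \<sigma> = r}. c *s act \<sigma> x)"
    by (rule sum.inter_filter[OF finite_perms, symmetric])
  also have "{\<sigma>\<in>perms. r \<circ> \<sigma> = r} = {\<eta>. \<eta> permutes UNIV \<and> r \<circ> \<eta> = r}" by auto
  finally show ?thesis unfolding row_sum_def by (simp add: scale_sum_right)
qed

lemma tabloid_map_polytabloid:
  "tabloid_map (fst \<circ> t) x (polytabloid t) =
    (\<Sum>\<pi>\<in>column_stabilizer t. of_int (sign \<pi>) *s act \<pi> (row_sum (fst \<circ> t) x))"
proof -
  have "tabloid_map (fst \<circ> t) x (Poly_Mapping.single (fst \<circ> t \<circ> inv \<pi>) (of_int (sign \<pi>))) =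
      of_int (sign \<pi>) *s act \<pi> (row_sum (fst \<circ> t) x)" if "\<pi> \<in> column_stabilizer t" for \<pi>
  proof -
    have p: "\<pi> permutes UNIV" using that unfolding column_stabilizer_def by blast
    show ?thesis
      unfolding perm_tabloids_single[OF p, symmetric] tabloid_map_perm_tabloids[OF p] tabloid_map_single
      by (rule act_scale[OF p])
  qed
  then show ?thesis
    unfolding polytabloid_def module_hom.sum[OF linear_tabloid_map] by (intro sum.cong) auto
qed

text \<open>
  The Specht module is generated by one polytabloid. If this polytabloid is mapped to a nonzero
  multiple of \<open>x\<close>, then the image is the whole span of the orbit of \<open>x\<close>. Injectivity follows by
  counting dimensions: the Specht module is spanned by at most as many elements as are linearly
  independent in the image.
\<close>

lemma specht_iso_orbit_span:
  assumes t: "tableau l t"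
    and c: "tabloid_map (fst \<circ> t) x (polytabloid t) = c *s x" "c \<noteq> 0"
    and E': "tab.orbit_span (polytabloid t :: _ \<Rightarrow>\<^sub>0 'k) \<subseteq> pm.span E'" "finite E'" "card E' \<le> card E"
    and E: "independent E" "E \<subseteq> orbit_span x"
  shows "(specht l :: ('n, 'k, _) rep) \<cong>\<^sub>R subrep (orbit_span x)"
proof -
  let ?\<psi> = "tabloid_map (fst \<circ> t) x" and ?e = "polytabloid t :: _ \<Rightarrow>\<^sub>0 'k"
  let ?S = "tab.orbit_span ?e"
  interpret \<psi>: module_hom pm_scale scale ?\<psi> by (rule linear_tabloid_map)
  have "?\<psi> ` ?S = span (?\<psi> ` {perm_tabloids \<sigma> ?e |\<sigma>. \<sigma> permutes UNIV})"
    unfolding tab.orbit_span_def by (rule \<psi>.span_image[symmetric])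
  also have "?\<psi> ` {perm_tabloids \<sigma> ?e |\<sigma>. \<sigma> permutes UNIV} =
      (\<lambda>y. c *s y) ` {act \<sigma> x |\<sigma>. \<sigma> permutes UNIV}"
    unfolding setcompr_eq_image image_image
    by (intro image_cong) (simp_all add: tabloid_map_perm_tabloids c act_scale)
  also have "span \<dots> = orbit_span x"
    unfolding orbit_span_def using c(2)
    by (intro span_image_scale[of _ "\<lambda>_. c"])
      (auto simp: setcompr_eq_image finite_perms)
  finally have image: "?\<psi> ` ?S = orbit_span x" .
  obtain B where B: "B \<subseteq> ?S" "pm.independent B" "?S \<subseteq> pm.span B"
    using pm.maximal_independent_subset .
  have S: "pm.span B = ?S"
    using B pm.span_minimal[OF B(1) tab.subspace_orbit_span] by blast
  have fB: "finite B" and cB: "card B \<le> card E'"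
    using pm.independent_span_bound[OF E'(2) B(2)] B(1) E'(1) by auto
  have spanB: "span (?\<psi> ` B) = orbit_span x"
    unfolding \<psi>.span_image S image ..
  obtain C where C: "C \<subseteq> ?\<psi> ` B" "independent C" "?\<psi> ` B \<subseteq> span C"
    using maximal_independent_subset .
  have fC: "finite C" using C(1) fB finite_subset by blast
  have "span (?\<psi> ` B) \<subseteq> span C"
    using C(3) by (rule span_minimal) simp
  then have "card E \<le> card C"
    using independent_span_bound[OF fC E(1)] E(2) spanB by auto
  moreover have "card C \<le> card (?\<psi> ` B)"
    using C(1) fB by (intro card_mono) auto
  moreover have "card (?\<psi> ` B) \<le> card B"
    using fB by (rule card_image_le)
  ultimately have card: "card C = card (?\<psi> ` B)" "card (?\<psi> ` B) = card B"
    using cB E'(3) by auto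
  have "C = ?\<psi> ` B"
    using card_subset_eq[OF _ C(1) card(1)] fB by blast
  then have "independent (?\<psi> ` B)" using C(2) by simp
  moreover have "inj_on ?\<psi> B"
    using card(2) fB by (intro eq_card_imp_inj_on)
  ultimately have inj: "inj_on ?\<psi> ?S"
    using \<psi>.inj_on_span_iff_independent_image S by metis
  show ?thesis
    unfolding specht_eq_orbit_span[OF t]
    by (rule rep_isoI[of ?\<psi>])
      (simp_all add: bij_betw_def inj image \<psi>.add \<psi>.scale tabloid_map_perm_tabloids)
qed

end

section \<open>The three types of reflection representations\<close>

context reflection_action
begin

lemma root_neq_0: "root a b x \<Longrightarrow> x \<noteq> 0"
  and root_neq: "root a b x \<Longrightarrow> a \<noteq> b"
  and root_swap_self: "root a b x \<Longrightarrow> swap a b x = - x"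
  and root_mem: "root a b x \<Longrightarrow> x \<in> U"
  unfolding root_def by auto

lemma mem_orbit_span: "x \<in> orbit_span x"
  using act_mem_orbit_span[OF permutes_id] by (simp only: act_id)

text \<open>
  Each row permutation contributes \<open>x\<close> or \<open>2 x\<close> to the difference, so that nothing cancels in
  characteristic zero.
\<close>

lemma row_sum_minus_swap:
  assumes "\<And>\<eta>. \<eta> permutes UNIV \<Longrightarrow> r \<circ> \<eta> = r \<Longrightarrow>
      act \<eta> x - swap a b (act \<eta> x) = x \<or> act \<eta> x - swap a b (act \<eta> x) = x + x"
  obtains k where "k \<noteq> 0" "row_sum r x - swap a b (row_sum r x) = k *s x"
proof -
  let ?R = "{\<eta> :: 'n \<Rightarrow> 'n. \<eta> permutes UNIV \<and> r \<circ> \<eta> = r}"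
  let ?d = "\<lambda>\<eta>. act \<eta> x - swap a b (act \<eta> x)"
  define g where "g \<eta> = (if ?d \<eta> = x then 1 else 2 :: nat)" for \<eta>
  have fin: "finite ?R" by (rule finite_subset[OF _ finite_perms]) auto
  have id: "id \<in> ?R" using permutes_id by auto
  have "?d \<eta> = of_nat (g \<eta>) *s x" if "\<eta> \<in> ?R" for \<eta>
  proof -
    have "2 *s x = x + x"
      by (metis one_add_one scale_left_distrib scale_one)
    then show ?thesis
      using assms[of \<eta>] that unfolding g_def by auto
  qed
  then have "(\<Sum>\<eta>\<in>?R. ?d \<eta>) = of_nat (\<Sum>\<eta>\<in>?R. g \<eta>) *s x"
    by (simp add: scale_sum_left)
  moreover have "row_sum r x - swap a b (row_sum r x) = (\<Sum>\<eta>\<in>?R. ?d \<eta>)"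
    unfolding row_sum_def by (simp add: act_sum[OF transpose_permutes] sum_subtractf)
  moreover have "(\<Sum>\<eta>\<in>?R. g \<eta>) > 0"
  proof (rule sum_pos[OF fin])
    show "?R \<noteq> {}" using id by blast
  qed (simp add: g_def)
  ultimately show ?thesis
    using that[of "of_nat (\<Sum>\<eta>\<in>?R. g \<eta>)"] by (simp only: of_nat_eq_0_iff neq0_conv)
qed

subsection \<open>The sign representation\<close>

text \<open>
  The permutations act on the root by their signs. On the other side, left translation of the
  summation shows that they act by their signs also on the polytabloid of a single column.
\<close>

lemma sign_type:
  assumes r: "root a b x" and neg: "\<And>c d. c \<noteq> d \<Longrightarrow> swap c d x = - x"
  shows "(specht (replicate CARD('n) 1) :: ('n, 'k, _) rep) \<cong>\<^sub>R subrep (orbit_span x)"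
    and "rep_closed (specht (replicate CARD('n) 1) :: ('n, 'k, _) rep)"
proof -
  obtain f where f: "bij_betw f (UNIV :: 'n set) {..<CARD('n)}"
    using ex_bij_lessThan .
  let ?t = "\<lambda>x. (f x, 0::nat)"
  have inj: "inj f" using f by (rule bij_betw_imp_inj_on)
  have cells: "young_cells (replicate CARD('n) 1) = (\<lambda>i. (i, 0)) ` {..<CARD('n)}"
    unfolding young_cells_def by auto
  have t: "tableau (replicate CARD('n) 1) ?t"
    using f unfolding tableau_def cells bij_betw_def by (auto simp: inj_on_def image_iff)
  then show "rep_closed (specht (replicate CARD('n) 1) :: ('n, 'k, _) rep)"
    by (rule rep_closed_specht_of_tableau)
  have C: "column_stabilizer ?t = perms"
    unfolding column_stabilizer_def by auto
  have "{\<eta>. \<eta> permutes UNIV \<and> (fst \<circ> ?t) \<circ> \<eta> = fst \<circ> ?t} = {id}"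
    using inj permutes_id by (auto simp: fun_eq_iff inj_eq)
  then have row: "row_sum (fst \<circ> ?t) x = x"
    unfolding row_sum_def by (simp only: sum.insert sum.empty finite.emptyI empty_iff
        not_False_eq_True act_id add_0_right)
  have act: "act \<sigma> x = of_int (sign \<sigma>) *s x" if "\<sigma> permutes UNIV" for \<sigma>
    using act_negated_by_swaps[OF that neg] .
  have "tabloid_map (fst \<circ> ?t) x (polytabloid ?t) = (\<Sum>\<sigma>\<in>perms. x)"
    unfolding tabloid_map_polytabloid C row
  proof (rule sum.cong)
    fix \<sigma> :: "'n \<Rightarrow> 'n" assume "\<sigma> \<in> perms"
    then show "of_int (sign \<sigma>) *s act \<sigma> x = x"
      by (simp add: act flip: of_int_mult)
  qed simp
  then have map: "tabloid_map (fst \<circ> ?t) x (polytabloid ?t) = of_nat (card perms) *s x"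
    by (simp only: sum_constant_scale)
  let ?e = "polytabloid ?t :: _ \<Rightarrow>\<^sub>0 'k"
  have "perm_tabloids \<tau> ?e = pm_scale (of_int (sign \<tau>)) ?e" if t: "\<tau> permutes UNIV" for \<tau>
  proof -
    have "pm_scale (of_int (sign \<tau>)) ?e =
        (\<Sum>\<pi>\<in>perms. Poly_Mapping.single (fst \<circ> ?t \<circ> inv \<pi>) (of_int (sign \<tau>) * of_int (sign \<pi>)))"
      unfolding polytabloid_def C by (simp add: pm.scale_sum_right) (simp add: pm_scale_def)
    also have "\<dots> = (\<Sum>\<pi>\<in>perms. Poly_Mapping.single (fst \<circ> ?t \<circ> inv (\<tau> \<circ> \<pi>))
        (of_int (sign \<tau>) * of_int (sign (\<tau> \<circ> \<pi>))))"
      by (rule sum_perms_left[OF t, symmetric])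
    also have "\<dots> = (\<Sum>\<pi>\<in>perms. perm_tabloids \<tau> (Poly_Mapping.single (fst \<circ> ?t \<circ> inv \<pi>) (of_int (sign \<pi>))))"
    proof (rule sum.cong)
      fix \<pi> :: "'n \<Rightarrow> 'n" assume "\<pi> \<in> perms"
      then have p: "\<pi> permutes UNIV" by simp
      have "sign \<tau> * sign (\<tau> \<circ> \<pi>) = sign \<pi>"
        using sign_compose[OF permutation_UNIV[OF t] permutation_UNIV[OF p]] by simp
      then show "Poly_Mapping.single (fst \<circ> ?t \<circ> inv (\<tau> \<circ> \<pi>)) (of_int (sign \<tau>) * of_int (sign (\<tau> \<circ> \<pi>)) :: 'k) =
          perm_tabloids \<tau> (Poly_Mapping.single (fst \<circ> ?t \<circ> inv \<pi>) (of_int (sign \<pi>)))"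
        unfolding perm_tabloids_single[OF t] inv_comp_perm[OF t p] comp_assoc
        by (simp only: of_int_mult[symmetric])
    qed simp
    also have "\<dots> = perm_tabloids \<tau> ?e"
      unfolding polytabloid_def C by (rule tab.act_sum[OF t, symmetric])
    finally show ?thesis by simp
  qed
  then have "perm_tabloids \<tau> ?e \<in> pm.span {?e}" if "\<tau> permutes UNIV" for \<tau>
    using pm.span_scale[OF pm.span_base[OF singletonI]] that by metis
  then have "tab.orbit_span ?e \<subseteq> pm.span {?e}"
    unfolding tab.orbit_span_def by (intro pm.span_minimal pm.subspace_span) blast
  then show "(specht (replicate CARD('n) 1) :: ('n, 'k, _) rep) \<cong>\<^sub>R subrep (orbit_span x)"
    by (rule specht_iso_orbit_span[OF t map card_perms_neq_0, of _ "{x}"])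
      (use root_neq_0[OF r] mem_orbit_span in auto)
qed

subsection \<open>The standard representation\<close>

text \<open>
  The two assumptions on the root \<open>x\<close> of \<open>(a b)\<close> say that the vectors \<open>\<sigma> x\<close>, indexed by \<open>\<sigma> a\<close> and \<open>\<sigma> b\<close>,
  satisfy the relations of the differences \<open>e\<^sub>i - e\<^sub>j\<close> of unit vectors. A permutation that
  fixes \<open>a\<close> but not \<open>b\<close> maps \<open>x\<close> to a difference that the reflection in \<open>x\<close> changes by \<open>x\<close>.
\<close>

lemma standard_row:
  assumes r: "root a b x"
    and Q: "\<And>c. c \<notin> {a, b} \<Longrightarrow> swap b c x + swap a c x = x"
    and outer: "\<And>c d. c \<notin> {a, b} \<Longrightarrow> d \<notin> {a, b} \<Longrightarrow> c \<noteq> d \<Longrightarrow> swap c d x = x"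
    and e: "\<eta> permutes UNIV" "\<eta> a = a"
  shows "act \<eta> x - swap a b (act \<eta> x) = x \<or> act \<eta> x - swap a b (act \<eta> x) = x + x"
proof -
  have fixed: "act \<sigma> x = x" if s: "\<sigma> permutes UNIV" "\<sigma> a = a" "\<sigma> b = b" for \<sigma>
  proof (rule act_fixed_by_swaps)
    show "\<sigma> permutes UNIV - {a, b}"
      using s by (auto intro!: permutes_superset[OF s(1)])
  qed (use outer in auto)
  have ab: "a \<noteq> b" using r by (rule root_neq)
  show ?thesis
  proof (cases "\<eta> b = b")
    case True
    then show ?thesis
      using fixed[OF e True] root_swap_self[OF r] by simp
  next
    case False
    define c where "c = \<eta> b"
    have c: "c \<notin> {a, b}"
      using False e ab permutes_inj[OF e(1)] unfolding c_def by (metis inj_eq insert_iff singletonD)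
    have p: "transpose b c \<circ> \<eta> permutes UNIV"
      using e(1) by (intro permutes_compose transpose_permutes)
    have "act (transpose b c \<circ> \<eta>) x = x"
      by (rule fixed[OF p]) (use c e ab in \<open>auto simp: c_def\<close>)
    then have "swap b c (act \<eta> x) = x"
      by (simp only: act_comp[OF transpose_permutes e(1)])
    then have y: "act \<eta> x = swap b c x"
      by (metis swap_swap)
    have "transpose a b b = a" "transpose a b c = c" using c by auto
    then have "swap a b (swap b c x) = - swap a c x"
      using act_swap[OF transpose_permutes, of a b b c x] root_swap_self[OF r] by (simp add: swap_neg)
    then show ?thesis
      using Q[OF c] y by simp
  qed
qed

text \<open>
  In the model above these are the vectors \<open>e\<^sub>c - e\<^sub>b\<close>. Applying \<open>1 - (c b)\<close> to a linear relation
  with coefficients \<open>\<alpha>\<close> gives \<open>(\<alpha>\<^sub>c + \<Sum>\<alpha>) (e\<^sub>c - e\<^sub>b) = 0\<close>. So all coefficients equal \<open>- \<Sum>\<alpha>\<close>, and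
  summing them up yields \<open>n \<Sum>\<alpha> = 0\<close>.
\<close>

lemma standard_independent:
  assumes r: "root a b x"
    and Q: "\<And>c. c \<notin> {a, b} \<Longrightarrow> swap b c x + swap a c x = x"
    and outer: "\<And>c d. c \<notin> {a, b} \<Longrightarrow> d \<notin> {a, b} \<Longrightarrow> c \<noteq> d \<Longrightarrow> swap c d x = x"
  shows "independent ((\<lambda>c. swap a c x) ` (UNIV - {b}))"
    and "card ((\<lambda>c. swap a c x) ` (UNIV - {b})) = CARD('n) - 1"
proof -
  let ?A = "UNIV - {b}" and ?g = "\<lambda>c. swap a c x"
  have ab: "a \<noteq> b" using r by (rule root_neq)
  have swap_same: "swap c c y = y" for c y
    using act_id[of y] by (simp add: id_def)
  have groot: "root c b (?g c)" if "c \<noteq> b" for c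
    using root_swap[OF r, of a c] ab that by simp
  have perm: "swap d c (?g d) = ?g c" if "c \<noteq> b" "d \<noteq> b" "c \<noteq> d" for c d
  proof -
    consider "c = a" | "d = a" | "c \<noteq> a" "d \<noteq> a" by blast
    then show ?thesis
    proof cases
      case 1
      then show ?thesis using swap_same by (simp add: swap_commute[of d a])
    next
      case 2
      then show ?thesis using swap_same by simp
    next
      case 3
      have "transpose d c a = a" "transpose d c d = c" using 3 by auto
      then have "swap d c (swap a d x) = swap a c (swap d c x)"
        using act_swap[OF transpose_permutes[of d c], of a d x] by simp
      then show ?thesis using outer[of d c] that 3 by simp
    qed
  qed
  have diff: "swap c b (?g d) = ?g d - ?g c" if "c \<noteq> b" "d \<noteq> b" "c \<noteq> d" for c d
  proof -
    let ?s = "transpose a d"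
    have sb: "?s b = b" "?s a = d" using ab that by auto
    have "?s c \<notin> {a, b}"
      using that ab by (auto simp: transpose_def)
    then have "swap a d (swap b (?s c) x + swap a (?s c) x) = swap a d x"
      using Q by simp
    then have "swap b c (?g d) + swap d c (?g d) = ?g d"
      using act_swap[OF transpose_permutes[of a d], of _ "?s c" x] by (simp add: swap_add sb)
    then show ?thesis
      using perm[OF that] by (simp add: swap_commute[of c b] eq_diff_eq)
  qed
  have zero: "\<alpha> c = 0" if 0: "(\<Sum>c\<in>?A. \<alpha> c *s ?g c) = 0" and c: "c \<in> ?A" for \<alpha> c
  proof -
    let ?S = "\<Sum>c\<in>?A. \<alpha> c"
    have eq: "\<alpha> c + ?S = 0" if c: "c \<in> ?A" for c
    proof -
      have "(\<Sum>d\<in>?A. \<alpha> d *s ?g d) - swap c b (\<Sum>d\<in>?A. \<alpha> d *s ?g d) =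
          (\<Sum>d\<in>?A. \<alpha> d *s (?g d - swap c b (?g d)))"
        by (simp add: act_sum[OF transpose_permutes] swap_scale sum_subtractf scale_right_diff_distrib)
      also have "\<dots> = (\<Sum>d\<in>?A. (\<alpha> d + (if d = c then \<alpha> d else 0)) *s ?g c)"
      proof (rule sum.cong)
        fix d assume d: "d \<in> ?A"
        show "\<alpha> d *s (?g d - swap c b (?g d)) = (\<alpha> d + (if d = c then \<alpha> d else 0)) *s ?g c"
        proof (cases "d = c")
          case True
          have rs: "swap c b (?g c) = - ?g c"
            using root_swap_self[OF groot] c by simp
          show ?thesis
            by (simp only: True rs simp_thms if_True diff_minus_eq_add scale_right_distrib scale_left_distrib)
        next
          case False
          then show ?thesis using diff[of c d] c d by simp
        qed
      qed simp
      also have "\<dots> = (?S + \<alpha> c) *s ?g c"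
        using c by (simp add: sum.distrib flip: scale_sum_left)
      finally have "(?S + \<alpha> c) *s ?g c = 0"
        unfolding 0 by (simp add: swap_zero)
      then show ?thesis
        using root_neq_0[OF groot, of c] c by (simp add: add.commute)
    qed
    have "\<alpha> d = - ?S" if "d \<in> ?A" for d
      using eq[OF that] by (simp add: eq_neg_iff_add_eq_0)
    then have "?S = (\<Sum>d\<in>?A. - ?S)" by (rule sum.cong[OF refl])
    also have "\<dots> = - (of_nat (card ?A) * ?S)" by simp
    finally have "?S + of_nat (card ?A) * ?S = 0"
      unfolding eq_neg_iff_add_eq_0 .
    then have "of_nat (Suc (card ?A)) * ?S = 0"
      unfolding of_nat_Suc distrib_right mult_1_left .
    then have "?S = 0"
      by (simp only: mult_eq_0_iff of_nat_eq_0_iff nat.distinct simp_thms)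
    then show "\<alpha> c = 0" using eq[OF c] by simp
  qed
  show "independent (?g ` ?A)"
    by (rule independent_family(2)) (simp, rule zero)
  show "card (?g ` ?A) = CARD('n) - 1"
  proof -
    have "inj_on ?g ?A"
      by (rule independent_family(1)) (simp, rule zero)
    from card_image[OF this] show ?thesis by simp
  qed
qed

text \<open>
  The tableau has the entry \<open>a\<close> in its second row and \<open>b\<close> above it, so that its column group is
  generated by \<open>(a b)\<close> and its polytabloid is the difference of the tabloids of \<open>a\<close> and \<open>b\<close>.
\<close>

lemma standard_type:
  assumes r: "root a b x"
    and Q: "\<And>c. c \<notin> {a, b} \<Longrightarrow> swap b c x + swap a c x = x"
    and outer: "\<And>c d. c \<notin> {a, b} \<Longrightarrow> d \<notin> {a, b} \<Longrightarrow> c \<noteq> d \<Longrightarrow> swap c d x = x"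
  shows "(specht [CARD('n) - 1, 1] :: ('n, 'k, _) rep) \<cong>\<^sub>R subrep (orbit_span x)"
    and "rep_closed (specht [CARD('n) - 1, 1] :: ('n, 'k, _) rep)"
proof -
  let ?l = "[CARD('n) - 1, 1]"
  have ab: "a \<noteq> b" using r by (rule root_neq)
  obtain h where h: "bij_betw h (UNIV - {a}) {..<CARD('n) - 1}"
    using ex_bij_lessThan[of "UNIV - {a}"] by auto
  have hb: "h b < CARD('n) - 1"
    using bij_betwE[OF h] ab by auto
  \<comment> \<open>the columns of the entries other than \<open>a\<close>, arranged so that \<open>b\<close> is in the column of \<open>a\<close>\<close>
  define f where "f = transpose 0 (h b) \<circ> h"
  have "bij_betw (transpose 0 (h b)) {..<CARD('n) - 1} {..<CARD('n) - 1}"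
    using hb by (intro permutes_imp_bij permutes_swap_id) auto
  then have f: "bij_betw f (UNIV - {a}) {..<CARD('n) - 1}"
    unfolding f_def by (rule bij_betw_trans[OF h])
  have fb: "f b = 0" unfolding f_def by simp
  have f_inj: "f y = f z \<Longrightarrow> y \<noteq> a \<Longrightarrow> z \<noteq> a \<Longrightarrow> y = z" for y z
    using bij_betw_imp_inj_on[OF f] by (auto dest: inj_onD)
  define t :: "'n \<Rightarrow> nat \<times> nat" where "t y = (if y = a then (1, 0) else (0, f y))" for y
  have cells: "young_cells ?l = insert (1, 0) (Pair 0 ` {..<CARD('n) - 1})"
    unfolding young_cells_def by (auto simp: less_Suc_eq nth_Cons')
  have t: "tableau ?l t"
    unfolding tableau_def bij_betw_def
  proof
    show "inj t" by (rule injI) (auto simp: t_def f_inj split: if_splits)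
    have "range t = insert (t a) (t ` (UNIV - {a}))" by auto
    also have "t ` (UNIV - {a}) = Pair 0 ` f ` (UNIV - {a})"
      unfolding image_image by (rule image_cong) (auto simp: t_def)
    also have "f ` (UNIV - {a}) = {..<CARD('n) - 1}"
      using f by (rule bij_betw_imp_surj_on)
    finally show "range t = young_cells ?l" by (simp only: cells) (simp add: t_def)
  qed
  then show "rep_closed (specht ?l :: ('n, 'k, _) rep)"
    by (rule rep_closed_specht_of_tableau)
  have C: "column_stabilizer t = {id, transpose a b}"
  proof (intro equalityI subsetI)
    fix \<pi> assume p: "\<pi> \<in> column_stabilizer t"
    then have pp: "\<pi> permutes UNIV" and col: "snd (t (\<pi> y)) = snd (t y)" for y
      unfolding column_stabilizer_def by auto
    have "\<pi> y = y" if y: "y \<notin> {a, b}" for y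
    proof -
      have "f y \<noteq> 0" using f_inj[of y b] y ab fb by auto
      then show ?thesis
        using col[of y] f_inj[of "\<pi> y" y] y unfolding t_def by (auto split: if_splits)
    qed
    then have "\<pi> permutes {a, b}"
      by (intro permutes_superset[OF pp]) auto
    then show "\<pi> \<in> {id, transpose a b}"
      unfolding permutes_doubleton_iff by blast
  next
    fix \<pi> assume p: "\<pi> \<in> {id, transpose a b}"
    have "snd (t (transpose a b y)) = snd (t y)" for y
      using fb by (cases "y = a"; cases "y = b") (auto simp: t_def)
    then show "\<pi> \<in> column_stabilizer t"
      using p permutes_id transpose_permutes unfolding column_stabilizer_def by auto
  qed
  have id: "id \<noteq> transpose a b" using ab by (metis transpose_eq_id_iff)
  \<comment> \<open>the tabloid with \<open>y\<close> in the second row\<close>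
  define \<delta> :: "'n \<Rightarrow> 'n \<Rightarrow> nat" where "\<delta> y = (\<lambda>z. if z = y then 1 else 0)" for y
  have \<delta>: "\<delta> y \<circ> inv \<sigma> = \<delta> (\<sigma> y)" if "\<sigma> permutes UNIV" for y \<sigma>
    using permutes_inverses[OF that] by (fastforce simp: \<delta>_def fun_eq_iff)
  have ft: "fst \<circ> t = \<delta> a" by (auto simp: t_def \<delta>_def)
  obtain k where k: "k \<noteq> 0" "row_sum (fst \<circ> t) x - swap a b (row_sum (fst \<circ> t) x) = k *s x"
  proof (rule row_sum_minus_swap[of "fst \<circ> t" x a b])
    fix \<eta> :: "'n \<Rightarrow> 'n" assume e: "\<eta> permutes UNIV" "fst \<circ> t \<circ> \<eta> = fst \<circ> t"
    have "\<delta> a (\<eta> a) = \<delta> a a" using e(2) unfolding ft by (metis comp_apply)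
    then have "\<eta> a = a" by (simp add: \<delta>_def split: if_splits)
    then show "act \<eta> x - swap a b (act \<eta> x) = x \<or> act \<eta> x - swap a b (act \<eta> x) = x + x"
      using standard_row[OF r Q outer e(1)] by blast
  qed
  have "tabloid_map (fst \<circ> t) x (polytabloid t) =
      of_int (sign (id :: 'n \<Rightarrow> 'n)) *s act id (row_sum (fst \<circ> t) x) +
      of_int (sign (transpose a b)) *s swap a b (row_sum (fst \<circ> t) x)"
    unfolding tabloid_map_polytabloid C using id by (simp only: sum.insert finite.intros
        insert_iff empty_iff simp_thms sum.empty add_0_right not_False_eq_True)
  also have "\<dots> = k *s x"
    using k(2) ab by (simp only: act_id sign_id sign_swap_id) simp
  finally have map: "tabloid_map (fst \<circ> t) x (polytabloid t) = k *s x" .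
  let ?s = "\<lambda>y. Poly_Mapping.single (\<delta> y) 1 :: ('n \<Rightarrow> nat) \<Rightarrow>\<^sub>0 'k"
  let ?e = "polytabloid t :: _ \<Rightarrow>\<^sub>0 'k"
  let ?E = "(\<lambda>y. ?s y - ?s b) ` (UNIV - {b})"
  have "?e = Poly_Mapping.single (\<delta> a \<circ> inv id) (of_int (sign (id :: 'n \<Rightarrow> 'n))) +
      Poly_Mapping.single (\<delta> a \<circ> inv (transpose a b)) (of_int (sign (transpose a b)))"
    unfolding polytabloid_def C ft using id by (simp only: sum.insert finite.intros
        insert_iff empty_iff simp_thms sum.empty add_0_right not_False_eq_True)
  also have "\<dots> = ?s a - ?s b"
    unfolding \<delta>[OF permutes_id] \<delta>[OF transpose_permutes] using ab
    by (simp add: sign_swap_id single_uminus)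
  finally have e: "?e = ?s a - ?s b" .
  have s_mem: "?s y - ?s z \<in> pm.span ?E" for y z
  proof -
    have *: "?s y - ?s b \<in> pm.span ?E" for y
      by (cases "y = b") (auto intro: pm.span_base pm.span_zero)
    have "(?s y - ?s b) - (?s z - ?s b) \<in> pm.span ?E"
      by (rule pm.span_diff[OF * *])
    then show ?thesis by simp
  qed
  have "perm_tabloids \<sigma> ?e \<in> pm.span ?E" if s: "\<sigma> permutes UNIV" for \<sigma>
    unfolding e tab.act_diff[OF s] perm_tabloids_single[OF s] \<delta>[OF s] by (rule s_mem)
  then have "tab.orbit_span ?e \<subseteq> pm.span ?E"
    unfolding tab.orbit_span_def by (intro pm.span_minimal) auto
  then show "(specht ?l :: ('n, 'k, _) rep) \<cong>\<^sub>R subrep (orbit_span x)"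
  proof (rule specht_iso_orbit_span[OF t map k(1)])
    show "independent ((\<lambda>c. swap a c x) ` (UNIV - {b}))"
      by (rule standard_independent[OF r Q outer])
    show "card ?E \<le> card ((\<lambda>c. swap a c x) ` (UNIV - {b}))"
      using card_image_le[of "UNIV - {b}" "\<lambda>y. ?s y - ?s b"] standard_independent(2)[OF r Q outer]
      by simp
    show "(\<lambda>c. swap a c x) ` (UNIV - {b}) \<subseteq> orbit_span x"
      using act_mem_orbit_span[OF transpose_permutes] by auto
  qed simp
qed

subsection \<open>The two-dimensional representation for four variables\<close>

text \<open>
  The product of the commuting reflections \<open>(a b)\<close> and \<open>(c d)\<close> with a common root is unipotent of
  finite order, hence trivial in characteristic zero.
\<close>

lemma common_root_swap_eq:
  assumes r: "root a b x" "root c d x" and disj: "{a, b} \<inter> {c, d} = {}" and y: "y \<in> U"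
  shows "swap a b y = swap c d y"
proof -
  have mem: "y - swap a b y \<in> U" for a b
    using y stableD[OF stable_U transpose_permutes y] subspace_U by (auto intro: subspace_diff)
  have neg: "swap a b (y - swap a b y) = - (y - swap a b y)" for a b
    by (simp add: swap_diff)
  obtain k where k: "y - swap a b y = k *s x"
    using root_multiple[OF r(1) mem neg] .
  obtain k' where k': "y - swap c d y = k' *s x"
    using root_multiple[OF r(2) mem neg] .
  have s: "swap a b y = y - k *s x" "swap c d y = y - k' *s x"
    using k k' by (simp_all add: algebra_simps)
  have sx: "swap a b x = - x" "swap c d x = - x"
    using r root_swap_self by blast+
  have u: "swap a b (swap c d y) = y + (k' - k) *s x"
    by (simp add: s swap_diff swap_scale sx scale_left_diff_distrib algebra_simps)
  have u': "swap c d (swap a b y) = y + (k - k') *s x"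
    by (simp add: s swap_diff swap_scale sx scale_left_diff_distrib algebra_simps)
  have "transpose a b c = c" "transpose a b d = d" using disj by auto
  then have "swap a b (swap c d y) = swap c d (swap a b y)"
    using act_swap[OF transpose_permutes[of a b], of c d y] by simp
  then have "(k' - k) *s x = (k - k') *s x"
    using u u' by simp
  then have "k' - k = k - k'"
    using root_neq_0[OF r(1)] by simp
  then have "2 * k = 2 * k'" by (simp add: algebra_simps)
  then have "k = k'" by simp
  then show ?thesis using s by simp
qed

lemma permutes_fixing_two:
  assumes univ: "UNIV = {a, b, c, d :: 'n}" and p: "\<pi> permutes UNIV" "\<pi> a = a" "\<pi> b = b"
  shows "\<pi> = id \<or> \<pi> = transpose c d"
proof -
  have "\<pi> permutes {c, d}"
    by (rule permutes_superset[OF p(1)]) (use univ p in auto)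
  then show ?thesis unfolding permutes_doubleton_iff .
qed

lemma permutes_preserving_pairs:
  assumes univ: "UNIV = {a, b, c, d :: 'n}" and dist: "distinct [a, b, c, d]"
    and p: "\<pi> permutes UNIV" "\<pi> a \<in> {a, b}" "\<pi> b \<in> {a, b}"
  shows "\<pi> \<in> {id, transpose a b, transpose c d, transpose a b \<circ> transpose c d}"
proof (cases "\<pi> a = a")
  case True
  then have "\<pi> b = b"
    using p(3) dist permutes_inj[OF p(1)] by (metis distinct_length_2_or_more inj_eq insert_iff singletonD)
  then show ?thesis using permutes_fixing_two[OF univ p(1) True] by blast
next
  case False
  then have a: "\<pi> a = b" using p(2) by blast
  then have b: "\<pi> b = a"
    using p(3) dist permutes_inj[OF p(1)] by (metis distinct_length_2_or_more inj_eq insert_iff singletonD)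
  let ?q = "transpose a b \<circ> \<pi>"
  have "?q permutes UNIV" using p(1) by (intro permutes_compose transpose_permutes)
  then have "?q = id \<or> ?q = transpose c d"
    using permutes_fixing_two[OF univ] a b by simp
  moreover have "\<pi> = transpose a b \<circ> ?q"
    by (simp add: fun_eq_iff)
  ultimately have "\<pi> = transpose a b \<circ> id \<or> \<pi> = transpose a b \<circ> transpose c d" by metis
  then show ?thesis by auto
qed

text \<open>
  As \<open>(a b)\<close> and \<open>(c d)\<close> act in the same way, so do \<open>(a c)\<close> and \<open>(b d)\<close>, and the action factors
  through \<open>S\<^sub>3\<close>. The tableau has the columns \<open>a, b\<close> and \<open>c, d\<close>; every row permutation acts on the
  root \<open>x\<close> as the identity or as \<open>(a c)\<close>. The Specht module is spanned by two elements because
  polytabloids are differences of the three sums \<open>S\<close> that correspond to the partitions of the four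
  entries into pairs.
\<close>

lemma exceptional_type:
  assumes r: "root a b x" and univ: "UNIV = {a, b, c, d :: 'n}" and dist: "distinct [a, b, c, d]"
    and Q: "swap b c x + swap a c x = x" and cd: "swap c d x = - x"
  shows "(specht [2, 2] :: ('n, 'k, _) rep) \<cong>\<^sub>R subrep (orbit_span x)"
    and "rep_closed (specht [2, 2] :: ('n, 'k, _) rep)"
    and "independent {x, swap a c x}" and "card {x, swap a c x} = 2"
proof -
  have x0: "x \<noteq> 0" and sab: "swap a b x = - x" and xU: "x \<in> U"
    using root_neq_0[OF r] root_swap_self[OF r] root_mem[OF r] by auto
  have univ': "UNIV = {a, c, b, d}" using univ by auto
  have rcd: "root c d x" using dist x0 xU cd unfolding root_def by auto
  have eq1: "swap a b y = swap c d y" if "y \<in> U" for y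
    using common_root_swap_eq[OF r rcd _ that] dist by auto
  have eq2: "swap a c y = swap b d y" if y: "y \<in> U" for y
  proof -
    have "transpose b c a = a" "transpose b c d = d" using dist by auto
    moreover have "swap b c (swap a b (swap b c y)) = swap b c (swap c d (swap b c y))"
      using eq1[OF stableD[OF stable_U transpose_permutes y]] by simp
    ultimately show ?thesis
      using act_swap[OF transpose_permutes[of b c], of a b "swap b c y"]
        act_swap[OF transpose_permutes[of b c], of c d "swap b c y"] by simp
  qed
  have indep: "swap a c x \<noteq> k *s x" for k
  proof
    assume k: "swap a c x = k *s x"
    then have k1: "k = 1 \<or> k = -1" using swap_eigenvalue x0 by blast
    have "swap b c x = (1 - k) *s x"
      using Q k by (simp add: scale_left_diff_distrib eq_diff_eq)
    moreover have "1 - k \<noteq> 1" "1 - k \<noteq> -1" using k1 by auto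
    ultimately show False using swap_neq_scale x0 by blast
  qed
  then have "swap a c x \<notin> span {x}"
    unfolding span_singleton by auto
  then have "independent {swap a c x, x}"
    by (rule independent_insertI) (simp only: dependent_single x0 simp_thms)
  then show indep2: "independent {x, swap a c x}"
    by (subst insert_commute)
  have "x \<noteq> swap a c x" using indep[of 1] unfolding scale_one by (rule not_sym)
  then show card2: "card {x, swap a c x} = 2" by (simp add: card_insert_if)

  define t :: "'n \<Rightarrow> nat \<times> nat"
    where "t y = (if y = a then (0, 0) else if y = b then (1, 0) else if y = c then (0, 1) else (1, 1))"
    for y
  have tv: "t a = (0, 0)" "t b = (1, 0)" "t c = (0, 1)" "t d = (1, 1)"
    using dist unfolding t_def by auto
  have cells: "young_cells [2, 2] = {(0, 0), (1, 0), (0, 1), (1, 1)}"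
    unfolding young_cells_def by (auto simp: less_Suc_eq nth_Cons' numeral_2_eq_2)
  have t: "tableau [2, 2] t"
    unfolding tableau_def bij_betw_def cells
  proof
    show "inj t" by (rule injI) (use univ in \<open>auto simp: t_def split: if_splits\<close>)
    show "range t = {(0, 0), (1, 0), (0, 1), (1, 1)}" unfolding univ by (simp add: tv)
  qed
  then show "rep_closed (specht [2, 2] :: ('n, 'k, _) rep)"
    by (rule rep_closed_specht_of_tableau)
  let ?ab = "transpose a b" and ?cd = "transpose c d"
  have all: "P a \<Longrightarrow> P b \<Longrightarrow> P c \<Longrightarrow> P d \<Longrightarrow> P y" for P y
    using univ by (metis UNIV_I insertE singletonD)
  have C: "column_stabilizer t = {id, ?ab, ?cd, ?ab \<circ> ?cd}"
  proof (intro equalityI subsetI)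
    fix \<pi> assume "\<pi> \<in> column_stabilizer t"
    then have pp: "\<pi> permutes UNIV" and col: "\<And>y. snd (t (\<pi> y)) = snd (t y)"
      unfolding column_stabilizer_def by auto
    have "\<pi> y \<in> {a, b}" if "snd (t y) = 0" for y
      using col[of y] that unfolding t_def by (auto split: if_splits)
    then show "\<pi> \<in> {id, ?ab, ?cd, ?ab \<circ> ?cd}"
      by (intro permutes_preserving_pairs[OF univ dist pp]) (simp_all add: tv)
  next
    fix \<pi> assume p: "\<pi> \<in> {id, ?ab, ?cd, ?ab \<circ> ?cd}"
    have "?ab \<circ> ?cd permutes UNIV"
      by (intro permutes_compose transpose_permutes)
    then have "\<pi> permutes UNIV" using p permutes_id transpose_permutes by auto
    moreover have sab: "snd (t (?ab y)) = snd (t y)" for y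
      by (rule all[of "\<lambda>y. snd (t (?ab y)) = snd (t y)"]) (use dist in \<open>auto simp: tv\<close>)
    moreover have scd: "snd (t (?cd y)) = snd (t y)" for y
      by (rule all[of "\<lambda>y. snd (t (?cd y)) = snd (t y)"]) (use dist in \<open>auto simp: tv\<close>)
    ultimately show "\<pi> \<in> column_stabilizer t"
      using p unfolding column_stabilizer_def by auto
  qed
  have vals: "id a = a" "?ab a = b" "?cd a = a" "(?ab \<circ> ?cd) a = b"
    "id c = c" "?ab c = c" "?cd c = d" "(?ab \<circ> ?cd) c = d"
    using dist by auto
  have dC: "id \<noteq> ?ab" "id \<noteq> ?cd" "id \<noteq> ?ab \<circ> ?cd" "?ab \<noteq> ?cd" "?ab \<noteq> ?ab \<circ> ?cd" "?cd \<noteq> ?ab \<circ> ?cd"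
    using vals dist by (metis distinct_length_2_or_more)+
  have sumC: "(\<Sum>\<pi>\<in>column_stabilizer t. h \<pi>) = h id + (h ?ab + (h ?cd + h (?ab \<circ> ?cd)))"
    for h :: "('n \<Rightarrow> 'n) \<Rightarrow> 'z::comm_monoid_add"
    unfolding C using dC by (simp only: sum.insert finite.intros
        insert_iff empty_iff simp_thms sum.empty add_0_right not_False_eq_True)
  have signs: "sign (id :: 'n \<Rightarrow> 'n) = 1" "sign ?ab = -1" "sign ?cd = -1" "sign (?ab \<circ> ?cd) = 1"
    using dist by (simp_all only: sign_compose[OF permutation_UNIV permutation_UNIV]
        transpose_permutes sign_swap_id sign_id) auto
  let ?F = "row_sum (fst \<circ> t) x"
  obtain k where k: "k \<noteq> 0" "?F - swap a b ?F = k *s x"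
  proof (rule row_sum_minus_swap[of "fst \<circ> t" x a b])
    fix \<eta> :: "'n \<Rightarrow> 'n" assume e: "\<eta> permutes UNIV" "fst \<circ> t \<circ> \<eta> = fst \<circ> t"
    have row: "fst (t (\<eta> y)) = fst (t y)" for y
      using e(2) by (metis comp_apply)
    have "\<eta> y \<in> {a, c}" if "fst (t y) = 0" for y
      using row[of y] that unfolding t_def by (auto split: if_splits)
    then have "\<eta> \<in> {id, transpose a c, transpose b d, transpose a c \<circ> transpose b d}"
      using dist by (intro permutes_preserving_pairs[OF univ' _ e(1)]) (auto simp: tv)
    moreover have "act (transpose a c \<circ> transpose b d) x = x"
      unfolding act_comp[OF transpose_permutes transpose_permutes] by (simp flip: eq2[OF xU])
    ultimately have "act \<eta> x = x \<or> act \<eta> x = swap a c x"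
      using eq2[OF xU] act_id[of x] by (elim insertE emptyE) simp_all
    moreover have "swap a b (swap a c x) = - swap b c x"
    proof -
      have "transpose a b c = c" using dist by auto
      then have "swap a b (swap a c x) = swap b c (swap a b x)"
        using act_swap[OF transpose_permutes[of a b], of a c x] by simp
      then show ?thesis by (simp add: sab swap_neg)
    qed
    ultimately show "act \<eta> x - swap a b (act \<eta> x) = x \<or> act \<eta> x - swap a b (act \<eta> x) = x + x"
      using Q by (auto simp: sab add.commute)
  qed
  have FU: "?F \<in> U"
    unfolding row_sum_def using stableD[OF stable_U _ xU] by (intro subspace_sum[OF subspace_U]) auto
  have "tabloid_map (fst \<circ> t) x (polytabloid t) =
      ?F + (- swap a b ?F + (- swap c d ?F + swap a b (swap c d ?F)))"
    unfolding tabloid_map_polytabloid sumC signs act_id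
      act_comp[OF transpose_permutes transpose_permutes] by simp
  also have "\<dots> = (?F - swap a b ?F) + (?F - swap a b ?F)"
    by (simp flip: eq1[OF FU])
  also have "\<dots> = (k + k) *s x"
    unfolding k(2) by (rule scale_left_distrib[symmetric])
  finally have map: "tabloid_map (fst \<circ> t) x (polytabloid t) = (k + k) *s x" .

  \<comment> \<open>the tabloid with \<open>y\<close> and \<open>z\<close> in the first row\<close>
  define T :: "'n \<Rightarrow> 'n \<Rightarrow> 'n \<Rightarrow> nat" where "T y z = (\<lambda>v. if v = y \<or> v = z then 0 else 1)" for y z
  have T: "T y z \<circ> inv \<sigma> = T (\<sigma> y) (\<sigma> z)" if "\<sigma> permutes UNIV" for y z \<sigma>
  proof -
    have "inv \<sigma> v = w \<longleftrightarrow> v = \<sigma> w" for v w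
      using permutes_inverses[OF that] by metis
    then show ?thesis by (simp add: T_def fun_eq_iff)
  qed
  have T_commute: "T y z = T z y" for y z by (auto simp: T_def)
  have ft: "fst \<circ> t = T a c"
  proof
    fix y show "(fst \<circ> t) y = T a c y"
      by (rule all[of "\<lambda>y. (fst \<circ> t) y = T a c y"]) (use dist in \<open>auto simp: tv T_def\<close>)
  qed
  define S :: "'n \<Rightarrow> 'n \<Rightarrow> 'n \<Rightarrow> 'n \<Rightarrow> ('n \<Rightarrow> nat) \<Rightarrow>\<^sub>0 'k"
    where "S p q u v = Poly_Mapping.single (T p q) 1 + Poly_Mapping.single (T u v) 1" for p q u v
  have S_perm: "perm_tabloids \<sigma> (S p q u v) = S (\<sigma> p) (\<sigma> q) (\<sigma> u) (\<sigma> v)"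
    if "\<sigma> permutes UNIV" for \<sigma> p q u v
    unfolding S_def tab.act_add[OF that] perm_tabloids_single[OF that] T[OF that] ..
  have S_swap: "S p q u v = S q p u v" "S p q u v = S p q v u" "S p q u v = S u v p q" for p q u v
    unfolding S_def by (simp_all add: T_commute[of p q] T_commute[of u v] add.commute)
  let ?P1 = "S b c a d" and ?P2 = "S a c b d" and ?P3 = "S a b c d"
  let ?e = "polytabloid t :: _ \<Rightarrow>\<^sub>0 'k"
  have abcd: "?ab \<circ> ?cd permutes UNIV"
    by (intro permutes_compose transpose_permutes)
  have e: "?e = ?P2 - ?P1"
    unfolding polytabloid_def sumC signs ft T[OF permutes_id] T[OF transpose_permutes] T[OF abcd] vals S_def
    by (simp add: single_uminus algebra_simps)
  have S_mem: "S p q u v \<in> {?P1, ?P2, ?P3}" if pq: "distinct [p, q, u, v]" for p q u v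
  proof -
    have last: "S p q u d \<in> {?P1, ?P2, ?P3}" if "distinct [p, q, u, d]" for p q u
    proof -
      have "p \<in> {a, b, c}" "q \<in> {a, b, c}" "u \<in> {a, b, c}"
        using that univ by auto
      moreover have "S q p u d = S p q u d" by (rule S_swap)
      ultimately show ?thesis
        using that S_swap(1)[of b a c d] S_swap(1)[of c a b d] S_swap(1)[of c b a d] by auto
    qed
    have "d \<in> {p, q, u, v}"
    proof (rule ccontr)
      assume "d \<notin> {p, q, u, v}"
      then have "{p, q, u, v} \<subseteq> {a, b, c}" using univ by auto
      then have "card {p, q, u, v} \<le> card {a, b, c}" by (intro card_mono) auto
      then show False using pq dist by simp
    qed
    then consider "v = d" | "u = d" | "q = d" | "p = d" by blast
    then show ?thesis
    proof cases
      case 1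
      then show ?thesis using last pq by simp
    next
      case 2
      then show ?thesis using last[of p q v] pq S_swap(2)[of p q d v] by auto
    next
      case 3
      then show ?thesis using last[of u v p] pq S_swap(3)[of p d u v] by auto
    next
      case 4
      then show ?thesis using last[of u v q] pq S_swap(3)[of d q u v] S_swap(2)[of u v d q] by auto
    qed
  qed
  let ?E = "{?P1 - ?P3, ?P2 - ?P3}"
  have diff_mem: "y - z \<in> pm.span ?E" if "y \<in> {?P1, ?P2, ?P3}" "z \<in> {?P1, ?P2, ?P3}" for y z
  proof -
    have *: "y - ?P3 \<in> pm.span ?E" if "y \<in> {?P1, ?P2, ?P3}" for y
      using that by (auto intro: pm.span_base pm.span_zero)
    have "(y - ?P3) - (z - ?P3) \<in> pm.span ?E"
      using that by (intro pm.span_diff *)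
    then show ?thesis by simp
  qed
  have kk: "k + k \<noteq> 0" using k(1) by simp
  have "perm_tabloids \<sigma> ?e \<in> pm.span ?E" if s: "\<sigma> permutes UNIV" for \<sigma>
    unfolding e tab.act_diff[OF s] S_perm[OF s]
    using dist permutes_inj[OF s] by (intro diff_mem S_mem) (auto simp: inj_eq)
  then have "tab.orbit_span ?e \<subseteq> pm.span ?E"
    unfolding tab.orbit_span_def by (intro pm.span_minimal) auto
  then show "(specht [2, 2] :: ('n, 'k, _) rep) \<cong>\<^sub>R subrep (orbit_span x)"
  proof (rule specht_iso_orbit_span[OF t map kk])
    show "card ?E \<le> card {x, swap a c x}"
      unfolding card2 by (simp add: card_insert_if)
    show "{x, swap a c x} \<subseteq> orbit_span x"
      using mem_orbit_span act_mem_orbit_span[OF transpose_permutes] by auto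
  qed (use indep2 in auto)
qed

subsection \<open>Classification\<close>

lemma ex_invariants_basis:
  assumes "U \<subseteq> span F" "finite F"
  obtains B where "finite B" "independent B" "B \<subseteq> invariants U" "span B = invariants U"
    and "rep_power (card B) (specht [CARD('n)] :: ('n, 'k, _) rep) \<cong>\<^sub>R subrep (invariants U)"
proof -
  obtain B where B: "B \<subseteq> invariants U" "independent B" "invariants U \<subseteq> span B"
    using maximal_independent_subset .
  have "B \<subseteq> span F" using B(1) assms(1) unfolding invariants_def by auto
  then have fB: "finite B"
    using independent_span_bound[OF assms(2) B(2)] by blast
  have sB: "span B = invariants U"
    using B(3) span_minimal[OF B(1) subspace_invariants[OF subspace_U]] by auto
  have "rep_power (card B) (specht [CARD('n)] :: ('n, 'k, _) rep) \<cong>\<^sub>R subrep (span B)"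
    using B(1) by (intro rep_power_trivial_iso[OF fB B(2)]) (auto simp: invariants_def)
  then show ?thesis using that fB B(2,1) sB by simp
qed

lemma root_decomposition:
  assumes r: "root a b x" and F: "U \<subseteq> span F" "finite F"
    and W: "W \<cong>\<^sub>R subrep (orbit_span x)" "rep_closed W"
    and E: "independent E" "finite E" "E \<subseteq> orbit_span x"
  obtains m where "card E + m \<le> card F"
    and "subrep U \<cong>\<^sub>R W \<oplus>\<^sub>R rep_power m (specht [CARD('n)] :: ('n, 'k, _) rep)"
proof -
  obtain B where B': "finite B" "independent B" "B \<subseteq> invariants U" "span B = invariants U"
    and iso: "rep_power (card B) (specht [CARD('n)] :: ('n, 'k, _) rep) \<cong>\<^sub>R subrep (invariants U)"
    by (rule ex_invariants_basis[OF F])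
  note B = B'(2,1,3)
  let ?W = "W \<oplus>\<^sub>R rep_power (card B) (specht [CARD('n)] :: ('n, 'k, _) rep)"
  have disj: "orbit_span x \<inter> invariants U \<subseteq> {0}"
    using orbit_span_Int_invariants[OF total_root[OF r]] .
  note N = subspace_orbit_span[of x] and M = subspace_invariants[OF subspace_U]
  have "E \<union> B \<subseteq> span F"
  proof (rule Un_least)
    show "E \<subseteq> span F"
      by (rule subset_trans[OF E(3) subset_trans[OF _ F(1)]])
        (rule orbit_span_subset[OF subspace_U stable_U root_mem[OF r]])
    show "B \<subseteq> span F"
      by (rule subset_trans[OF B(3) subset_trans[OF _ F(1)]])
        (unfold invariants_def, rule Collect_restrict)
  qed
  then have "card (E \<union> B) \<le> card F"
    using independent_span_bound[OF F(2) independent_Un(1)[OF E B N M disj]] by blast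
  then have card: "card E + card B \<le> card F"
    unfolding independent_Un(2)[OF E B N M disj] .
  have sum: "subrep (orbit_span x) \<oplus>\<^sub>R subrep (invariants U) \<cong>\<^sub>R subrep U"
    by (rule internal_direct_sum_iso[OF N M disj]) (rule span_root_plus_invariants[OF r])
  have "?W \<cong>\<^sub>R subrep U"
    by (rule rep_iso_trans[OF rep_iso_sum[OF W(1) iso] sum])
  then have "subrep U \<cong>\<^sub>R ?W"
    by (rule rep_iso_sym[OF _ rep_closed_sum[OF W(2) rep_closed_power[OF rep_closed_specht_trivial]]])
  with card show ?thesis by (rule that)
qed

text \<open>
  If no transposition acts as a reflection, the action is trivial. Otherwise let \<open>x\<close> be a root of
  \<open>(a b)\<close>. Either \<open>x\<close> is a root of all transpositions, or all triples are of type \<open>A\<^sub>2\<close>; in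
  the latter case disjoint transpositions either have a common root, which forces \<open>n = 4\<close>, or fix
  each other's roots. The bounds on the number of trivial summands come from the dimension.
\<close>

theorem reflection_action_classification:
  assumes F: "U \<subseteq> span F" "finite F" "card F \<le> CARD('n)" and U0: "U \<noteq> {0}"
  shows
    "(\<exists>m. 1 \<le> m \<and> m \<le> CARD('n) \<and>
        subrep U \<cong>\<^sub>R rep_power m (specht [CARD('n)] :: ('n, 'k, _) rep)) \<or>
     (\<exists>m. m \<le> CARD('n) - 1 \<and> subrep U \<cong>\<^sub>R
        (specht (replicate CARD('n) 1) :: ('n, 'k, _) rep) \<oplus>\<^sub>R rep_power m (specht [CARD('n)])) \<or>
     (CARD('n) \<ge> 2 \<and> (\<exists>m. m \<le> 1 \<and> subrep U \<cong>\<^sub>R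
        (specht [CARD('n) - 1, 1] :: ('n, 'k, _) rep) \<oplus>\<^sub>R rep_power m (specht [CARD('n)]))) \<or>
     (CARD('n) = 4 \<and> (\<exists>m. m \<le> 2 \<and> subrep U \<cong>\<^sub>R
        (specht [2, 2] :: ('n, 'k, _) rep) \<oplus>\<^sub>R rep_power m (specht [4])))"
proof (cases "\<forall>a b. \<forall>y\<in>U. a \<noteq> b \<longrightarrow> swap a b y = y")
  case True
  have "act \<sigma> y = y" if "\<sigma> permutes UNIV" "y \<in> U" for \<sigma> y
    using that True by (intro act_fixed_by_swaps[of \<sigma> UNIV]) auto
  then have inv: "invariants U = U" unfolding invariants_def by auto
  obtain B where B: "finite B" "independent B" "span B = U" "B \<subseteq> U"
    and iso: "rep_power (card B) (specht [CARD('n)] :: ('n, 'k, _) rep) \<cong>\<^sub>R subrep U"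
    using ex_invariants_basis[OF F(1,2)] unfolding inv by blast
  have "card B \<noteq> 0" using B U0 by (auto simp: card_eq_0_iff)
  moreover have "card B \<le> CARD('n)"
    using independent_span_bound[OF F(2) B(2) order_trans[OF B(4) F(1)]] F(3) by simp
  moreover have "subrep U \<cong>\<^sub>R rep_power (card B) (specht [CARD('n)] :: ('n, 'k, _) rep)"
    using iso by (rule rep_iso_sym) (intro rep_closed_power rep_closed_specht_trivial)
  ultimately show ?thesis
    by (intro disjI1 exI[of _ "card B"]) simp
next
  case False
  then obtain a b y where aby: "y \<in> U" "a \<noteq> b" "swap a b y \<noteq> y" by blast
  define x where "x = y - swap a b y"
  have "x \<in> U"
    unfolding x_def using aby(1) stableD[OF stable_U transpose_permutes aby(1)] subspace_U
    by (auto intro: subspace_diff)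
  then have r: "root a b x"
    using aby unfolding root_def x_def by (auto simp: swap_diff)
  have n2: "CARD('n) \<ge> 2"
    using card_mono[of UNIV "{a, b}"] aby(2) by simp
  show ?thesis
  proof (cases "\<forall>c d. c \<noteq> d \<longrightarrow> swap c d x = - x")
    case True
    then have neg: "\<And>c d. c \<noteq> d \<Longrightarrow> swap c d x = - x" by blast
    obtain m where "card {x} + m \<le> card F" "subrep U \<cong>\<^sub>R
        (specht (replicate CARD('n) 1) :: ('n, 'k, _) rep) \<oplus>\<^sub>R rep_power m (specht [CARD('n)])"
      by (rule root_decomposition[OF r F(1,2) sign_type[OF r neg], of "{x}"])
        (use root_neq_0[OF r] mem_orbit_span in auto)
    moreover from this have "m \<le> CARD('n) - 1" using F(3) by simp
    ultimately show ?thesis by blast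
  next
    case False
    have Q: "swap b c x + swap a c x = x" if c: "c \<notin> {a, b}" for c
    proof (rule ccontr)
      assume "swap b c x + swap a c x \<noteq> x"
      then have "swap b c x = - x" using root_triple[OF r, of c] c by auto
      then show False using root_all_negated[OF r c] False by blast
    qed
    show ?thesis
    proof (cases "\<exists>c d. c \<notin> {a, b} \<and> d \<notin> {a, b} \<and> c \<noteq> d \<and> swap c d x = - x")
      case True
      then obtain c d where cd: "c \<notin> {a, b}" "d \<notin> {a, b}" "c \<noteq> d" "swap c d x = - x" by blast
      have univ: "UNIV = {a, b, c, d}"
        using root_common_disjoint[OF r Q cd] .
      have dist: "distinct [a, b, c, d]" using cd root_neq[OF r] by auto
      have n4: "CARD('n) = 4"
        unfolding univ using distinct_card[OF dist] by simp
      note type = exceptional_type[OF r univ dist Q[OF cd(1)] cd(4)]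
      obtain m where "card {x, swap a c x} + m \<le> card F" "subrep U \<cong>\<^sub>R
          (specht [2, 2] :: ('n, 'k, _) rep) \<oplus>\<^sub>R rep_power m (specht [CARD('n)])"
        by (rule root_decomposition[OF r F(1,2) type(1,2,3)])
          (use mem_orbit_span act_mem_orbit_span[OF transpose_permutes] in auto)
      moreover from this have "m \<le> 2" using F(3) unfolding type(4) n4 by simp
      ultimately show ?thesis unfolding n4 by blast
    next
      case False
      have outer: "swap c d x = x" if "c \<notin> {a, b}" "d \<notin> {a, b}" "c \<noteq> d" for c d
        using root_disjoint[OF r that(1,2)] False that by blast
      note indep = standard_independent[OF r Q outer]
      obtain m where "card ((\<lambda>c. swap a c x) ` (UNIV - {b})) + m \<le> card F" "subrep U \<cong>\<^sub>R
          (specht [CARD('n) - 1, 1] :: ('n, 'k, _) rep) \<oplus>\<^sub>R rep_power m (specht [CARD('n)])"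
        by (rule root_decomposition[OF r F(1,2) standard_type[OF r Q outer] indep(1)])
          (use act_mem_orbit_span[OF transpose_permutes] in auto)
      moreover from this have "m \<le> 1" using F(3) n2 indep(2) by linarith
      ultimately show ?thesis using n2 by blast
    qed
  qed
qed

end

section \<open>Stable complete intersections\<close>

global_interpretation pol: linear_perm_action
  "pm_scale :: 'k::field_char_0 \<Rightarrow> ('n::finite, 'k) mpoly \<Rightarrow> _" perm_poly
  by standard (simp_all add: perm_poly_add perm_poly_pm_scale perm_poly_id perm_poly_comp del: comp_apply)

lemma subspace_of_ideal:
  assumes "is_ideal I"
  shows "pm.subspace (I :: ('n, 'k::field) mpoly set)"
  using module.subspace_0[OF module_times assms] module.subspace_add[OF module_times assms]
    module.subspace_scale[OF module_times assms]
  by (intro pm.subspaceI) (simp_all add: pm_scale_conv_mult)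

lemma quotient_rep_iso_complement:
  fixes I K U :: "('n::finite, 'k::field_char_0) mpoly set"
  assumes K: "is_ideal K" "perm_stable K" and I: "is_ideal I" "K \<subseteq> I"
    and U: "pm.subspace U" "pol.stable U" "U \<subseteq> I" "U \<inter> K \<subseteq> {0}" "\<forall>x\<in>I. \<exists>u\<in>U. x - u \<in> K"
  shows "quotient_rep I K \<cong>\<^sub>R pol.subrep U"
proof -
  have subK: "pm.subspace K" using K(1) by (rule subspace_of_ideal)
  have coset_eq: "coset x K = coset y K \<longleftrightarrow> x - y \<in> K" for x y
  proof
    assume "coset x K = coset y K"
    moreover have "x \<in> coset x K"
      unfolding coset_def using pm.subspace_0[OF subK] by (auto intro!: exI[of _ 0])
    ultimately obtain k where "x = y + k" "k \<in> K" unfolding coset_def by blast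
    then show "x - y \<in> K" by simp
  next
    assume xy: "x - y \<in> K"
    have "\<exists>l. x + k = y + l \<and> l \<in> K" if "k \<in> K" for k
      using pm.subspace_add[OF subK xy that] by (intro exI[of _ "x - y + k"]) simp
    moreover have "\<exists>l. y + k = x + l \<and> l \<in> K" if "k \<in> K" for k
      using pm.subspace_diff[OF subK that xy] by (intro exI[of _ "k - (x - y)"]) simp
    ultimately show "coset x K = coset y K" unfolding coset_def by blast
  qed
  have car: "rep_carrier (quotient_rep I K) = {coset f K | f. f \<in> I}"
    by (simp add: quotient_rep_def)
  have "pol.subrep U \<cong>\<^sub>R quotient_rep I K"
  proof (rule rep_isoI[of "\<lambda>u. coset u K"])
    have "inj_on (\<lambda>u. coset u K) U"
    proof (rule inj_onI)
      fix u v assume "u \<in> U" "v \<in> U" "coset u K = coset v K"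
      then have "u - v \<in> U \<inter> K"
        using pm.subspace_diff[OF U(1)] coset_eq by blast
      then show "u = v" using U(4) by auto
    qed
    moreover have "(\<lambda>u. coset u K) ` U = {coset f K | f. f \<in> I}"
    proof (intro equalityI subsetI)
      fix X assume "X \<in> {coset f K | f. f \<in> I}"
      then obtain f where f: "X = coset f K" "f \<in> I" by blast
      then obtain u where "u \<in> U" "f - u \<in> K" using U(5) by blast
      then show "X \<in> (\<lambda>u. coset u K) ` U" using f(1) coset_eq by blast
    qed (use U(3) in blast)
    ultimately show "bij_betw (\<lambda>u. coset u K) (rep_carrier (pol.subrep U)) (rep_carrier (quotient_rep I K))"
      unfolding bij_betw_def car by simp
  qed (simp_all add: quotient_rep_add[OF K(1)] quotient_rep_scale[OF K(1)] quotient_rep_act[OF _ K(2)])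
  then show ?thesis
    by (rule rep_iso_sym[OF _ pol.rep_closed_subrep[OF U(1,2)]])
qed

text \<open>
  A polynomial negated by the transposition \<open>(a b)\<close> is divisible by \<open>x\<^sub>a - x\<^sub>b\<close>. So two such
  polynomials in the ideal have a common factor in \<open>\<mm>\<close>.
\<close>

lemma antisymmetric_imp_dependent:
  fixes fs :: "('n::finite, 'k::field_char_0) mpoly list"
  defines "I \<equiv> ideal_gen (set fs)"
  assumes reg: "regular_sequence fs" and xI: "x \<in> I" "y \<in> I"
    and neg: "perm_poly (transpose a b) x = - x" "perm_poly (transpose a b) y = - y"
  shows "\<exists>c d. (c \<noteq> 0 \<or> d \<noteq> 0) \<and> pm_scale c x + pm_scale d y \<in> ideal_prod max_ideal I"
proof -
  let ?h = "Var a - Var b :: ('n, 'k) mpoly"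
  have factor: "\<exists>z'. z = ?h * z'" if "perm_poly (transpose a b) z = - z" for z :: "('n, 'k) mpoly"
  proof -
    have "?h dvd (z + z)"
      using Var_diff_dvd_diff_perm_poly_transpose[of a b z] that by simp
    then obtain w where w: "z + z = ?h * w" by (rule dvdE)
    have "z = Const (1 / 2) * (z + z)"
      unfolding distrib_left distrib_right[symmetric] single_add[symmetric] by simp
    also have "\<dots> = ?h * (Const (1 / 2) * w)"
      unfolding w by (simp only: mult.left_commute)
    finally show ?thesis by blast
  qed
  obtain x' y' where xy: "x = ?h * x'" "y = ?h * y'"
    using factor neg by blast
  have "?h \<in> max_ideal"
    unfolding max_ideal_def by (intro ideal_diff ideal_base) auto
  from common_factor_imp_dependent[OF reg this, of x' y'] xI show ?thesis
    unfolding I_def xy by blast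
qed

theorem proposition2p5:
  fixes I :: "('n::finite, 'k::field_char_0) mpoly set"
  assumes "is_ideal I"
    and "I \<noteq> {0}"
    and "homogeneous_ideal I"
    and "perm_stable I"
    and "complete_intersection_ideal I"
  defines "n \<equiv> CARD('n)"
    and "Q \<equiv> quotient_rep I (ideal_prod max_ideal I)"
  shows
    "(\<exists>m. 1 \<le> m \<and> m \<le> n \<and> Q \<cong>\<^sub>R rep_power m (specht [n])) \<or>
     (\<exists>m. m \<le> n - 1 \<and> Q \<cong>\<^sub>R specht (replicate n 1) \<oplus>\<^sub>R rep_power m (specht [n])) \<or>
     (n \<ge> 2 \<and> (\<exists>m. m \<le> 1 \<and> Q \<cong>\<^sub>R specht [n - 1, 1] \<oplus>\<^sub>R rep_power m (specht [n]))) \<or>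
     (n = 4 \<and> (\<exists>m. m \<le> 2 \<and> Q \<cong>\<^sub>R specht [2, 2] \<oplus>\<^sub>R rep_power m (specht [4])))"
proof -
  let ?K = "ideal_prod max_ideal I"
  obtain fs where reg: "regular_sequence fs" and I: "I = ideal_gen (set fs)"
    using assms(5) unfolding complete_intersection_ideal_def by blast
  have K: "is_ideal ?K" by (rule is_ideal_ideal_prod)
  have stK: "perm_stable ?K"
    using perm_stable_max_ideal assms(4) by (rule perm_stable_ideal_prod)
  have KI: "?K \<subseteq> I" using assms(1) by (rule ideal_prod_subset_right)
  have subI: "pm.subspace I" and subK: "pm.subspace ?K"
    using assms(1) K subspace_of_ideal by blast+
  have stable: "pol.stable I" "pol.stable ?K"
    using assms(4) stK unfolding pol.stable_def perm_stable_def by blast+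
  obtain U where U: "pm.subspace U" "pol.stable U" "U \<subseteq> I" "U \<inter> ?K \<subseteq> {0}"
    "\<forall>x\<in>I. \<exists>u\<in>U. x - u \<in> ?K"
    by (rule pol.ex_stable_complement[OF subI stable(1) subK stable(2) KI])
  interpret reflection_action pm_scale perm_poly U
  proof
    show "pm.subspace U" "pol.stable U" by fact+
    fix a b :: 'n and x y
    assume "a \<noteq> b" and xy: "x \<in> U" "y \<in> U"
      and neg: "perm_poly (transpose a b) x = - x" "perm_poly (transpose a b) y = - y"
    have "x \<in> ideal_gen (set fs)" "y \<in> ideal_gen (set fs)"
      using xy U(3) unfolding I by auto
    from antisymmetric_imp_dependent[OF reg this neg]
    obtain c d where cd: "c \<noteq> 0 \<or> d \<noteq> 0" "pm_scale c x + pm_scale d y \<in> ?K"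
      unfolding I by blast
    have "pm_scale c x + pm_scale d y \<in> U"
      using xy U(1) by (intro pm.subspace_add pm.subspace_scale)
    then have "pm_scale c x + pm_scale d y = 0" using cd(2) U(4) by blast
    then show "\<exists>c d. (c \<noteq> 0 \<or> d \<noteq> 0) \<and> pm_scale c x + pm_scale d y = 0"
      using cd(1) by blast
  qed
  have "\<forall>f\<in>set fs. \<exists>u\<in>U. f - u \<in> ?K"
    using U(5) unfolding I by (auto intro: ideal_base)
  then obtain u where u: "\<And>f. f \<in> set fs \<Longrightarrow> u f \<in> U \<and> f - u f \<in> ?K"
    by metis
  let ?F = "u ` set fs"
  have "x \<in> pm.span ?F" if x: "x \<in> U" for x
  proof -
    have "x \<in> ideal_gen (set fs)" using x U(3) unfolding I by blast
    then obtain \<alpha> where \<alpha>: "x - (\<Sum>i<length fs. Const (\<alpha> i) * fs ! i) \<in> ?K"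
      unfolding I by (rule ideal_gen_mod_max_ideal_prodE)
    let ?y = "\<Sum>i<length fs. pm_scale (\<alpha> i) (u (fs ! i))"
    have "(\<Sum>i<length fs. pm_scale (\<alpha> i) (fs ! i - u (fs ! i))) \<in> ?K"
      using u by (intro pm.subspace_sum[OF subK] pm.subspace_scale[OF subK]) simp
    from pm.subspace_add[OF subK \<alpha> this] have "x - ?y \<in> ?K"
      by (simp add: pm.scale_right_diff_distrib sum_subtractf flip: pm_scale_conv_mult)
    moreover have "?y \<in> U"
      using u by (intro pm.subspace_sum[OF U(1)] pm.subspace_scale[OF U(1)]) simp
    then have "x - ?y \<in> U"
      using x U(1) by (intro pm.subspace_diff)
    ultimately have "x = ?y" using U(4) by auto
    moreover have "?y \<in> pm.span ?F"
      by (intro pm.span_sum pm.span_scale) (auto intro: pm.span_base)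
    ultimately show ?thesis by simp
  qed
  then have span: "U \<subseteq> pm.span ?F" by blast
  have card: "card ?F \<le> CARD('n)"
    using card_image_le[of "set fs" u] card_length[of fs] regular_sequence_length_le[OF reg] by simp
  have "U \<noteq> {0}"
  proof
    assume "U = {0}"
    then have "I \<subseteq> ?K" using U(5) by force
    then have "?K = I" using KI by blast
    then show False
      using regular_sequence_max_ideal_prod_neq[OF reg] assms(2) unfolding I by blast
  qed
  note classification = reflection_action_classification[OF span _ card this]
  have Q: "Q \<cong>\<^sub>R pol.subrep U"
    unfolding Q_def using quotient_rep_iso_complement[OF K stK assms(1) KI U] .
  show ?thesis
    unfolding n_def using classification[OF finite_imageI[OF finite_set]]
    by (elim disjE exE conjE) (drule rep_iso_trans[OF Q], blast)+
qed

end
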